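(* Fix a monomial order on $F$. Let $g_1,\dots,g_{n-r}\in S$ be a homogeneous regular sequence of degrees $d_1,\dots,d_{n-r}$. Let $M\subsetneq F$ be the graded submodule generated by \[ \{g_ie_j: 1\le i\le n-r,\ 1\le j\le m\}\cup\{f_1,\dots,f_s\}, \] where the $f_i$ are homogeneous, $s\ge1$, and $D=\max_i\deg(f_i)\ge l$. Let $J=(x_1^{d_1},\dots,x_{n-r}^{d_{n-r}})\subseteq S$. If $Q$ is an $l$-standard cone decomposition of $N_M$, and $P$ is any $D$-exact cone decomposition of $N_{JF}$ with Macaulay constants $b_0,\dots,b_{n+1}$, then \[ 1+\deg(Q)\le\max\{b_1,\ d_1+\cdots+d_{n-r}+l-n+1\}. \] (When $P^+\neq\emptyset$, $b_1=1+\deg(P^+)$.)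
   Context: Standing notation. $S=\mathbb{K}[x_1,\dots,x_n]$ is standard graded, and $F=Se_1\oplus\cdots\oplus Se_m$ is a graded free module with $\deg(e_j)\ge0$ integers; $l=\max_j\deg(e_j)$. Monomials of $F$ are $x^\alpha e_j$ of degree $|\alpha|+\deg(e_j)$. For a submodule $M'\subseteq F$, $N_{M'}$ is the $\mathbb{K}$-span of the monomials of $F$ not in $\mathrm{in}_\prec(M')$. Since $JF$ is a monomial submodule, $N_{JF}$ is the span of the monomials not in $JF$. A regular sequence means each $g_i$ is a non-zerodivisor modulo $(g_1,\dots,g_{i-1})$ and $(g_1,\dots,g_{n-r})\ne S$. Cones. For a homogeneous $h\in F$ and $u\subseteq\{x_1,\dots,x_n\}$, the cone $C(h,u)=h\,\mathbb{K}[u]$ has degree $\deg h$ and dimension $|u|$. A cone decomposition of a subspace $T\subseteq F$ is a finite set $P$ of cones with $T=\bigoplus_{C\in P}C$; $\deg(P)=\max_{C\in P}\deg C$, and $P^+=\{C\in P:\dim C>0\}$. $P$ is $q$-standard if (1) no $C\in P^+$ has $\deg C<q$, and (2) for every $C\in P^+$ and every integer $d$ with $q\le d\le\deg C$ there is $C'\in P$ with $\deg C'=d$ and $\dim C'\ge\dim C$. $P$ is $q$-exact if it is $q$-standard and distinct cones of $P^+$ have distinct degrees. The Macaulay constants of a $q$-exact $P$ are $b_k=\max(\{q\}\cup\{1+\deg C: C\in P,\ \dim C\ge k\})$ for $k=0,\dots,n+1$. *)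

theory Defs
  imports Main "HOL-Library.Poly_Mapping"
begin

text \<open>Exponent vectors: alpha :: nat =>0 nat (variable x_(i+1) has index i, i < n).
  Polynomials of S: (nat =>0 nat) =>0 'k.  Module terms x^alpha e_(j+1): (alpha, j) with j < m.
  Elements of F: ((nat =>0 nat) * nat) =>0 'k.  degE j = deg(e_(j+1)).\<close>

type_synonym expo = "nat \<Rightarrow>\<^sub>0 nat"
type_synonym mterm = "expo \<times> nat"
type_synonym 'k poly = "expo \<Rightarrow>\<^sub>0 'k"
type_synonym 'k mvec = "mterm \<Rightarrow>\<^sub>0 'k"

definition tdeg :: "expo \<Rightarrow> nat" where
  "tdeg a = (\<Sum>i\<in>Poly_Mapping.keys a. Poly_Mapping.lookup a i)"

definition mtdeg :: "(nat \<Rightarrow> nat) \<Rightarrow> mterm \<Rightarrow> nat" where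
  "mtdeg degE t = tdeg (fst t) + degE (snd t)"

definition valid_expo :: "nat \<Rightarrow> expo \<Rightarrow> bool" where
  "valid_expo n a \<longleftrightarrow> Poly_Mapping.keys a \<subseteq> {..<n}"

definition valid_term :: "nat \<Rightarrow> nat \<Rightarrow> mterm \<Rightarrow> bool" where
  "valid_term n m t \<longleftrightarrow> valid_expo n (fst t) \<and> snd t < m"

definition Sring :: "nat \<Rightarrow> ('k::field) poly set" where
  "Sring n = {p. \<forall>a\<in>Poly_Mapping.keys p. valid_expo n a}"

definition Fmod :: "nat \<Rightarrow> nat \<Rightarrow> ('k::field) mvec set" where
  "Fmod n m = {v. \<forall>t\<in>Poly_Mapping.keys v. valid_term n m t}"

definition Ksub :: "nat set \<Rightarrow> ('k::field) poly set" where
  "Ksub u = {p. \<forall>a\<in>Poly_Mapping.keys p. Poly_Mapping.keys a \<subseteq> u}"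

definition mmult :: "('k::field) poly \<Rightarrow> 'k mvec \<Rightarrow> 'k mvec" where
  "mmult p v = (\<Sum>a\<in>Poly_Mapping.keys p. \<Sum>t\<in>Poly_Mapping.keys v.
      Poly_Mapping.single (a + fst t, snd t) (Poly_Mapping.lookup p a * Poly_Mapping.lookup v t))"

definition var_pow :: "nat \<Rightarrow> nat \<Rightarrow> expo" where
  "var_pow i d = Poly_Mapping.single i d"

definition hom_poly :: "('k::field) poly \<Rightarrow> nat \<Rightarrow> bool" where
  "hom_poly p d \<longleftrightarrow> (\<forall>a\<in>Poly_Mapping.keys p. tdeg a = d)"

definition hom_vec :: "(nat \<Rightarrow> nat) \<Rightarrow> ('k::field) mvec \<Rightarrow> nat \<Rightarrow> bool" where
  "hom_vec degE v d \<longleftrightarrow> (\<forall>t\<in>Poly_Mapping.keys v. mtdeg degE t = d)"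

text \<open>Degree of a nonzero homogeneous element (degree of any of its terms).\<close>
definition vdeg :: "(nat \<Rightarrow> nat) \<Rightarrow> ('k::field) mvec \<Rightarrow> nat" where
  "vdeg degE v = mtdeg degE (SOME t. t \<in> Poly_Mapping.keys v)"

inductive_set ideal_gen :: "nat \<Rightarrow> ('k::field) poly set \<Rightarrow> 'k poly set"
  for n :: nat and G :: "'k poly set" where
  ig_zero: "0 \<in> ideal_gen n G"
| ig_gen: "g \<in> G \<Longrightarrow> g \<in> ideal_gen n G"
| ig_add: "a \<in> ideal_gen n G \<Longrightarrow> b \<in> ideal_gen n G \<Longrightarrow> a + b \<in> ideal_gen n G"
| ig_mult: "p \<in> Sring n \<Longrightarrow> a \<in> ideal_gen n G \<Longrightarrow> p * a \<in> ideal_gen n G"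

inductive_set sub_gen :: "nat \<Rightarrow> ('k::field) mvec set \<Rightarrow> 'k mvec set"
  for n :: nat and G :: "'k mvec set" where
  sg_zero: "0 \<in> sub_gen n G"
| sg_gen: "g \<in> G \<Longrightarrow> g \<in> sub_gen n G"
| sg_add: "a \<in> sub_gen n G \<Longrightarrow> b \<in> sub_gen n G \<Longrightarrow> a + b \<in> sub_gen n G"
| sg_mult: "p \<in> Sring n \<Longrightarrow> a \<in> sub_gen n G \<Longrightarrow> mmult p a \<in> sub_gen n G"

inductive_set kspan :: "('k::field) mvec set \<Rightarrow> 'k mvec set"
  for A :: "'k mvec set" where
  ks_zero: "0 \<in> kspan A"
| ks_smult: "a \<in> A \<Longrightarrow> mmult (Poly_Mapping.single 0 c) a \<in> kspan A"
| ks_add: "a \<in> kspan A \<Longrightarrow> b \<in> kspan A \<Longrightarrow> a + b \<in> kspan A"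

definition regular_seq :: "nat \<Rightarrow> nat \<Rightarrow> (nat \<Rightarrow> ('k::field) poly) \<Rightarrow> bool" where
  "regular_seq n c g \<longleftrightarrow>
     (\<forall>i<c. g i \<in> Sring n \<and>
        (\<forall>f\<in>Sring n. g i * f \<in> ideal_gen n (g ` {..<i}) \<longrightarrow> f \<in> ideal_gen n (g ` {..<i})))
   \<and> 1 \<notin> ideal_gen n (g ` {..<c})"

definition monomial_order :: "nat \<Rightarrow> nat \<Rightarrow> (mterm \<Rightarrow> mterm \<Rightarrow> bool) \<Rightarrow> bool" where
  "monomial_order n m ord \<longleftrightarrow>
     (\<forall>s. valid_term n m s \<longrightarrow> \<not> ord s s)
   \<and> (\<forall>s t u. valid_term n m s \<longrightarrow> valid_term n m t \<longrightarrow> valid_term n m u \<longrightarrow>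
          ord s t \<longrightarrow> ord t u \<longrightarrow> ord s u)
   \<and> (\<forall>s t. valid_term n m s \<longrightarrow> valid_term n m t \<longrightarrow> s = t \<or> ord s t \<or> ord t s)
   \<and> (\<forall>a j b k c. valid_term n m (a, j) \<longrightarrow> valid_term n m (b, k) \<longrightarrow> valid_expo n c \<longrightarrow>
          ord (a, j) (b, k) \<longrightarrow> ord (a + c, j) (b + c, k))
   \<and> (\<forall>a j c. valid_term n m (a, j) \<longrightarrow> valid_expo n c \<longrightarrow> c \<noteq> 0 \<longrightarrow>
          ord (a, j) (a + c, j))"

definition lead_term :: "(mterm \<Rightarrow> mterm \<Rightarrow> bool) \<Rightarrow> ('k::field) mvec \<Rightarrow> mterm" where
  "lead_term ord v = (THE t. t \<in> Poly_Mapping.keys v \<and> (\<forall>s\<in>Poly_Mapping.keys v. s \<noteq> t \<longrightarrow> ord s t))"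

definition init_sub :: "nat \<Rightarrow> (mterm \<Rightarrow> mterm \<Rightarrow> bool) \<Rightarrow> ('k::field) mvec set \<Rightarrow> 'k mvec set" where
  "init_sub n ord M' =
     sub_gen n {Poly_Mapping.single (lead_term ord v) 1 | v. v \<in> M' \<and> v \<noteq> 0}"

definition Nspan :: "nat \<Rightarrow> nat \<Rightarrow> ('k::field) mvec set \<Rightarrow> 'k mvec set" where
  "Nspan n m A = kspan {Poly_Mapping.single t 1 | t. valid_term n m t \<and> Poly_Mapping.single t 1 \<notin> A}"

definition cone :: "('k::field) mvec \<times> nat set \<Rightarrow> 'k mvec set" where
  "cone C = {mmult p (fst C) | p. p \<in> Ksub (snd C)}"

definition cdeg :: "(nat \<Rightarrow> nat) \<Rightarrow> ('k::field) mvec \<times> nat set \<Rightarrow> nat" where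
  "cdeg degE C = vdeg degE (fst C)"

definition cdim :: "('k::field) mvec \<times> nat set \<Rightarrow> nat" where
  "cdim C = card (snd C)"

definition cone_decomp :: "nat \<Rightarrow> nat \<Rightarrow> (nat \<Rightarrow> nat) \<Rightarrow> ('k::field) mvec set
    \<Rightarrow> ('k mvec \<times> nat set) set \<Rightarrow> bool" where
  "cone_decomp n m degE T P \<longleftrightarrow>
     finite P
   \<and> (\<forall>C\<in>P. fst C \<in> Fmod n m \<and> fst C \<noteq> 0 \<and> hom_vec degE (fst C) (vdeg degE (fst C))
          \<and> snd C \<subseteq> {..<n} \<and> cone C \<subseteq> T)
   \<and> (\<forall>v\<in>T. \<exists>!c. (\<forall>C\<in>P. c C \<in> cone C) \<and> (\<forall>C. C \<notin> P \<longrightarrow> c C = 0)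
                  \<and> v = (\<Sum>C\<in>P. c C))"

definition decomp_deg :: "(nat \<Rightarrow> nat) \<Rightarrow> (('k::field) mvec \<times> nat set) set \<Rightarrow> nat" where
  "decomp_deg degE P = Max (cdeg degE ` P)"

definition q_standard :: "(nat \<Rightarrow> nat) \<Rightarrow> nat \<Rightarrow> (('k::field) mvec \<times> nat set) set \<Rightarrow> bool" where
  "q_standard degE q P \<longleftrightarrow>
     (\<forall>C\<in>P. cdim C > 0 \<longrightarrow> q \<le> cdeg degE C)
   \<and> (\<forall>C\<in>P. cdim C > 0 \<longrightarrow> (\<forall>d. q \<le> d \<and> d \<le> cdeg degE C \<longrightarrow>
          (\<exists>C'\<in>P. cdeg degE C' = d \<and> cdim C' \<ge> cdim C)))"

definition q_exact :: "(nat \<Rightarrow> nat) \<Rightarrow> nat \<Rightarrow> (('k::field) mvec \<times> nat set) set \<Rightarrow> bool" where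
  "q_exact degE q P \<longleftrightarrow> q_standard degE q P
   \<and> (\<forall>C\<in>P. \<forall>C'\<in>P. cdim C > 0 \<longrightarrow> cdim C' > 0 \<longrightarrow> C \<noteq> C' \<longrightarrow> cdeg degE C \<noteq> cdeg degE C')"

definition macaulay_const :: "(nat \<Rightarrow> nat) \<Rightarrow> nat \<Rightarrow> (('k::field) mvec \<times> nat set) set \<Rightarrow> nat \<Rightarrow> nat" where
  "macaulay_const degE q P k = Max (insert q {1 + cdeg degE C | C. C \<in> P \<and> cdim C \<ge> k})"

end

theory Submission
  imports Defs Complex_Main "HOL-Library.Multiset" "HOL-Library.FuncSet"
begin

text \<open>
  Write \<open>(g)F\<close> for the submodule generated by the \<open>g\<^sub>i e\<^sub>j\<close>. Since \<open>g\<close> is regular, \<open>F/(g)F\<close> and \<open>F/JF\<close> have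
  the same Hilbert function, which is therefore that of \<open>P\<close>. The module \<open>M/(g)F\<close> is filtered by shifted
  cyclic modules \<open>S/I\<close> generated in degrees at most \<open>D\<close>, and each of these has the Hilbert function of
  a standard cone decomposition (Dube's splitting of monomial complements). Together with \<open>Q\<close>, raised from
  \<open>l\<close>-standard to \<open>D\<close>-standard, they give a \<open>D\<close>-standard family of cones with the Hilbert function of \<open>P\<close>.
  A standard family is dominated by the exact one: a cone of \<open>Q\<close> in a degree \<open>e \<ge> b\<^sub>1\<close> forces a point cone
  of \<open>P\<close> in degree \<open>e\<close>. But from degree \<open>max b\<^sub>1 (d\<^sub>1 + \<dots> + d\<^sub>n\<^sub>-\<^sub>r + l - n + 1)\<close> on, the Hilbert function
  of \<open>P\<close> and that of its cones of positive dimension are polynomials, so no point cone can occur there.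
\<close>

subsection \<open>Hilbert functions of cones\<close>

text \<open>Only Hilbert functions can be compared: the cones coming from the cyclic quotients do
  not decompose a subspace of \<open>F\<close> together with \<open>Q\<close>. Hence actual cones
  give way to multisets of types. Splitting cones loses point cones in low degrees, so the Hilbert
  functions agree from degree \<open>D\<close> on only. This suffices because \<open>D\<close> is at
  most \<open>b_1\<close>. The hypothesis \<open>D \<ge> l\<close>, and the choice of
  \<open>D\<close> as the largest degree of the \<open>f_i\<close>, make it possible to raise every
  family to the threshold \<open>D\<close>. The constant is a degree of a rational function. The
  Hilbert series of \<open>S/J\<close> is the product of the \<open>1 - t^{d_i}\<close> divided by
  \<open>(1 - t)^n\<close>; its degree is \<open>d_1 + ... + d_{n-r} - n\<close>, and the
  coefficients are given by a polynomial from the next degree on. The generators \<open>e_j\<close>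
  delay this by at most \<open>l\<close>. Regularity gives \<open>S/(g)\<close> the same series, and
  this is all that links \<open>g\<close> with \<open>J\<close>. No polynomial is ever constructed:
  "polynomial from \<open>a\<close> on" means that the \<open>n\<close>-th difference vanishes from
  \<open>a\<close> on.\<close>

primrec cone_hf :: "nat \<Rightarrow> int \<Rightarrow> int" where
  "cone_hf 0 z = (if z = 0 then 1 else 0)"
| "cone_hf (Suc k) z = (\<Sum>y\<in>{0..z}. cone_hf k y)"

lemma cone_hf_neg: "z < 0 \<Longrightarrow> cone_hf k z = 0"
  by (cases k) auto

lemma cone_hf_nonneg: "0 \<le> cone_hf k z"
  by (induction k arbitrary: z) (auto intro: sum_nonneg)

text \<open>Pascal rule: a monomial in \<open>k + 1\<close> variables either avoids the last
  variable or is divisible by it. The argument is an integer so that shifts by the degree of a cone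
  need no case distinction.\<close>

lemma cone_hf_Suc: "cone_hf (Suc k) z = cone_hf k z + cone_hf (Suc k) (z - 1)"
proof (cases "z < 0")
  case True
  then show ?thesis by (simp add: cone_hf_neg)
next
  case False
  then have "{0..z} = insert z {0..z - 1}" by auto
  then show ?thesis by simp
qed

lemma cone_hf_0_right: "cone_hf k 0 = 1"
  by (induction k) (auto simp: cone_hf_Suc cone_hf_neg)

lemma cone_hf_pos: "0 \<le> z \<Longrightarrow> 1 \<le> cone_hf (Suc k) z"
proof -
  assume z: "0 \<le> z"
  have "(\<Sum>y\<in>{0}. cone_hf k y) \<le> (\<Sum>y\<in>{0..z}. cone_hf k y)"
    by (rule sum_mono2) (use z in \<open>auto simp: cone_hf_nonneg\<close>)
  then show ?thesis by (simp add: cone_hf_0_right)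
qed

section \<open>Finite differences, with a vanishing high difference in the role of
  polynomiality\<close>

definition fdiff :: "(int \<Rightarrow> int) \<Rightarrow> int \<Rightarrow> int" where
  "fdiff f = (\<lambda>z. f (z + 1) - f z)"

lemma fdiff_pow_Suc: "(fdiff ^^ Suc k) f z = (fdiff ^^ k) f (z + 1) - (fdiff ^^ k) f z"
  by (simp add: fdiff_def)

lemma fdiff_pow_0: "(fdiff ^^ k) (\<lambda>z. 0) z = 0"
  by (induction k arbitrary: z) (simp_all only: fdiff_pow_Suc, auto)

lemma fdiff_pow_add: "(fdiff ^^ k) (\<lambda>z. f z + g z) z = (fdiff ^^ k) f z + (fdiff ^^ k) g z"
  by (induction k arbitrary: z) (simp_all only: fdiff_pow_Suc, auto)

lemma fdiff_pow_diff: "(fdiff ^^ k) (\<lambda>z. f z - g z) z = (fdiff ^^ k) f z - (fdiff ^^ k) g z"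
  by (induction k arbitrary: z) (simp_all only: fdiff_pow_Suc, auto)

lemma fdiff_pow_sum:
  "(fdiff ^^ k) (\<lambda>z. \<Sum>i\<in>I. f i z) z = (\<Sum>i\<in>I. (fdiff ^^ k) (f i) z)"
  by (induction k arbitrary: z) (simp_all only: fdiff_pow_Suc sum_subtractf, auto)

lemma fdiff_pow_shift: "(fdiff ^^ k) (\<lambda>z. f (z - c)) z = (fdiff ^^ k) f (z - c)"
  by (induction k arbitrary: z) (simp_all only: fdiff_pow_Suc, auto simp: algebra_simps)

lemma fdiff_pow_cong:
  assumes "\<And>y. a \<le> y \<Longrightarrow> f y = g y" "a \<le> z"
  shows "(fdiff ^^ k) f z = (fdiff ^^ k) g z"
  using assms(2)
proof (induction k arbitrary: z)
  case (Suc k)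
  have "(fdiff ^^ k) f (z + 1) = (fdiff ^^ k) g (z + 1)" "(fdiff ^^ k) f z = (fdiff ^^ k) g z"
    using Suc by auto
  then show ?case by (simp only: fdiff_pow_Suc)
qed (use assms(1) in auto)

text \<open>By the Pascal rule one difference lowers the dimension by one and moves the argument up
  by one. This move is why a cone of dimension \<open>j\<close> counts as polynomial already from
  \<open>1 - j\<close> on and not only from 0.\<close>

lemma fdiff_pow_cone_hf: "(fdiff ^^ j) (cone_hf (k + j)) z = cone_hf k (z + int j)"
proof (induction j arbitrary: z k)
  case (Suc j)
  have "(fdiff ^^ Suc j) (cone_hf (k + Suc j)) z
      = (fdiff ^^ j) (cone_hf (Suc k + j)) (z + 1) - (fdiff ^^ j) (cone_hf (Suc k + j)) z"
    by (simp only: fdiff_pow_Suc add_Suc_right add_Suc)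
  also have "\<dots> = cone_hf (Suc k) (z + 1 + int j) - cone_hf (Suc k) (z + int j)"
    by (simp only: Suc)
  also have "\<dots> = cone_hf k (z + int (Suc j))"
    using cone_hf_Suc[of k "z + 1 + int j"] by (simp add: algebra_simps)
  finally show ?case .
qed simp

lemma fdiff_pow_zero_mono:
  assumes "\<And>z. a \<le> z \<Longrightarrow> (fdiff ^^ j) f z = 0" "a \<le> z"
  shows "(fdiff ^^ (i + j)) f z = 0"
  using assms(2)
proof (induction i arbitrary: z)
  case (Suc i)
  then show ?case using Suc.IH[of z] Suc.IH[of "z + 1"] by (simp only: fdiff_pow_Suc add_Suc)
qed (use assms in simp)

text \<open>After \<open>j\<close> differences only a delta at \<open>z = - j\<close> is left, and
  further differences stay 0 to the right of it.\<close>

lemma fdiff_pow_cone_hf_zero: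
  assumes "j \<le> k" "1 - int j \<le> z"
  shows "(fdiff ^^ k) (cone_hf j) z = 0"
proof -
  have "(fdiff ^^ (k - j + j)) (cone_hf j) z = 0"
    by (rule fdiff_pow_zero_mono[where a = "1 - int j"])
      (use fdiff_pow_cone_hf[of j 0] assms in auto)
  then show ?thesis using assms by simp
qed

text \<open>A polynomial that is 0 at all large arguments is 0. In difference form: if the next
  difference vanishes from \<open>a\<close> on, the current one is constant there, and its value is
  read off beyond \<open>b\<close>.\<close>

lemma eventually_zero_fdiff:
  assumes "\<And>z. a \<le> z \<Longrightarrow> (fdiff ^^ k) f z = 0" and "\<And>z. b \<le> z \<Longrightarrow> f z = 0" and "a \<le> z"
  shows "f z = 0"
  using assms(1,3)
proof (induction k arbitrary: z)
  case (Suc k)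
  have "(fdiff ^^ k) f y = 0" if "a \<le> y" for y
  proof -
    have *: "(fdiff ^^ k) f (y + int i) = (fdiff ^^ k) f y" for i
    proof (induction i)
      case (Suc i)
      have "(fdiff ^^ Suc k) f (y + int i) = 0" using Suc.prems that \<open>\<And>z. a \<le> z \<Longrightarrow> (fdiff ^^ Suc k) f z = 0\<close> by simp
      then show ?case using Suc by (simp only: fdiff_pow_Suc) (simp add: algebra_simps)
    qed simp
    have "(fdiff ^^ k) f (y + int (nat (b - y))) = (fdiff ^^ k) (\<lambda>z. 0) (y + int (nat (b - y)))"
      by (rule fdiff_pow_cong[of b]) (use assms(2) in auto)
    then show ?thesis using * by (simp only: fdiff_pow_0)
  qed
  then show ?case using Suc by blast
qed simp

subsection \<open>Multisets of cone types\<close>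

text \<open>A cone is recorded by the pair (degree, dimension), which is all that its Hilbert function sees.\<close>

definition hf :: "(nat \<times> nat) multiset \<Rightarrow> int \<Rightarrow> int" where
  "hf R z = (\<Sum>(e, k)\<in>#R. cone_hf k (z - int e))"

lemma hf_empty [simp]: "hf {#} z = 0" by (simp add: hf_def)
lemma hf_add_mset [simp]: "hf (add_mset (e, k) R) z = cone_hf k (z - int e) + hf R z"
  by (simp add: hf_def)
lemma hf_union [simp]: "hf (R + R') z = hf R z + hf R' z" by (simp add: hf_def)
lemma hf_nonneg: "0 \<le> hf R z"
  unfolding hf_def by (induction R) (auto simp: cone_hf_nonneg)

lemma hf_ge: "(e, k) \<in># R \<Longrightarrow> cone_hf k (z - int e) \<le> hf R z"
  by (metis add_increasing2 hf_add_mset hf_nonneg mset_add order_refl)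

text \<open>A point cone contributes 1 in its own degree and nothing elsewhere, so a family of point
  cones can be recovered from its Hilbert function.\<close>

lemma hf_zero_dim: "(\<And>e k. (e, k) \<in># R \<Longrightarrow> k = 0) \<Longrightarrow> hf R (int z) = int (count R (z, 0))"
proof (induction R)
  case (add x R)
  then show ?case by (cases x) force
qed simp

definition shift_cones :: "nat \<Rightarrow> (nat \<times> nat) multiset \<Rightarrow> (nat \<times> nat) multiset" where
  "shift_cones c R = image_mset (\<lambda>(e, k). (e + c, k)) R"

lemma hf_shift_cones: "hf (shift_cones c R) z = hf R (z - int c)"
  by (induction R) (auto simp: shift_cones_def algebra_simps)

text \<open>A cone of dimension \<open>j\<close> in degree \<open>e\<close> is polynomial from
  \<open>e - j + 1\<close> on, hence from \<open>b\<close> on, and of polynomial degree below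
  \<open>k\<close>.\<close>

lemma fdiff_pow_hf:
  assumes "\<And>e j. (e, j) \<in># R \<Longrightarrow> e < b \<and> 0 < j \<and> j \<le> k" "int b \<le> z"
  shows "(fdiff ^^ k) (hf R) z = 0"
  using assms(1)
proof (induction R)
  case empty
  then show ?case by (simp add: hf_def fdiff_pow_0)
next
  case (add x R)
  obtain e j where x: "x = (e, j)" by force
  have ej: "e < b" "0 < j" "j \<le> k" using add.prems x by auto
  have IH: "(fdiff ^^ k) (hf R) z = 0" by (rule add.IH) (use add.prems in auto)
  have "(fdiff ^^ k) (hf (add_mset x R)) z = (fdiff ^^ k) (\<lambda>z. cone_hf j (z - int e) + hf R z) z"
    by (simp add: x hf_add_mset[abs_def])
  also have "\<dots> = (fdiff ^^ k) (cone_hf j) (z - int e) + (fdiff ^^ k) (hf R) z"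
    by (simp add: fdiff_pow_add fdiff_pow_shift)
  also have "\<dots> = 0"
    using fdiff_pow_cone_hf_zero[of j k "z - int e"] ej assms(2) IH by simp
  finally show ?case .
qed

text \<open>The iterated difference extracts the number of cones of top dimension, the analogue of the
  leading coefficient of the Hilbert polynomial.\<close>

lemma fdiff_pow_hf_top:
  assumes "\<And>e j. (e, j) \<in># R \<Longrightarrow> j \<le> Suc k"
  shows "\<exists>b. \<forall>z\<ge>b. (fdiff ^^ k) (hf R) z = int (size (filter_mset (\<lambda>(e, j). j = Suc k) R))"
  using assms
proof (induction R)
  case empty
  then show ?case by (simp add: hf_def fdiff_pow_0)
next
  case (add x R)
  obtain e j where x: "x = (e, j)" by force
  obtain b where b: "\<And>z. z \<ge> b \<Longrightarrow>
      (fdiff ^^ k) (hf R) z = int (size (filter_mset (\<lambda>(e, j). j = Suc k) R))"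
    using add by auto
  have hd: "(fdiff ^^ k) (hf (add_mset x R)) z = (fdiff ^^ k) (cone_hf j) (z - int e) + (fdiff ^^ k) (hf R) z" for z
    by (simp add: x hf_add_mset[abs_def] fdiff_pow_add fdiff_pow_shift)
  have top: "(fdiff ^^ k) (cone_hf j) (z - int e) = (if j = Suc k then 1 else 0)" if "z > int e" for z
  proof (cases "j = Suc k")
    case True
    then show ?thesis using fdiff_pow_cone_hf[of k 1 "z - int e"] that by (simp add: cone_hf_Suc)
  next
    case False
    then show ?thesis using fdiff_pow_cone_hf_zero[of j k "z - int e"] that add.prems[of e j] x by auto
  qed
  show ?case
    by (rule exI[of _ "max b (int e + 1)"]) (auto simp: hd top b, auto simp: x)
qed

section \<open>Standard families and raising their threshold\<close>

definition standard :: "nat \<Rightarrow> (nat \<times> nat) multiset \<Rightarrow> bool" where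
  "standard q R \<longleftrightarrow> (\<forall>(e, k)\<in>#R. 0 < k \<longrightarrow>
     q \<le> e \<and> (\<forall>d. q \<le> d \<and> d \<le> e \<longrightarrow> (\<exists>k'\<ge>k. (d, k') \<in># R)))"

lemma standardD:
  assumes "standard q R" "(e, k) \<in># R" "0 < k"
  shows "q \<le> e" and "q \<le> d \<Longrightarrow> d \<le> e \<Longrightarrow> \<exists>k'\<ge>k. (d, k') \<in># R"
  using assms by (auto simp: standard_def)

lemma standardI:
  assumes "\<And>e k. (e, k) \<in># R \<Longrightarrow> 0 < k \<Longrightarrow> q \<le> e"
    and "\<And>e k d. (e, k) \<in># R \<Longrightarrow> 0 < k \<Longrightarrow> q \<le> d \<Longrightarrow> d \<le> e \<Longrightarrow> \<exists>k'\<ge>k. (d, k') \<in># R"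
  shows "standard q R"
  using assms unfolding standard_def by blast

lemma standard_union: "standard q R \<Longrightarrow> standard q R' \<Longrightarrow> standard q (R + R')"
  unfolding standard_def by fastforce

lemma standard_empty: "standard q {#}"
  by (simp add: standard_def)

lemma standard_shift_cones:
  assumes "standard q R" shows "standard (q + c) (shift_cones c R)"
proof (rule standardI)
  fix e k assume "(e, k) \<in># shift_cones c R" and k: "0 < k"
  then obtain e' where e': "e = e' + c" "(e', k) \<in># R" by (auto simp: shift_cones_def)
  show "q + c \<le> e" using standardD(1)[OF assms e'(2) k] e' by simp
  fix d assume d: "q + c \<le> d" "d \<le> e"
  have "\<exists>k'\<ge>k. (d - c, k') \<in># R"
    by (rule standardD(2)[OF assms e'(2) k]) (use d e' in auto)
  then obtain k' where "k' \<ge> k" "(d - c, k') \<in># R" by blast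
  then show "\<exists>k'\<ge>k. (d, k') \<in># shift_cones c R"
    unfolding shift_cones_def using d by (force simp: image_iff)
qed

text \<open>A cone \<open>C(h, {x\<^sub>1, \<dots>, x\<^sub>k})\<close> is the direct sum of the point cone of \<open>h\<close> and of the cones
  \<open>C(x\<^sub>j h, {x\<^sub>1, \<dots>, x\<^sub>j})\<close>. Applying this to all cones of degree \<open>q\<close> moves the standardness
  threshold from \<open>q\<close> to \<open>q + 1\<close>.\<close>

definition raise :: "nat \<Rightarrow> (nat \<times> nat) multiset \<Rightarrow> (nat \<times> nat) multiset" where
  "raise q R = filter_mset (\<lambda>(e, k). q < e) R +
     (\<Sum>(e, k)\<in>#filter_mset (\<lambda>(e, k). e = q) R. mset (map (\<lambda>j. (Suc q, Suc j)) [0..<k]))"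

lemma in_raise:
  "x \<in># raise q R \<longleftrightarrow> (x \<in># R \<and> q < fst x) \<or> (\<exists>k j. (q, k) \<in># R \<and> j < k \<and> x = (Suc q, Suc j))"
  unfolding raise_def by force

text \<open>\<open>raise\<close> leaves out the point cone of the splitting, which is missed in
  degree \<open>q\<close> only; hence \<open>int q < z\<close>. The sum telescopes by the Pascal
  rule.\<close>

lemma cone_hf_split:
  assumes "int q < z"
  shows "hf (mset (map (\<lambda>j. (Suc q, Suc j)) [0..<k])) z = cone_hf k (z - int q)"
proof (induction k)
  case 0
  then show ?case using assms by simp
next
  case (Suc k)
  then show ?case using cone_hf_Suc[of k "z - int q"] by (simp add: algebra_simps)
qed

text \<open>Everything below degree \<open>q\<close> is discarded by \<open>raise\<close>; by the
  first hypothesis these are point cones, invisible above \<open>q\<close>.\<close>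

lemma hf_raise:
  assumes "\<And>e k. (e, k) \<in># R \<Longrightarrow> 0 < k \<Longrightarrow> q \<le> e" and z: "int q < z"
  shows "hf (raise q R) z = hf R z"
  using assms(1)
proof (induction R)
  case (add x R)
  obtain e k where x: "x = (e, k)" by force
  have IH: "hf (raise q R) z = hf R z" using add by auto
  consider "q < e" | "e = q" | "e < q" "k = 0" using add.prems[of e k] x by fastforce
  then show ?case
  proof cases
    case 1
    then have "raise q (add_mset x R) = add_mset x (raise q R)" by (simp add: raise_def x)
    then show ?thesis using IH x by simp
  next
    case 2
    then have "raise q (add_mset x R) = mset (map (\<lambda>j. (Suc q, Suc j)) [0..<k]) + raise q R"
      by (simp add: raise_def x)
    then show ?thesis using IH x 2 cone_hf_split[OF z] by (simp del: mset_map)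
  next
    case 3
    then have "raise q (add_mset x R) = raise q R" by (simp add: raise_def x)
    then show ?thesis using IH x 3 z by simp
  qed
qed (simp add: raise_def)

text \<open>The hypothesis asks for witnesses in degrees above \<open>q\<close> only. This leaves
  room for families that have just lost a cone in degree \<open>q\<close> and are no longer
  \<open>q\<close>-standard. The new cones all sit in degree \<open>q + 1\<close> and are their own
  witnesses.\<close>

lemma standard_raise:
  assumes "\<And>e k d. (e, k) \<in># R \<Longrightarrow> 0 < k \<Longrightarrow> q < d \<Longrightarrow> d \<le> e \<Longrightarrow> \<exists>k'\<ge>k. (d, k') \<in># R"
  shows "standard (Suc q) (raise q R)"
proof (rule standardI)
  fix e k assume ek: "(e, k) \<in># raise q R" and k: "0 < k"
  then show "Suc q \<le> e" by (auto simp: in_raise)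
  fix d assume d: "Suc q \<le> d" "d \<le> e"
  from ek consider "(e, k) \<in># R" | "e = Suc q" by (auto simp: in_raise)
  then show "\<exists>k'\<ge>k. (d, k') \<in># raise q R"
  proof cases
    case 1
    then show ?thesis using assms[of e k d] k d by (auto simp: in_raise)
  next
    case 2
    then show ?thesis using ek d by force
  qed
qed

text \<open>The last conjunct is there for the cone of \<open>Q\<close> of largest degree: whatever
  its dimension, it must survive the raising.\<close>

lemma standard_raise_to:
  assumes "standard q R" "q \<le> q'"
  shows "\<exists>R'. standard q' R' \<and> (\<forall>z\<ge>int q'. hf R' z = hf R z) \<and> (\<forall>e k. (e, k) \<in># R \<longrightarrow> q' \<le> e \<longrightarrow> (e, k) \<in># R')"
  using assms(2)
proof (induction q' rule: dec_induct)
  case base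
  then show ?case using assms(1) by blast
next
  case (step q')
  then obtain R' where R': "standard q' R'" "\<And>z. z \<ge> int q' \<Longrightarrow> hf R' z = hf R z"
    "\<And>e k. (e, k) \<in># R \<Longrightarrow> q' \<le> e \<Longrightarrow> (e, k) \<in># R'" by blast
  show ?case
  proof (intro exI[of _ "raise q' R'"] conjI allI impI)
    show "standard (Suc q') (raise q' R')"
      by (rule standard_raise) (use standardD[OF R'(1)] in auto)
    show "hf (raise q' R') z = hf R z" if "z \<ge> int (Suc q')" for z
      using hf_raise[of R' q' z] standardD(1)[OF R'(1)] R'(2)[of z] that by auto
    show "(e, k) \<in># raise q' R'" if "(e, k) \<in># R" "Suc q' \<le> e" for e k
      using R'(3) that by (auto simp: in_raise)
  qed
qed

section \<open>Comparison of a standard family with an exact one\<close>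

lemma no_pos_dim_if_hf_vanishes:
  assumes "\<And>z. int b \<le> z \<Longrightarrow> hf R z = 0" "(e, k) \<in># R"
  shows "k = 0"
proof (rule ccontr)
  assume "k \<noteq> 0"
  then obtain k' where k: "k = Suc k'" by (cases k) auto
  have "1 \<le> hf R (int b + int e)"
    using cone_hf_pos[of "int b" k'] hf_ge[OF assms(2)[unfolded k], of "int b + int e"] by simp
  then show False using assms(1)[of "int b + int e"] by simp
qed

text \<open>Eventually equal functions have equal leading coefficients: by
  \<open>fdiff_pow_hf_top\<close> both families have the same number of cones of dimension
  \<open>Suc k\<close>, and one of them has such a cone.\<close>

lemma top_dim_exists_if_hf_eq:
  assumes "\<And>z. b \<le> z \<Longrightarrow> hf R z = hf P z"
    and "\<And>e j. (e, j) \<in># R + P \<Longrightarrow> j \<le> Suc k"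
    and "(e, Suc k) \<in># R + P"
  shows "(\<exists>e. (e, Suc k) \<in># R) \<and> (\<exists>e. (e, Suc k) \<in># P)"
proof -
  define top where "top X = filter_mset (\<lambda>(e, j). j = Suc k) X" for X :: "(nat \<times> nat) multiset"
  obtain b1 where b1: "\<And>z. z \<ge> b1 \<Longrightarrow> (fdiff ^^ k) (hf R) z = int (size (top R))"
    using fdiff_pow_hf_top[of R k] assms(2) unfolding top_def by auto
  obtain b2 where b2: "\<And>z. z \<ge> b2 \<Longrightarrow> (fdiff ^^ k) (hf P) z = int (size (top P))"
    using fdiff_pow_hf_top[of P k] assms(2) unfolding top_def by auto
  define z where "z = max b (max b1 b2)"
  have "(fdiff ^^ k) (hf R) z = (fdiff ^^ k) (hf P) z"
    by (rule fdiff_pow_cong[of b]) (use assms(1) in \<open>auto simp: z_def\<close>)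
  then have eq: "size (top R) = size (top P)" using b1[of z] b2[of z] by (auto simp: z_def)
  have "(e, Suc k) \<in># top R \<or> (e, Suc k) \<in># top P" using assms(3) by (auto simp: top_def)
  then have "top R \<noteq> {#} \<and> top P \<noteq> {#}" using eq by (metis empty_iff set_mset_empty size_empty size_eq_0_iff_empty)
  then show ?thesis by (auto simp: top_def filter_mset_eq_conv multiset_nonemptyE dest!: multiset_nonemptyE)
qed

text \<open>Distinct cones may have the same type. Removing one copy of \<open>(e, k)\<close>
  expresses "another cone", so that such a repetition also counts as a clash of degrees.\<close>

definition exact :: "nat \<Rightarrow> (nat \<times> nat) multiset \<Rightarrow> bool" where
  "exact q P \<longleftrightarrow> standard q P \<and>
     (\<forall>e k e' k'. (e, k) \<in># P \<longrightarrow> (e', k') \<in># P - {#(e, k)#} \<longrightarrow> 0 < k \<longrightarrow> 0 < k' \<longrightarrow> e \<noteq> e')"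

text \<open>Both sides have a cone of top dimension in degree \<open>q\<close>. Splitting it off leaves the exact side
  exact in degrees above \<open>q\<close>, while \<^const>\<open>raise\<close> restores standardness of the other side.\<close>

lemma standard_bounded_by_exact:
  assumes "standard q R" "exact q P" "\<And>z. int q \<le> z \<Longrightarrow> hf R z = hf P z"
    and "\<And>e k. (e, k) \<in># P \<Longrightarrow> 0 < k \<Longrightarrow> e < b" and "q \<le> b"
    and "(e, k) \<in># R" "b \<le> e"
  shows "(e, 0) \<in># P"
  using assms
proof (induction "b - q" arbitrary: q R P k rule: less_induct)
  case less
  note std = standardD[OF less.prems(1)]
  have stdP: "standard q P" using less.prems(2) by (simp add: exact_def)
  show ?case
  proof (cases "\<exists>e k. (e, k) \<in># P \<and> 0 < k")
    \<comment> \<open>If \<open>P\<close> has point cones only, the common Hilbert function vanishes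
      in high degrees. Then \<open>R\<close> has no cone of positive dimension either, and both
      families can be counted degree by degree from \<open>q\<close> on.\<close>
    case False
    then have P0: "\<And>e k. (e, k) \<in># P \<Longrightarrow> k = 0" by auto
    obtain c where c: "\<And>e k. (e, k) \<in># P \<Longrightarrow> e \<le> c"
      using finite_nat_set_iff_bounded_le[of "fst ` set_mset P"] by force
    have "hf P z = 0" if "int (Suc c) \<le> z" for z
    proof -
      have "(nat z, 0) \<notin># P" using c[of "nat z" 0] that by auto
      then show ?thesis using hf_zero_dim[where R = P and z = "nat z", OF P0] that by (simp add: not_in_iff)
    qed
    then have "hf R z = 0" if "int (max q (Suc c)) \<le> z" for z
      using less.prems(3)[of z] that by simp
    then have k: "k = 0" using no_pos_dim_if_hf_vanishes less.prems(6) by blast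
    have "1 \<le> hf R (int e)" using hf_ge[OF less.prems(6), of "int e"] k by simp
    also have "hf R (int e) = hf P (int e)" using less.prems by simp
    also have "\<dots> = int (count P (e, 0))" by (rule hf_zero_dim[OF P0])
    finally show ?thesis by simp
  next
    case True
    \<comment> \<open>The maximum runs over both families: equality of the Hilbert functions puts a
      cone of dimension \<open>K\<close> into each, standardness brings it down to degree
      \<open>q\<close>, and maximality fixes its dimension there.\<close>
    define K where "K = Max (snd ` set_mset (R + P))"
    obtain e0 k0 where e0: "(e0, k0) \<in># P" "0 < k0" using True by blast
    have K: "j \<le> K" if "(i, j) \<in># R + P" for i j
      unfolding K_def by (rule Max_ge) (use that in \<open>auto simp: image_iff intro: bexI[rotated]\<close>)
    have "K \<in> snd ` set_mset (R + P)" unfolding K_def by (rule Max_in) (use e0 in auto)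
    then obtain e1 where e1: "(e1, K) \<in># R + P" by (metis imageE prod.collapse)
    obtain K' where K': "K = Suc K'" using K[of e0 k0] e0 by (cases K) auto
    obtain eR eP where eR: "(eR, K) \<in># R" and eP: "(eP, K) \<in># P"
      using top_dim_exists_if_hf_eq[of "int q" R P K' e1] less.prems(3) K e1 K' by auto
    have Kpos: "0 < K" using K' by simp
    have qR: "(q, K) \<in># R"
      using std(2)[OF eR Kpos, of q] std(1)[OF eR Kpos] K by (metis le_antisym order_refl union_iff)
    have qP: "(q, K) \<in># P"
      using standardD(2)[OF stdP eP Kpos, of q] standardD(1)[OF stdP eP Kpos] K
      by (metis le_antisym order_refl union_iff)
    \<comment> \<open>This makes the measure \<open>b - q\<close> decrease. It also keeps
      \<open>(e, k)\<close> strictly above degree \<open>q\<close>, where \<open>raise\<close>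
      changes nothing.\<close>
    have qb: "q < b" using less.prems(4)[OF qP Kpos] .
    define R0 where "R0 = R - {#(q, K)#}"
    define P0 where "P0 = P - {#(q, K)#}"
    have RR: "R = add_mset (q, K) R0" and PP: "P = add_mset (q, K) P0"
      using qR qP by (auto simp: R0_def P0_def)
    define P1 where "P1 = filter_mset (\<lambda>(e, k). q < e) P0"
    \<comment> \<open>By exactness the removed cone was the only one of positive dimension in degree
      \<open>q\<close>, so the filter in \<open>P1\<close> drops point cones only.\<close>
    have P0deg: "q < i" if "(i, j) \<in># P0" "0 < j" for i j
    proof -
      have "q \<noteq> i" using less.prems(2) qP Kpos that unfolding exact_def P0_def by blast
      moreover have "q \<le> i" using standardD(1)[OF stdP, of i j] that PP by auto
      ultimately show ?thesis by simp
    qed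
    have hfP1: "hf P1 z = hf P0 z" if "int q < z" for z
      using P0deg unfolding P1_def
    proof (induction P0)
      case (add x Y)
      obtain i j where x: "x = (i, j)" by force
      have "hf (filter_mset (\<lambda>(e, k). q < e) Y) z = hf Y z" using add by auto
      moreover have "q < i \<or> j = 0" using add.prems[of i j] x by auto
      ultimately show ?case using that by (auto simp: x)
    qed simp
    have stdP1: "standard (Suc q) P1"
    proof (rule standardI)
      fix i j assume ij: "(i, j) \<in># P1" "0 < j"
      then show "Suc q \<le> i" by (auto simp: P1_def)
      fix d' assume d': "Suc q \<le> d'" "d' \<le> i"
      have "(i, j) \<in># P" using ij PP by (auto simp: P1_def)
      then obtain j' where "j' \<ge> j" "(d', j') \<in># P"
        using standardD(2)[OF stdP, of i j d'] ij d' by auto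
      then show "\<exists>k'\<ge>j. (d', k') \<in># P1" using d' PP by (auto simp: P1_def)
    qed
    have exP1: "exact (Suc q) P1"
      unfolding exact_def
    proof (intro conjI stdP1 allI impI)
      fix i j i' j' assume a: "(i, j) \<in># P1" "(i', j') \<in># P1 - {#(i, j)#}" "0 < j" "0 < j'"
      have "P1 - {#(i, j)#} \<subseteq># P - {#(i, j)#}"
        by (auto simp: subseteq_mset_def P1_def PP intro!: diff_le_mono)
      then have "(i', j') \<in># P - {#(i, j)#}" using a by (meson mset_subset_eqD)
      moreover have "(i, j) \<in># P" using a PP by (auto simp: P1_def)
      ultimately show "i \<noteq> i'" using less.prems(2) a unfolding exact_def by blast
    qed
    have R0q: "q \<le> i" if "(i, j) \<in># R0" "0 < j" for i j using std(1)[of i j] that RR by auto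
    have "(e, 0) \<in># P1"
    proof (rule less.hyps[of "Suc q" "raise q R0" P1 k])
      show "standard (Suc q) (raise q R0)"
      proof (rule standard_raise)
        fix i j d' assume "(i, j) \<in># R0" "0 < j" "q < d'" "d' \<le> i"
        then show "\<exists>k'\<ge>j. (d', k') \<in># R0" using std(2)[of i j d'] RR by auto
      qed
      show "hf (raise q R0) z = hf P1 z" if "int (Suc q) \<le> z" for z
      proof -
        have "hf (raise q R0) z = hf R0 z" by (rule hf_raise) (use R0q that in auto)
        moreover have "hf R z = hf P z" using less.prems(3) that by simp
        ultimately show ?thesis using hfP1[of z] that RR PP by simp
      qed
      show "i < b" if "(i, j) \<in># P1" "0 < j" for i j
        using less.prems(4)[of i j] that PP by (auto simp: P1_def)
      show "(e, k) \<in># raise q R0" using less.prems(6,7) qb RR by (auto simp: in_raise)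
    qed (use exP1 qb less.prems in auto)
    then show ?thesis using PP by (auto simp: P1_def)
  qed
qed

subsection \<open>Dickson's lemma\<close>

text \<open>Every sequence has a monotone subsequence, and a decreasing one of naturals is constant
  from the index of its minimum on.\<close>

lemma monoseq_subseq_nat:
  fixes s :: "nat \<Rightarrow> nat"
  shows "\<exists>f. strict_mono f \<and> incseq (\<lambda>i. s (f i))"
proof -
  obtain f :: "nat \<Rightarrow> nat" where f: "strict_mono f" "monoseq (\<lambda>i. s (f i))" using seq_monosub by blast
  show ?thesis
  proof (cases "incseq (\<lambda>i. s (f i))")
    case False
    then have dec: "decseq (\<lambda>i. s (f i))" using f(2) by (simp add: monoseq_iff)
    obtain i where i: "\<And>j. s (f i) \<le> s (f j)"
      using exists_least_iff[of "\<lambda>v. \<exists>i. v = s (f i)"] by (metis not_le)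
    have "s (f (j + i)) = s (f i)" for j
      using decseqD[OF dec, of i "j + i"] i[of "j + i"] by simp
    then have "incseq (\<lambda>j. s (f (j + i)))" by (simp add: incseq_def)
    moreover have "strict_mono (\<lambda>j. f (j + i))" using f(1) by (simp add: strict_mono_def)
    ultimately show ?thesis by (intro exI[of _ "\<lambda>j. f (j + i)"]) simp
  qed (use f in blast)
qed

text \<open>One coordinate at a time: monotonicity in the coordinates already treated survives the
  passage to a further subsequence.\<close>

lemma dickson_subseq:
  fixes s :: "nat \<Rightarrow> 'x \<Rightarrow> nat"
  assumes "finite u"
  shows "\<exists>f. strict_mono f \<and> (\<forall>x\<in>u. incseq (\<lambda>i. s (f i) x))"
  using assms
proof (induction u)
  case empty
  show ?case by (rule exI[of _ id]) (simp add: strict_mono_def)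
next
  case (insert x u)
  then obtain f where f: "strict_mono f" "\<forall>x\<in>u. incseq (\<lambda>i. s (f i) x)" by blast
  obtain g where g: "strict_mono g" "incseq (\<lambda>i. s (f (g i)) x)"
    using monoseq_subseq_nat[of "\<lambda>i. s (f i) x"] by blast
  have "strict_mono (f \<circ> g)" using f g by (simp add: strict_mono_def)
  moreover have "incseq (\<lambda>i. s (f (g i)) y)" if "y \<in> u" for y
    using f(2) that strict_mono_mono[OF g(1)] unfolding incseq_def mono_def by blast
  ultimately show ?case using g(2) by (intro exI[of _ "f \<circ> g"]) (auto simp: comp_def)
qed

text \<open>Complements of monomial ideals, the sets that arise as standard monomials.\<close>

definition down_closed :: "expo set \<Rightarrow> bool" where
  "down_closed N \<longleftrightarrow> (\<forall>a b. a + b \<in> N \<longrightarrow> a \<in> N)"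

definition expos :: "nat set \<Rightarrow> expo set" where
  "expos u = {a. Poly_Mapping.keys a \<subseteq> u}"

lemma expo_le_imp_add:
  fixes a b :: expo
  assumes "\<And>x. Poly_Mapping.lookup a x \<le> Poly_Mapping.lookup b x"
  shows "b = a + (b - a)"
  by (rule poly_mapping_eqI) (simp add: lookup_add lookup_minus assms)

text \<open>Noetherianity of monomial ideals, seen from the complements. Pick a monomial
  \<open>a i\<close> lost at each step of an infinite descent. By Dickson an earlier one divides a
  later one; the later one is still present, so by down-closedness the earlier one was not
  lost.\<close>

lemma wf_down_closed:
  assumes "finite u"
  shows "wf {(N', N). N' \<subset> N \<and> N \<subseteq> expos u \<and> down_closed N'}"
  unfolding wf_iff_no_infinite_down_chain
proof
  assume "\<exists>N. \<forall>i. (N (Suc i), N i) \<in> {(N', N). N' \<subset> N \<and> N \<subseteq> expos u \<and> down_closed N'}"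
  then obtain N where "\<forall>i. N (Suc i) \<subset> N i \<and> N i \<subseteq> expos u \<and> down_closed (N (Suc i))" by auto
  then have N: "\<And>i. N (Suc i) \<subset> N i" "\<And>i. N i \<subseteq> expos u" "\<And>i. down_closed (N (Suc i))"
    by simp_all
  have "\<forall>i. \<exists>a. a \<in> N i \<and> a \<notin> N (Suc i)" using N(1) by blast
  then obtain a where "\<forall>i. a i \<in> N i \<and> a i \<notin> N (Suc i)" by (rule choice[THEN exE])
  then have a: "\<And>i. a i \<in> N i" "\<And>i. a i \<notin> N (Suc i)" by simp_all
  obtain f where f: "strict_mono f" "\<forall>x\<in>u. incseq (\<lambda>i. Poly_Mapping.lookup (a (f i)) x)"
    using dickson_subseq[OF assms, of "\<lambda>i. Poly_Mapping.lookup (a i)"] by blast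
  have "Poly_Mapping.lookup (a (f 0)) x \<le> Poly_Mapping.lookup (a (f 1)) x" for x
  proof (cases "x \<in> u")
    case True
    then show ?thesis using f(2) by (auto simp: incseq_def)
  next
    case False
    then have "x \<notin> Poly_Mapping.keys (a (f 0))" using a N(2) by (fastforce simp: expos_def)
    then show ?thesis by (simp add: in_keys_iff)
  qed
  then have le: "a (f 1) = a (f 0) + (a (f 1) - a (f 0))" by (rule expo_le_imp_add)
  have less: "Suc (f 0) \<le> f 1" using f(1) by (simp add: strict_mono_def Suc_leI)
  have anti: "decseq N" using N(1) by (intro decseq_SucI) auto
  \<comment> \<open>Down-closedness is known only for the sets after the first one, so the index has
    to be a successor.\<close>
  obtain i where i: "f 1 = Suc i" using less by (cases "f 1") auto
  have "a (f 0) \<in> N (f 1)" using N(3)[of i] a(1)[of "f 1"] le i unfolding down_closed_def by (metis (no_types))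
  then show False using a(2)[of "f 0"] decseqD[OF anti less] by blast
qed

subsection \<open>Hilbert functions of sets of monomials\<close>

lemma tdeg_eq_sum: "finite u \<Longrightarrow> Poly_Mapping.keys a \<subseteq> u \<Longrightarrow> tdeg a = (\<Sum>i\<in>u. Poly_Mapping.lookup a i)"
  unfolding tdeg_def by (rule sum.mono_neutral_left) (auto simp: in_keys_iff)

lemma tdeg_zero [simp]: "tdeg 0 = 0" by (simp add: tdeg_def)

lemma tdeg_add: "tdeg (a + b) = tdeg a + tdeg b"
proof -
  let ?u = "Poly_Mapping.keys a \<union> Poly_Mapping.keys b"
  have "Poly_Mapping.keys (a + b) \<subseteq> ?u" by (rule Poly_Mapping.keys_add)
  then show ?thesis
    using tdeg_eq_sum[of ?u a] tdeg_eq_sum[of ?u b] tdeg_eq_sum[of ?u "a + b"]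
    by (simp add: lookup_add sum.distrib)
qed

lemma tdeg_single [simp]: "tdeg (Poly_Mapping.single i d) = d"
  by (cases "d = 0") (simp_all add: tdeg_def)

lemma lookup_le_tdeg: "Poly_Mapping.lookup a i \<le> tdeg a"
proof (cases "i \<in> Poly_Mapping.keys a")
  case True
  then show ?thesis unfolding tdeg_def by (simp add: member_le_sum)
qed (simp add: in_keys_iff)

lemma keys_add_expo: "Poly_Mapping.keys (a + b :: expo) = Poly_Mapping.keys a \<union> Poly_Mapping.keys b"
  by (auto simp: in_keys_iff lookup_add)

lemma add_single_minus:
  "d \<le> Poly_Mapping.lookup a x \<Longrightarrow> (a - Poly_Mapping.single x d) + Poly_Mapping.single x d = (a :: expo)"
  by (rule poly_mapping_eqI) (auto simp: lookup_add lookup_minus lookup_single when_def)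

lemma finite_expos_tdeg_le: "finite u \<Longrightarrow> finite {a \<in> expos u. tdeg a \<le> z}"
proof -
  assume u: "finite u"
  have "inj_on (\<lambda>a. restrict (Poly_Mapping.lookup a) u) {a \<in> expos u. tdeg a \<le> z}"
  proof (rule inj_onI)
    fix a b assume ab: "a \<in> {a \<in> expos u. tdeg a \<le> z}" "b \<in> {a \<in> expos u. tdeg a \<le> z}"
      and eq: "restrict (Poly_Mapping.lookup a) u = restrict (Poly_Mapping.lookup b) u"
    show "a = b"
    proof (rule poly_mapping_eqI)
      fix x
      show "Poly_Mapping.lookup a x = Poly_Mapping.lookup b x"
      proof (cases "x \<in> u")
        case True
        then show ?thesis using fun_cong[OF eq, of x] by simp
      next
        case False
        then have "x \<notin> Poly_Mapping.keys a" "x \<notin> Poly_Mapping.keys b" using ab by (auto simp: expos_def)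
        then show ?thesis by (simp add: in_keys_iff)
      qed
    qed
  qed
  moreover have "(\<lambda>a. restrict (Poly_Mapping.lookup a) u) ` {a \<in> expos u. tdeg a \<le> z}
      \<subseteq> (\<Pi>\<^sub>E x\<in>u. {..z})"
    by (auto intro: order_trans[OF lookup_le_tdeg])
  moreover have "finite (\<Pi>\<^sub>E x\<in>u. {..z})" using u by (intro finite_PiE) auto
  ultimately show ?thesis using finite_imageD finite_subset by blast
qed

definition mon_hf :: "expo set \<Rightarrow> int \<Rightarrow> int" where
  "mon_hf N z = int (card {a \<in> N. int (tdeg a) = z})"

lemma finite_mon_hf: "finite u \<Longrightarrow> N \<subseteq> expos u \<Longrightarrow> finite {a \<in> N. int (tdeg a) = z}"
  by (rule finite_subset[OF _ finite_expos_tdeg_le[of u "nat z"]]) auto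

text \<open>Monomials of \<open>N\<close> divisible by \<open>x^d\<close> correspond to those of the
  colon set \<open>N : x^d\<close>, in degree lowered by \<open>d\<close>. Taken with
  \<open>d = 1\<close> for cones and Dube's splitting, and with \<open>d = d_i\<close> for the
  monomials outside \<open>J\<close>.\<close>

lemma mon_hf_split:
  assumes "finite u" "N \<subseteq> expos u"
  shows "mon_hf N z = mon_hf {a \<in> N. Poly_Mapping.lookup a x < d} z
    + mon_hf {a. a + Poly_Mapping.single x d \<in> N} (z - int d)"
proof -
  let ?A = "{a \<in> N. Poly_Mapping.lookup a x < d \<and> int (tdeg a) = z}"
  let ?B = "{a \<in> N. d \<le> Poly_Mapping.lookup a x \<and> int (tdeg a) = z}"
  let ?C = "{a. a + Poly_Mapping.single x d \<in> N \<and> int (tdeg a) = z - int d}"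
  have fin: "finite ?A" "finite ?B"
    by (rule finite_subset[OF _ finite_mon_hf[OF assms, of z]]; auto)+
  have "bij_betw (\<lambda>a. a + Poly_Mapping.single x d) ?C ?B"
  proof (rule bij_betw_byWitness[where f' = "\<lambda>a. a - Poly_Mapping.single x d"])
    show "(\<lambda>a. a - Poly_Mapping.single x d) ` ?B \<subseteq> ?C"
    proof (rule image_subsetI)
      fix a assume a: "a \<in> ?B"
      then have eq: "(a - Poly_Mapping.single x d) + Poly_Mapping.single x d = a"
        by (intro add_single_minus) simp
      have "tdeg (a - Poly_Mapping.single x d) + d = tdeg a"
        using tdeg_add[of "a - Poly_Mapping.single x d" "Poly_Mapping.single x d"] eq by simp
      then show "a - Poly_Mapping.single x d \<in> ?C" using a eq by auto
    qed
  qed (auto simp: add_single_minus tdeg_add lookup_add)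
  then have "card ?C = card ?B" by (rule bij_betw_same_card)
  moreover have "{a \<in> N. int (tdeg a) = z} = ?A \<union> ?B" "?A \<inter> ?B = {}" by auto
  ultimately show ?thesis using fin by (simp add: mon_hf_def card_Un_disjoint)
qed

lemma mon_hf_empty [simp]: "mon_hf {} z = 0" by (simp add: mon_hf_def)

lemma expos_lookup_0: "x \<notin> u \<Longrightarrow> {a \<in> expos (insert x u). Poly_Mapping.lookup a x = 0} = expos u"
  by (auto simp: expos_def in_keys_iff)

lemma expos_shift: "x \<in> u \<Longrightarrow> {a. a + Poly_Mapping.single x d \<in> expos u} = expos u"
  by (auto simp: expos_def keys_add_expo split: if_splits)

text \<open>Both sides satisfy the Pascal recursion and vanish in negative degrees.\<close>

lemma mon_hf_expos: "finite u \<Longrightarrow> mon_hf (expos u) z = cone_hf (card u) z"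
proof (induction u arbitrary: z rule: finite_induct)
  case empty
  have "{a \<in> expos {}. int (tdeg a) = z} = (if z = 0 then {0} else {})" by (auto simp: expos_def)
  then show ?case by (simp add: mon_hf_def)
next
  case (insert x u)
  have step: "mon_hf (expos (insert x u)) z = cone_hf (card u) z + mon_hf (expos (insert x u)) (z - 1)" for z
    using mon_hf_split[of "insert x u" "expos (insert x u)" z x 1] insert
    by (simp add: expos_lookup_0 expos_shift)
  show ?case
  proof (cases "z < 0")
    case True
    then have "{a \<in> expos (insert x u). int (tdeg a) = z} = {}" by auto
    then show ?thesis using True unfolding mon_hf_def by (simp add: cone_hf_neg)
  next
    case False
    then have "0 \<le> z" by simp
    then have "mon_hf (expos (insert x u)) z = cone_hf (Suc (card u)) z"
    proof (induction z rule: int_ge_induct)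
      case base
      have "{a \<in> expos (insert x u). int (tdeg a) = 0 - 1} = {}" by auto
      then show ?case using step[of 0] unfolding mon_hf_def by (simp add: cone_hf_0_right)
    next
      case (step i)
      then show ?case using \<open>\<And>z. mon_hf (expos (insert x u)) z = _ z + _\<close>[of "i + 1"] cone_hf_Suc[of "card u" "i + 1"] by simp
    qed
    then show ?thesis using insert by simp
  qed
qed

text \<open>Dube's splitting: if the coordinate space \<open>expos s\<close> is maximal in \<open>N\<close> and \<open>x \<notin> s\<close>, decompose \<open>N\<close>
  into its part without \<open>x\<close> and the strictly smaller set \<open>N : x\<close>, shifted by one degree. The last two
  conjuncts say that a cone of top dimension occurs in degree 0, whence standardness.\<close>

theorem standard_decomposition_exists:
  assumes "finite u" "N \<subseteq> expos u" "down_closed N"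
  shows "\<exists>R. standard 0 R \<and> (\<forall>z. mon_hf N z = hf R z)
    \<and> (\<forall>(e, k)\<in>#R. \<exists>s\<subseteq>u. card s = k \<and> expos s \<subseteq> N)
    \<and> (\<forall>s\<subseteq>u. expos s \<subseteq> N \<longrightarrow> (\<exists>k\<ge>card s. (0, k) \<in># R))"
  using assms
proof (induction u arbitrary: N rule: finite_psubset_induct)
  case (psubset u)
  show ?case using psubset.prems
  \<comment> \<open>The outer induction, on the variables, serves the part of \<open>N\<close>
    without \<open>x\<close>. The inner one, on \<open>N\<close>, serves \<open>N : x\<close>, which
    may still involve all of \<open>u\<close> but is strictly smaller.\<close>
  proof (induction N rule: wf_induct_rule[OF wf_down_closed[OF \<open>finite u\<close>]])
    case (1 N)
    consider "N = {}" | "expos u \<subseteq> N" | "N \<noteq> {}" "\<not> expos u \<subseteq> N" by blast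
    then show ?case
    proof cases
      case 1
      have "0 \<in> expos s" for s by (simp add: expos_def)
      then have "\<not> expos s \<subseteq> N" for s using 1 by blast
      then show ?thesis using 1 by (intro exI[of _ "{#}"]) (simp add: standard_empty)
    next
      case 2
      then have N: "N = expos u" using \<open>N \<subseteq> expos u\<close> by blast
      show ?thesis
      proof (intro exI[of _ "{#(0, card u)#}"] conjI allI impI)
        show "mon_hf N z = hf {#(0, card u)#} z" for z
          using mon_hf_expos[OF psubset.hyps] N by simp
      qed (use N psubset.hyps in \<open>auto simp: standard_def card_mono\<close>)
    next
      case 3
      define S where "S = {s. s \<subseteq> u \<and> expos s \<subseteq> N}"
      have "finite S" using psubset.hyps by (simp add: S_def)
      obtain a where "a \<in> N" using 3 by blast
      then have "0 \<in> N" using \<open>down_closed N\<close> unfolding down_closed_def by (metis add_0)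
      then have "{} \<in> S" by (auto simp: S_def expos_def)
      then have "Max (card ` S) \<in> card ` S" using \<open>finite S\<close> by (intro Max_in) auto
      then obtain s where s: "s \<in> S" "card s = Max (card ` S)" by auto
      have smax: "card t \<le> card s" if "t \<in> S" for t
        using s(2) that \<open>finite S\<close> by simp
      have "s \<noteq> u" using s 3 by (auto simp: S_def)
      then obtain x where x: "x \<in> u" "x \<notin> s" using s by (auto simp: S_def)
      let ?N0 = "{a \<in> N. Poly_Mapping.lookup a x < 1}"
      let ?N1 = "{a. a + Poly_Mapping.single x 1 \<in> N}"
      have N1sub: "?N1 \<subseteq> N" using \<open>down_closed N\<close> by (auto simp: down_closed_def)
      \<comment> \<open>If \<open>N : x = N\<close>, then \<open>N\<close> is closed under
        multiplication by \<open>x\<close>, and \<open>s\<close> could be enlarged by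
        \<open>x\<close>, against its maximality.\<close>
      have "?N1 \<noteq> N"
      proof
        assume eq: "?N1 = N"
        have "a \<in> N" if "a \<in> expos (insert x s)" for a
          using that
        proof (induction "Poly_Mapping.lookup a x" arbitrary: a)
          case 0
          then have "a \<in> expos s" by (auto simp: expos_def in_keys_iff)
          then show ?case using s by (auto simp: S_def)
        next
          case (Suc i)
          let ?b = "a - Poly_Mapping.single x 1"
          have ab: "?b + Poly_Mapping.single x 1 = a" by (rule add_single_minus) (use Suc in simp)
          have "?b \<in> expos (insert x s)" using Suc.prems ab keys_add_expo[of ?b "Poly_Mapping.single x 1"]
            by (auto simp: expos_def)
          moreover have "i = Poly_Mapping.lookup ?b x" using Suc.hyps(2) by (simp add: lookup_minus)
          ultimately have "?b \<in> ?N1" using Suc.hyps(1) eq by blast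
          then show ?case using ab by simp
        qed
        then have "insert x s \<in> S" using s x by (auto simp: S_def)
        moreover have "finite s" using s psubset.hyps finite_subset by (auto simp: S_def)
        ultimately show False using smax[of "insert x s"] x by simp
      qed
      then have N1: "?N1 \<subset> N" "?N1 \<subseteq> expos u" using N1sub \<open>N \<subseteq> expos u\<close> by auto
      have dc1: "down_closed ?N1"
        using \<open>down_closed N\<close> unfolding down_closed_def by (auto simp: ac_simps)
      have N0: "?N0 \<subseteq> expos (u - {x})" using \<open>N \<subseteq> expos u\<close> by (auto simp: expos_def in_keys_iff)
      have dc0: "down_closed ?N0"
        using \<open>down_closed N\<close> unfolding down_closed_def by (auto simp: lookup_add)
      obtain R0 where R0: "standard 0 R0" "\<And>z. mon_hf ?N0 z = hf R0 z"
        "\<And>e k. (e, k) \<in># R0 \<Longrightarrow> \<exists>s\<subseteq>u - {x}. card s = k \<and> expos s \<subseteq> ?N0"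
        "\<And>s. s \<subseteq> u - {x} \<Longrightarrow> expos s \<subseteq> ?N0 \<Longrightarrow> \<exists>k\<ge>card s. (0, k) \<in># R0"
      proof -
        have "u - {x} \<subset> u" using x by blast
        from psubset.IH[OF this N0 dc0] show ?thesis by (elim exE conjE) (force elim: that)
      qed
      obtain R1 where R1: "standard 0 R1" "\<And>z. mon_hf ?N1 z = hf R1 z"
        "\<And>e k. (e, k) \<in># R1 \<Longrightarrow> \<exists>s\<subseteq>u. card s = k \<and> expos s \<subseteq> ?N1"
      proof -
        have "(?N1, N) \<in> {(N', N). N' \<subset> N \<and> N \<subseteq> expos u \<and> down_closed N'}"
          using N1 dc1 \<open>N \<subseteq> expos u\<close> by blast
        from 1(1)[OF this N1(2) dc1] show ?thesis by (elim exE conjE) (force elim: that)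
      qed
      \<comment> \<open>\<open>s\<close> avoids \<open>x\<close>, so its coordinate space survives
        in the part without \<open>x\<close>, whose decomposition then has a cone of at least this
        dimension in degree 0.\<close>
      have "expos s \<subseteq> ?N0" "s \<subseteq> u - {x}" using s x by (auto simp: S_def expos_def in_keys_iff)
      then obtain k0 where k0: "k0 \<ge> card s" "(0, k0) \<in># R0" using R0(4) by blast
      let ?R = "R0 + shift_cones 1 R1"
      have dims: "\<exists>s\<subseteq>u. card s = k \<and> expos s \<subseteq> N" if "(e, k) \<in># ?R" for e k
      proof -
        have "(e, k) \<in># R0 \<or> (\<exists>e'. (e', k) \<in># R1)" using that by (auto simp: shift_cones_def)
        then consider "(e, k) \<in># R0" | e' where "(e', k) \<in># R1" by blast
        then show ?thesis 
        proof cases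
          case 1
          then show ?thesis using R0(3)[OF 1] by blast
        next
          case 2
          then show ?thesis using R1(3)[OF 2] N1sub by blast
        qed
      qed
      \<comment> \<open>The dimension of every cone is that of a coordinate space inside
        \<open>N\<close>, so none exceeds \<open>k0\<close>. The one cone in degree 0 thus serves
        all chains, including those of the shifted part, which by itself is only 1-standard.\<close>
      have k0max: "k \<le> k0" if "(e, k) \<in># ?R" for e k
      proof -
        have "\<exists>t\<in>S. card t = k" using dims[OF that] unfolding S_def by blast
        then obtain t where "t \<in> S" "card t = k" by blast
        then show ?thesis using smax[of t] k0(1) by simp
      qed
      have "standard 0 ?R"
      proof (rule standardI)
        fix e k d assume ek: "(e, k) \<in># ?R" "0 < k" and d: "d \<le> e"
        show "\<exists>k'\<ge>k. (d, k') \<in># ?R"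
        proof (cases "d = 0")
          case True
          then show ?thesis using k0max[OF ek(1)] k0 by auto
        next
          case False
          consider "(e, k) \<in># R0" | "(e, k) \<in># shift_cones 1 R1" using ek by auto
          then show ?thesis
          proof cases
            case 1
            then show ?thesis using standardD(2)[OF R0(1) 1 ek(2), of d] d by auto
          next
            case 2
            then show ?thesis
              using standardD(2)[OF standard_shift_cones[OF R1(1), of 1] 2 ek(2), of d] d False by auto
          qed
        qed
      qed simp
      moreover have "mon_hf N z = hf ?R z" for z
        using mon_hf_split[OF psubset.hyps \<open>N \<subseteq> expos u\<close>, of z x 1] R0(2) R1(2)
        by (simp add: hf_shift_cones)
      moreover have "\<exists>k\<ge>card t. (0, k) \<in># ?R" if "t \<subseteq> u" "expos t \<subseteq> N" for t
      proof -
        have "t \<in> S" using that by (simp add: S_def)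
        then show ?thesis using smax[of t] k0 by (intro exI[of _ k0]) simp
      qed
      moreover have "\<forall>(e, k)\<in>#?R. \<exists>s\<subseteq>u. card s = k \<and> expos s \<subseteq> N" using dims by blast
      ultimately show ?thesis by (intro exI[of _ ?R] conjI allI impI)
    qed
  qed
qed

subsection \<open>Spaces of finitely supported functions\<close>

text \<open>The index type stays arbitrary so that the same linear algebra serves polynomials,
  module elements, and coordinate spaces indexed by pairs of a cone and an exponent.\<close>

definition smul :: "'k::field \<Rightarrow> ('a \<Rightarrow>\<^sub>0 'k) \<Rightarrow> ('a \<Rightarrow>\<^sub>0 'k)" where
  "smul c v = Poly_Mapping.map ((*) c) v"

lemma lookup_smul [simp]: "Poly_Mapping.lookup (smul c v) t = c * Poly_Mapping.lookup v t"
  by (simp add: smul_def Poly_Mapping.map.rep_eq when_def)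

global_interpretation pm: vector_space "smul :: 'k::field \<Rightarrow> ('a \<Rightarrow>\<^sub>0 'k) \<Rightarrow> _"
  by unfold_locales (auto intro!: poly_mapping_eqI simp: lookup_add algebra_simps)

lemma smul_single [simp]: "smul c (Poly_Mapping.single t d) = Poly_Mapping.single t (c * d)"
  by (rule poly_mapping_eqI) (simp add: lookup_single when_def)

definition supp_in :: "'a set \<Rightarrow> ('a \<Rightarrow>\<^sub>0 'k::field) set" where
  "supp_in A = {v. Poly_Mapping.keys v \<subseteq> A}"

lemma supp_inI: "(\<And>t. Poly_Mapping.lookup v t \<noteq> 0 \<Longrightarrow> t \<in> A) \<Longrightarrow> v \<in> supp_in A"
  by (auto simp: supp_in_def in_keys_iff)

lemma supp_inD: "v \<in> supp_in A \<Longrightarrow> t \<notin> A \<Longrightarrow> Poly_Mapping.lookup v t = 0"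
  by (auto simp: supp_in_def in_keys_iff)

lemma subspace_supp_in: "pm.subspace (supp_in A)"
proof (rule pm.subspaceI)
  fix v w :: "'b \<Rightarrow>\<^sub>0 'a" assume "v \<in> supp_in A" "w \<in> supp_in A"
  then show "v + w \<in> supp_in A" using Poly_Mapping.keys_add[of v w] by (auto simp: supp_in_def)
qed (auto simp: supp_in_def in_keys_iff)

lemma keys_sum_singles:
  fixes v :: "'a \<Rightarrow>\<^sub>0 'k::comm_monoid_add"
  assumes "finite A" "Poly_Mapping.keys v \<subseteq> A"
  shows "v = (\<Sum>t\<in>A. Poly_Mapping.single t (Poly_Mapping.lookup v t))"
proof (rule poly_mapping_eqI)
  fix s
  show "Poly_Mapping.lookup v s = Poly_Mapping.lookup (\<Sum>t\<in>A. Poly_Mapping.single t (Poly_Mapping.lookup v t)) s"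
    using assms by (cases "s \<in> A") (auto simp: lookup_sum lookup_single when_def in_keys_iff)
qed

lemma supp_in_span_singles:
  assumes "finite A"
  shows "supp_in A = pm.span ((\<lambda>t. Poly_Mapping.single t (1::'k::field)) ` A)"
proof
  show "supp_in A \<subseteq> pm.span ((\<lambda>t. Poly_Mapping.single t (1::'k)) ` A)"
  proof
    fix v :: "'a \<Rightarrow>\<^sub>0 'k" assume "v \<in> supp_in A"
    then have "v = (\<Sum>t\<in>A. smul (Poly_Mapping.lookup v t) (Poly_Mapping.single t 1))"
      using keys_sum_singles[OF assms, of v] by (simp add: supp_in_def)
    also have "\<dots> \<in> pm.span ((\<lambda>t. Poly_Mapping.single t (1::'k)) ` A)"
      by (intro pm.span_sum pm.span_scale pm.span_base) auto
    finally show "v \<in> pm.span ((\<lambda>t. Poly_Mapping.single t (1::'k)) ` A)" .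
  qed
  show "pm.span ((\<lambda>t. Poly_Mapping.single t (1::'k)) ` A) \<subseteq> supp_in A"
    by (rule pm.span_minimal[OF _ subspace_supp_in]) (auto simp: supp_in_def)
qed

lemma finite_basis_exists:
  assumes "pm.subspace V" "V \<subseteq> supp_in A" "finite A"
  obtains B where "finite B" "B \<subseteq> V" "pm.independent B" "pm.span B = V" "card B = pm.dim V"
proof -
  obtain B where B: "B \<subseteq> V" "pm.independent B" "V \<subseteq> pm.span B" "card B = pm.dim V"
    using pm.basis_exists[of V] by blast
  have "finite B"
    using pm.independent_span_bound[OF finite_imageI[OF assms(3)] B(2)] B(1) assms(2)
    unfolding supp_in_span_singles[OF assms(3)] by blast
  moreover have "pm.span B = V" using B(3) pm.span_minimal[OF B(1) assms(1)] by blast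
  ultimately show ?thesis using that B by blast
qed

text \<open>Rank-nullity for the map from \<open>A\<close> to \<open>(V + \<phi>(A))/V\<close>,
  phrased without quotient spaces. A basis \<open>B\<close> of the kernel is extended to a basis of
  \<open>A\<close> by \<open>C\<close>; then a basis of \<open>V\<close> together with the image of
  \<open>C\<close> is a basis of the sum.\<close>

lemma dim_sum_image:
  fixes \<phi> :: "('a \<Rightarrow>\<^sub>0 'k::field) \<Rightarrow> ('b \<Rightarrow>\<^sub>0 'k)"
  assumes A: "pm.subspace A" "A \<subseteq> supp_in X" "finite X"
    and V: "pm.subspace V" "V \<subseteq> supp_in Y" "finite Y"
    and \<phi>: "Vector_Spaces.linear smul smul \<phi>"
  shows "pm.dim {v + \<phi> a | v a. v \<in> V \<and> a \<in> A} + pm.dim {a \<in> A. \<phi> a \<in> V} = pm.dim V + pm.dim A"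
proof -
  interpret l: Vector_Spaces.linear smul smul \<phi> by (rule \<phi>)
  let ?K = "{a \<in> A. \<phi> a \<in> V}"
  have K: "pm.subspace ?K"
    using A(1) V(1) by (auto simp: pm.subspace_def l.add l.scale l.zero)
  have "?K \<subseteq> supp_in X" using A(2) by blast
  then obtain B where B: "finite B" "B \<subseteq> ?K" "pm.independent B" "pm.span B = ?K" "card B = pm.dim ?K"
    using finite_basis_exists[OF K _ A(3)] by blast
  obtain E where E: "finite E" "E \<subseteq> V" "pm.independent E" "pm.span E = V" "card E = pm.dim V"
    using finite_basis_exists[OF V] by blast
  obtain B' where B': "B \<subseteq> B'" "B' \<subseteq> A" "pm.independent B'" "A \<subseteq> pm.span B'"
    using pm.maximal_independent_subset_extend[of B A] B by blast
  have "finite B'"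
    using pm.independent_span_bound[OF finite_imageI[OF A(3)] B'(3)] B'(2) A(2)
    unfolding supp_in_span_singles[OF A(3)] by blast
  define C where "C = B' - B"
  have C: "finite C" "C \<inter> B = {}" "C \<subseteq> A" "B \<union> C = B'"
    using \<open>finite B'\<close> B' by (auto simp: C_def)
  have spanB': "pm.span B' = A" using B'(4) pm.span_minimal[OF B'(2) A(1)] by blast
  have dimA: "pm.dim A = card B + card C"
    using pm.basis_card_eq_dim[OF B'(2,4,3)] C B(1) by (metis Int_commute card_Un_disjoint)
  \<comment> \<open>The cardinality in the claim also records that \<open>\<phi>\<close> is
    injective on \<open>C'\<close> and that the image misses \<open>E\<close>.\<close>
  have main: "pm.independent (E \<union> \<phi> ` C') \<and> card (E \<union> \<phi> ` C') = card E + card C'"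
    if "C' \<subseteq> C" for C'
    using finite_subset[OF that C(1)] that
  proof (induction C' rule: finite_induct)
    case empty
    then show ?case using E by simp
  next
    case (insert c C')
    \<comment> \<open>A relation would give \<open>y\<close> in the span of \<open>C'\<close> with
      \<open>\<phi> (c - y)\<close> in \<open>V\<close>, hence \<open>c - y\<close> in the span of
      \<open>B\<close>, against the independence of \<open>B'\<close>.\<close>
    have "\<phi> c \<notin> pm.span (E \<union> \<phi> ` C')"
    proof
      assume "\<phi> c \<in> pm.span (E \<union> \<phi> ` C')"
      then obtain v w where vw: "v \<in> V" "w \<in> pm.span (\<phi> ` C')" "\<phi> c = v + w"
        unfolding pm.span_Un using E(4) by blast
      obtain y where y: "y \<in> pm.span C'" "w = \<phi> y" using vw(2) l.span_image[of C'] by blast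
      have "pm.span C' \<subseteq> A" using insert.prems C(3) A(1) by (intro pm.span_minimal) auto
      then have "c - y \<in> A" using y insert.prems C(3) A(1) by (intro pm.subspace_diff) auto
      moreover have "\<phi> (c - y) = v" using vw y by (simp add: l.diff)
      ultimately have "c - y \<in> pm.span B" using B(4) vw(1) by simp
      then have "c - y \<in> pm.span (B \<union> C')" "y \<in> pm.span (B \<union> C')"
        using y pm.span_mono[of B "B \<union> C'"] pm.span_mono[of C' "B \<union> C'"] by auto
      then have "c \<in> pm.span (B \<union> C')" using pm.span_add[of "c - y" "B \<union> C'" y] by simp
      moreover have "B \<union> C' \<subseteq> B' - {c}" "c \<in> B'" using insert C by auto
      ultimately have "pm.dependent B'" unfolding pm.dependent_def using pm.span_mono[of "B \<union> C'" "B' - {c}"] by blast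
      then show False using B'(3) by simp
    qed
    moreover have "pm.independent (E \<union> \<phi> ` C')" "card (E \<union> \<phi> ` C') = card E + card C'"
      using insert by auto
    moreover have "\<phi> c \<notin> E \<union> \<phi> ` C'" using calculation(1) pm.span_base[of "\<phi> c" "E \<union> \<phi> ` C'"] by blast
    ultimately show ?case using insert.hyps E(1) pm.independent_insertI[of "\<phi> c" "E \<union> \<phi> ` C'"]
      by simp
  qed
  have "pm.span (E \<union> \<phi> ` C) = {v + \<phi> a | v a. v \<in> V \<and> a \<in> A}"
  proof (intro equalityI subsetI)
    fix x assume "x \<in> pm.span (E \<union> \<phi> ` C)"
    then obtain v w where vw: "v \<in> V" "w \<in> pm.span (\<phi> ` C)" "x = v + w"
      unfolding pm.span_Un using E(4) by blast
    obtain y where y: "y \<in> pm.span C" "w = \<phi> y" using vw(2) l.span_image[of C] by blast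
    have "pm.span C \<subseteq> A" using C(3) A(1) by (intro pm.span_minimal) auto
    then show "x \<in> {v + \<phi> a | v a. v \<in> V \<and> a \<in> A}" using vw y by blast
  next
    fix x assume "x \<in> {v + \<phi> a | v a. v \<in> V \<and> a \<in> A}"
    then obtain v a where va: "v \<in> V" "a \<in> A" "x = v + \<phi> a" by blast
    have "a \<in> pm.span (B \<union> C)" using va spanB' C(4) by simp
    then obtain b c where bc: "b \<in> pm.span B" "c \<in> pm.span C" "a = b + c"
      unfolding pm.span_Un by blast
    have "\<phi> b \<in> V" using bc(1) B(4) by simp
    then have "v + \<phi> b \<in> pm.span E" using va V(1) E(4) by (simp add: pm.subspace_add)
    moreover have "\<phi> c \<in> pm.span (\<phi> ` C)" using bc(2) l.span_image[of C] by blast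
    ultimately have "(v + \<phi> b) + \<phi> c \<in> pm.span (E \<union> \<phi> ` C)" unfolding pm.span_Un by blast
    then show "x \<in> pm.span (E \<union> \<phi> ` C)" using va bc by (simp add: l.add add.assoc)
  qed
  then have "pm.dim {v + \<phi> a | v a. v \<in> V \<and> a \<in> A} = card E + card C"
    using main[OF order_refl] pm.dim_span_eq_card_independent by metis
  then show ?thesis using dimA B(5) E(5) by simp
qed

subsection \<open>Leading terms\<close>

text \<open>Relative to \<open>A\<close>, because \<open>monomial_order\<close> constrains the order
  on valid terms only.\<close>

definition strict_total_on :: "'a set \<Rightarrow> ('a \<Rightarrow> 'a \<Rightarrow> bool) \<Rightarrow> bool" where
  "strict_total_on A ord \<longleftrightarrow> (\<forall>s\<in>A. \<not> ord s s)
     \<and> (\<forall>s\<in>A. \<forall>t\<in>A. \<forall>u\<in>A. ord s t \<longrightarrow> ord t u \<longrightarrow> ord s u)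
     \<and> (\<forall>s\<in>A. \<forall>t\<in>A. s = t \<or> ord s t \<or> ord t s)"

lemma strict_total_on_subset: "strict_total_on A ord \<Longrightarrow> B \<subseteq> A \<Longrightarrow> strict_total_on B ord"
  unfolding strict_total_on_def by (meson subsetD)

lemma strict_total_on_max:
  assumes "finite A" "A \<noteq> {}" "strict_total_on A ord"
  shows "\<exists>t\<in>A. \<forall>s\<in>A. s \<noteq> t \<longrightarrow> ord s t"
  using assms
proof (induction A rule: finite_ne_induct)
  case (insert x A)
  then obtain t where t: "t \<in> A" "\<forall>s\<in>A. s \<noteq> t \<longrightarrow> ord s t"
    using strict_total_on_subset[of "insert x A" ord A] by blast
  have tr: "ord s u" if "ord s r" "ord r u" "s \<in> insert x A" "r \<in> insert x A" "u \<in> insert x A" for s r u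
    using insert.prems that unfolding strict_total_on_def by blast
  have "x \<noteq> t" using insert.hyps t by blast
  then consider "ord x t" | "ord t x" using insert.prems t(1) unfolding strict_total_on_def by blast
  then show ?case
  proof cases
    case 1
    then show ?thesis using t by auto
  next
    case 2
    have "ord s x" if "s \<in> A" for s using tr[of s t x] t 2 that by (cases "s = t") auto
    then show ?thesis by auto
  qed
qed simp

text \<open>The relational counterpart of \<open>lead_term\<close>: without a definite description
  it makes sense before any maximum is known to exist.\<close>

definition leads :: "('a \<Rightarrow> 'a \<Rightarrow> bool) \<Rightarrow> ('a \<Rightarrow>\<^sub>0 'k::field) set \<Rightarrow> 'a set" where
  "leads ord V = {t. \<exists>v\<in>V. t \<in> Poly_Mapping.keys v \<and> (\<forall>s\<in>Poly_Mapping.keys v. s \<noteq> t \<longrightarrow> ord s t)}"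

text \<open>Gaussian elimination at the greatest term \<open>t\<close> of \<open>A\<close>: the
  vectors of \<open>V\<close> without \<open>t\<close> form a subspace of codimension at most 1, and
  of codimension 1 exactly when \<open>t\<close> is a leading term.\<close>

lemma dim_eq_card_leads:
  assumes "finite A" "strict_total_on A ord" "pm.subspace V" "V \<subseteq> supp_in A"
  shows "pm.dim V = card (leads ord V)"
  using assms
proof (induction A arbitrary: V rule: finite_psubset_induct)
  case (psubset A)
  show ?case
  proof (cases "A = {}")
    case True
    then have "V \<subseteq> {0}" using psubset.prems by (auto simp: supp_in_def)
    then have "V = {0}" using psubset.prems(2) pm.subspace_0 by blast
    moreover have "pm.dim V = card ({} :: ('a \<Rightarrow>\<^sub>0 'b) set)"
      using calculation by (intro pm.basis_card_eq_dim[symmetric]) (auto simp: pm.independent_empty)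
    ultimately show ?thesis by (simp add: leads_def)
  next
    case False
    then obtain t where t: "t \<in> A" "\<And>s. s \<in> A \<Longrightarrow> s \<noteq> t \<Longrightarrow> ord s t"
      using strict_total_on_max[OF psubset.hyps] psubset.prems by blast
    have irr: "\<not> (ord s t \<and> ord t s)" if "s \<in> A" for s
      using psubset.prems(1) t(1) that unfolding strict_total_on_def by blast
    let ?V' = "{v \<in> V. Poly_Mapping.lookup v t = 0}"
    have V'sub: "pm.subspace ?V'"
      using psubset.prems(2) by (auto simp: pm.subspace_def lookup_add)
    have V'supp: "?V' \<subseteq> supp_in (A - {t})"
      using psubset.prems(3) by (auto simp: supp_in_def in_keys_iff)
    have IH: "pm.dim ?V' = card (leads ord ?V')"
      by (rule psubset.IH[of "A - {t}"])
        (use t V'sub V'supp psubset.prems strict_total_on_subset[of A ord "A - {t}"] in auto)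
    show ?thesis
    proof (cases "\<exists>w\<in>V. Poly_Mapping.lookup w t \<noteq> 0")
      case False
      then have "?V' = V" by auto
      then show ?thesis using IH by simp
    next
      case True
      then obtain w where w: "w \<in> V" "Poly_Mapping.lookup w t \<noteq> 0" by blast
      obtain B where B: "finite B" "B \<subseteq> ?V'" "pm.independent B" "pm.span B = ?V'" "card B = pm.dim ?V'"
        using finite_basis_exists[OF V'sub V'supp] psubset.hyps by auto
      have wB: "w \<notin> pm.span B" using w B(4) by simp
      have VB: "V \<subseteq> pm.span (insert w B)"
      proof
        fix v assume v: "v \<in> V"
        let ?c = "Poly_Mapping.lookup v t / Poly_Mapping.lookup w t"
        have "v - smul ?c w \<in> V" using v w psubset.prems(2) by (simp add: pm.subspace_diff pm.subspace_scale)
        then have "v - smul ?c w \<in> pm.span B" using B(4) w by (simp add: lookup_minus)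
        then show "v \<in> pm.span (insert w B)" by (auto simp: pm.span_insert)
      qed
      have "pm.dim V = card (insert w B)"
      proof -
        have "insert w B \<subseteq> V" using w B(2) by blast
        then show ?thesis
          using pm.basis_card_eq_dim[of "insert w B" V] VB pm.independent_insertI[OF wB B(3)] by simp
      qed
      also have "\<dots> = Suc (card (leads ord ?V'))"
      proof -
        have "w \<notin> B" using wB pm.span_base[of w B] by blast
        then show ?thesis using B(1,5) IH by simp
      qed
      also have "\<dots> = card (insert t (leads ord ?V'))"
      proof -
        have sub: "leads ord ?V' \<subseteq> A - {t}" using V'supp unfolding leads_def supp_in_def by blast
        then have "finite (leads ord ?V')" using psubset.hyps finite_subset by blast
        moreover have "t \<notin> leads ord ?V'" using sub by blast
        ultimately show ?thesis by (rule card_insert_disjoint[symmetric])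
      qed
      also have "insert t (leads ord ?V') = leads ord V"
      proof (intro equalityI subsetI)
        fix s assume "s \<in> insert t (leads ord ?V')"
        moreover have "t \<in> leads ord V"
          unfolding leads_def using w t(2) psubset.prems(3)
          by (auto simp: in_keys_iff supp_in_def intro!: bexI[of _ w])
        moreover have "leads ord ?V' \<subseteq> leads ord V" unfolding leads_def by blast
        ultimately show "s \<in> leads ord V" by blast
      next
        fix s assume "s \<in> leads ord V"
        then obtain v where v: "v \<in> V" "s \<in> Poly_Mapping.keys v"
          "\<And>r. r \<in> Poly_Mapping.keys v \<Longrightarrow> r \<noteq> s \<Longrightarrow> ord r s" unfolding leads_def by blast
        show "s \<in> insert t (leads ord ?V')"
        proof (cases "s = t")
          case False
          have sA: "s \<in> A" using v psubset.prems(3) by (auto simp: supp_in_def)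
          have "t \<notin> Poly_Mapping.keys v" using v(3)[of t] False irr[OF sA] t(2)[OF sA] by auto
          then have "v \<in> ?V'" using v(1) by (simp add: in_keys_iff)
          then show ?thesis unfolding leads_def using v(2,3) by blast
        qed simp
      qed
      finally show ?thesis .
    qed
  qed
qed

lemma dim_supp_in:
  assumes "finite A"
  shows "pm.dim (supp_in A :: ('a \<Rightarrow>\<^sub>0 'k::field) set) = card A"
proof -
  have "card ((\<lambda>t. Poly_Mapping.single t (1::'k)) ` A) = card A"
    by (intro card_image inj_onI) (metis lookup_single_eq lookup_single_not_eq zero_neq_one)
  moreover have "pm.independent ((\<lambda>t. Poly_Mapping.single t (1::'k)) ` A)"
    using assms
  proof (induction A rule: finite_induct)
    case (insert x A)
    have "Poly_Mapping.single x (1::'k) \<notin> pm.span ((\<lambda>t. Poly_Mapping.single t (1::'k)) ` A)"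
      using insert.hyps by (simp add: supp_in_span_singles[symmetric] supp_in_def)
    then show ?case using insert by (simp add: pm.independent_insertI)
  qed (simp add: pm.independent_empty)
  ultimately show ?thesis
    unfolding supp_in_span_singles[OF assms] by (simp add: pm.dim_eq_card_independent)
qed

subsection \<open>Graded subspaces\<close>

lift_definition hpart :: "('a \<Rightarrow> nat) \<Rightarrow> nat \<Rightarrow> ('a \<Rightarrow>\<^sub>0 'k::zero) \<Rightarrow> ('a \<Rightarrow>\<^sub>0 'k)" is
  "\<lambda>dg z v t. if dg t = z then v t else 0"
  by (rule finite_subset) auto

lemma lookup_hpart: "Poly_Mapping.lookup (hpart dg z v) t = (if dg t = z then Poly_Mapping.lookup v t else 0)"
  by transfer simp

lemma keys_hpart: "Poly_Mapping.keys (hpart dg z v) = {t \<in> Poly_Mapping.keys v. dg t = z}"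
  by (auto simp: in_keys_iff lookup_hpart split: if_splits)

lemma hpart_add: "hpart dg z (v + w) = hpart dg z v + hpart dg z w"
  by (rule poly_mapping_eqI) (simp add: lookup_add lookup_hpart)

lemma hpart_zero [simp]: "hpart dg z 0 = 0"
  by (rule poly_mapping_eqI) (simp add: lookup_hpart)

lemma hpart_sum: "hpart dg z (\<Sum>i\<in>I. f i) = (\<Sum>i\<in>I. hpart dg z (f i))"
  by (induction I rule: infinite_finite_induct) (auto simp: hpart_add)

definition hom_of_deg :: "('a \<Rightarrow> nat) \<Rightarrow> nat \<Rightarrow> ('a \<Rightarrow>\<^sub>0 'k::zero) \<Rightarrow> bool" where
  "hom_of_deg dg z v \<longleftrightarrow> (\<forall>t\<in>Poly_Mapping.keys v. dg t = z)"

lemma hom_of_deg_iff_hpart: "hom_of_deg dg z v \<longleftrightarrow> hpart dg z v = v"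
proof
  assume "hom_of_deg dg z v"
  then show "hpart dg z v = v"
    by (intro poly_mapping_eqI) (auto simp: lookup_hpart hom_of_deg_def in_keys_iff)
next
  assume "hpart dg z v = v"
  then show "hom_of_deg dg z v" unfolding hom_of_deg_def using keys_hpart[of dg z v] by auto
qed

lemma hpart_hom_of_deg: "hom_of_deg dg z v \<Longrightarrow> hpart dg y v = (if y = z then v else 0)"
  by (rule poly_mapping_eqI) (auto simp: lookup_hpart hom_of_deg_def in_keys_iff)

lemma hom_of_deg_hpart: "hom_of_deg dg z (hpart dg z v)"
  by (simp add: hom_of_deg_def keys_hpart)

lemma sum_hpart: "v = (\<Sum>z\<in>dg ` Poly_Mapping.keys v. hpart dg z v)"
  by (rule poly_mapping_eqI) (auto simp: lookup_sum lookup_hpart in_keys_iff)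

definition gr :: "('a \<Rightarrow> nat) \<Rightarrow> nat \<Rightarrow> ('a \<Rightarrow>\<^sub>0 'k::zero) set \<Rightarrow> ('a \<Rightarrow>\<^sub>0 'k) set" where
  "gr dg z V = {v \<in> V. hom_of_deg dg z v}"

definition graded :: "('a \<Rightarrow> nat) \<Rightarrow> ('a \<Rightarrow>\<^sub>0 'k::zero) set \<Rightarrow> bool" where
  "graded dg V \<longleftrightarrow> (\<forall>v\<in>V. \<forall>z. hpart dg z v \<in> V)"

definition hilb :: "('a \<Rightarrow> nat) \<Rightarrow> ('a \<Rightarrow>\<^sub>0 'k::field) set \<Rightarrow> nat \<Rightarrow> nat" where
  "hilb dg V z = pm.dim (gr dg z V)"

lemma subspace_gr: "pm.subspace V \<Longrightarrow> pm.subspace (gr dg z V)"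
proof -
  assume V: "pm.subspace V"
  have eq: "gr dg z V = V \<inter> supp_in {t. dg t = z}"
    by (auto simp: gr_def hom_of_deg_def supp_in_def)
  show ?thesis unfolding eq using V subspace_supp_in by (rule pm.subspace_inter)
qed

lemma gr_supp_in: "V \<subseteq> supp_in X \<Longrightarrow> gr dg z V \<subseteq> supp_in {t \<in> X. dg t = z}"
  by (auto simp: gr_def hom_of_deg_def supp_in_def)

lemma gr_supp_in_eq: "gr dg z (supp_in X) = supp_in {t \<in> X. dg t = z}"
  by (auto simp: gr_def hom_of_deg_def supp_in_def)

lemma hilb_supp_in: "finite {t \<in> X. dg t = z} \<Longrightarrow> hilb dg (supp_in X) z = card {t \<in> X. dg t = z}"
  by (simp add: hilb_def gr_supp_in_eq dim_supp_in)

text \<open>Macaulay's theorem on leading monomials. The order need not refine the degree: passing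
  to the homogeneous component containing \<open>t\<close> only removes terms, so \<open>t\<close>
  stays leading.\<close>

lemma hilb_eq_card_leads:
  assumes "pm.subspace V" "graded dg V" "V \<subseteq> supp_in X" "finite {t \<in> X. dg t = z}"
    and "strict_total_on X ord"
  shows "hilb dg V z = card {t \<in> leads ord V. dg t = z}"
proof -
  have "hilb dg V z = card (leads ord (gr dg z V))"
    unfolding hilb_def
    by (rule dim_eq_card_leads[OF assms(4) _ subspace_gr[OF assms(1)] gr_supp_in[OF assms(3)]])
      (rule strict_total_on_subset[OF assms(5)], blast)
  also have "leads ord (gr dg z V) = {t \<in> leads ord V. dg t = z}"
  proof (intro equalityI subsetI)
    fix t assume "t \<in> leads ord (gr dg z V)"
    then show "t \<in> {t \<in> leads ord V. dg t = z}" by (auto simp: leads_def gr_def hom_of_deg_def)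
  next
    fix t assume t: "t \<in> {t \<in> leads ord V. dg t = z}"
    then obtain v where v: "v \<in> V" "t \<in> Poly_Mapping.keys v"
      "\<forall>s\<in>Poly_Mapping.keys v. s \<noteq> t \<longrightarrow> ord s t" by (auto simp: leads_def)
    have "hpart dg z v \<in> gr dg z V" using v(1) assms(2) by (simp add: gr_def graded_def hom_of_deg_hpart)
    then show "t \<in> leads ord (gr dg z V)"
      unfolding leads_def using v t by (auto simp: keys_hpart intro!: bexI[of _ "hpart dg z v"])
  qed
  finally show ?thesis .
qed

text \<open>Rank-nullity in each degree for a map \<open>\<phi>\<close> that raises degrees by
  \<open>e\<close>; below \<open>e\<close> its image contributes nothing. It is applied to
  multiplication by \<open>g_i\<close> on \<open>F\<close> and to \<open>p \<mapsto> p f\<close> on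
  \<open>S\<close>.\<close>

lemma hilb_sum_image:
  fixes \<phi> :: "('a \<Rightarrow>\<^sub>0 'k::field) \<Rightarrow> ('b \<Rightarrow>\<^sub>0 'k)"
  assumes A: "pm.subspace A" "graded dg' A" "A \<subseteq> supp_in X" "\<And>y. finite {t \<in> X. dg' t = y}"
    and V: "pm.subspace V" "graded dg V" "V \<subseteq> supp_in Y" "\<And>y. finite {t \<in> Y. dg t = y}"
    and \<phi>: "Vector_Spaces.linear smul smul \<phi>"
    and hom: "\<And>a z. hpart dg z (\<phi> a) = (if e \<le> z then \<phi> (hpart dg' (z - e) a) else 0)"
  shows "int (hilb dg {v + \<phi> a | v a. v \<in> V \<and> a \<in> A} z) = int (hilb dg V z)
    + (if e \<le> z then int (hilb dg' A (z - e)) - int (hilb dg' {a \<in> A. \<phi> a \<in> V} (z - e)) else 0)"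
proof -
  interpret l: Vector_Spaces.linear smul smul \<phi> by (rule \<phi>)
  have z: "0 \<in> A" using A(1) by (rule pm.subspace_0)
  let ?S = "{v + \<phi> a | v a. v \<in> V \<and> a \<in> A}"
  show ?thesis
  proof (cases "e \<le> z")
    case False
    have "gr dg z ?S = gr dg z V"
    proof (intro equalityI subsetI)
      fix x assume "x \<in> gr dg z ?S"
      then obtain v a where x: "x = v + \<phi> a" "v \<in> V" "hpart dg z x = x"
        by (auto simp: gr_def hom_of_deg_iff_hpart)
      then have "x = hpart dg z v" using hom[of z a] False by (simp add: hpart_add)
      then show "x \<in> gr dg z V" using x V(2) by (simp add: gr_def graded_def hom_of_deg_hpart)
    next
      fix x assume x: "x \<in> gr dg z V"
      then have "x = x + \<phi> 0" "x \<in> V" by (simp_all add: l.zero gr_def)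
      then have "x \<in> ?S" using z by blast
      then show "x \<in> gr dg z ?S" using x by (simp add: gr_def)
    qed
    then show ?thesis using False by (simp add: hilb_def)
  next
    case True
    have eq: "gr dg z ?S = {v + \<phi> a | v a. v \<in> gr dg z V \<and> a \<in> gr dg' (z - e) A}"
    proof (intro equalityI subsetI)
      fix x assume "x \<in> gr dg z ?S"
      then obtain v a where x: "x = v + \<phi> a" "v \<in> V" "a \<in> A" "hpart dg z x = x"
        by (auto simp: gr_def hom_of_deg_iff_hpart)
      have "x = hpart dg z v + \<phi> (hpart dg' (z - e) a)"
        using x(1,4) hom[of z a] True by (simp add: hpart_add)
      moreover have "hpart dg z v \<in> gr dg z V" "hpart dg' (z - e) a \<in> gr dg' (z - e) A"
        using x A(2) V(2) by (simp_all add: gr_def graded_def hom_of_deg_hpart)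
      ultimately show "x \<in> {v + \<phi> a | v a. v \<in> gr dg z V \<and> a \<in> gr dg' (z - e) A}" by blast
    next
      fix x assume "x \<in> {v + \<phi> a | v a. v \<in> gr dg z V \<and> a \<in> gr dg' (z - e) A}"
      then obtain v a where x: "x = v + \<phi> a" "v \<in> gr dg z V" "a \<in> gr dg' (z - e) A" by blast
      then have "hpart dg z x = x"
        using hom[of z a] True by (simp add: hpart_add gr_def hom_of_deg_iff_hpart)
      then show "x \<in> gr dg z ?S" using x unfolding gr_def hom_of_deg_iff_hpart by blast
    qed
    have K: "gr dg' (z - e) {a \<in> A. \<phi> a \<in> V} = {a \<in> gr dg' (z - e) A. \<phi> a \<in> gr dg z V}"
    proof (intro equalityI subsetI)
      fix a assume a: "a \<in> gr dg' (z - e) {a \<in> A. \<phi> a \<in> V}"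
      then have "hpart dg z (\<phi> a) = \<phi> a" using hom[of z a] True by (simp add: gr_def hom_of_deg_iff_hpart)
      then show "a \<in> {a \<in> gr dg' (z - e) A. \<phi> a \<in> gr dg z V}" using a
        by (simp add: gr_def hom_of_deg_iff_hpart)
    qed (auto simp: gr_def)
    have "pm.dim {v + \<phi> a | v a. v \<in> gr dg z V \<and> a \<in> gr dg' (z - e) A}
        + pm.dim {a \<in> gr dg' (z - e) A. \<phi> a \<in> gr dg z V} = pm.dim (gr dg z V) + pm.dim (gr dg' (z - e) A)"
      by (rule dim_sum_image[OF subspace_gr[OF A(1)] gr_supp_in[OF A(3)] A(4)
            subspace_gr[OF V(1)] gr_supp_in[OF V(3)] V(4) \<phi>])
    then show ?thesis using True unfolding hilb_def eq K by simp
  qed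
qed

subsection \<open>Components of module elements\<close>

text \<open>\<open>mmult\<close> is a double sum over supports. Its laws are obtained
  coordinatewise, where it becomes multiplication of polynomials.\<close>

definition component :: "nat \<Rightarrow> ('k::field) mvec \<Rightarrow> 'k poly" where
  "component j v = Poly_Mapping.map_key (\<lambda>a. (a, j)) v"

lemma lookup_component [simp]: "Poly_Mapping.lookup (component j v) a = Poly_Mapping.lookup v (a, j)"
  by (simp add: component_def Poly_Mapping.map_key.rep_eq inj_on_def)

lemma mvec_eqI: "(\<And>j. component j v = component j w) \<Longrightarrow> v = w"
  by (rule poly_mapping_eqI) (metis lookup_component prod.exhaust)

lemma component_add: "component j (v + w) = component j v + component j w"
  by (rule poly_mapping_eqI) (simp add: lookup_add)

lemma component_zero [simp]: "component j 0 = 0"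
  by (rule poly_mapping_eqI) simp

lemma component_smul: "component j (smul c v) = smul c (component j v)"
  by (rule poly_mapping_eqI) simp

lemma component_sum: "component j (\<Sum>i\<in>I. f i) = (\<Sum>i\<in>I. component j (f i))"
  by (induction I rule: infinite_finite_induct) (auto simp: component_add)

lemma component_single:
  "component j (Poly_Mapping.single t c) = (if snd t = j then Poly_Mapping.single (fst t) c else 0)"
  by (cases t) (auto intro!: poly_mapping_eqI simp: lookup_single when_def)

lemma smul_eq_mult: "smul c p = Poly_Mapping.single 0 c * (p :: 'k::field poly)"
  unfolding smul_def by (rule mult_map_scale_conv_mult)

lemma component_mmult: "component j (mmult p v) = p * component j v"
proof -
  have p: "p = (\<Sum>a\<in>Poly_Mapping.keys p. Poly_Mapping.single a (Poly_Mapping.lookup p a))"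
    by (rule keys_sum_singles) auto
  have "component j v = component j (\<Sum>t\<in>Poly_Mapping.keys v. Poly_Mapping.single t (Poly_Mapping.lookup v t))"
    using keys_sum_singles[of "Poly_Mapping.keys v" v] by simp
  also have "\<dots> = (\<Sum>t\<in>Poly_Mapping.keys v.
      if snd t = j then Poly_Mapping.single (fst t) (Poly_Mapping.lookup v t) else 0)"
    by (simp add: component_sum component_single)
  finally have v: "component j v = \<dots>" .
  have "component j (mmult p v) = (\<Sum>a\<in>Poly_Mapping.keys p. \<Sum>t\<in>Poly_Mapping.keys v.
      Poly_Mapping.single a (Poly_Mapping.lookup p a) *
      (if snd t = j then Poly_Mapping.single (fst t) (Poly_Mapping.lookup v t) else 0))"
    unfolding mmult_def component_sum component_single
    by (intro sum.cong refl) (simp add: mult_single)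
  also have "\<dots> = (\<Sum>a\<in>Poly_Mapping.keys p. Poly_Mapping.single a (Poly_Mapping.lookup p a)) * component j v"
    unfolding v by (simp add: sum_product)
  also have "\<dots> = p * component j v" using p by simp
  finally show ?thesis .
qed

lemma mmult_add_left: "mmult (p + q) v = mmult p v + mmult q v"
  by (rule mvec_eqI) (simp add: component_mmult component_add distrib_right)

lemma mmult_add_right: "mmult p (v + w) = mmult p v + mmult p w"
  by (rule mvec_eqI) (simp add: component_mmult component_add distrib_left)

lemma mmult_zero_left [simp]: "mmult 0 v = 0"
  by (rule mvec_eqI) (simp add: component_mmult)

lemma mmult_zero_right [simp]: "mmult p 0 = 0"
  by (rule mvec_eqI) (simp add: component_mmult)

lemma mmult_one [simp]: "mmult 1 v = v"
  by (rule mvec_eqI) (simp add: component_mmult)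

lemma mmult_mult: "mmult (p * q) v = mmult p (mmult q v)"
  by (rule mvec_eqI) (simp add: component_mmult mult.assoc)

lemma mmult_commute: "mmult p (mmult q v) = mmult q (mmult p v)"
  by (simp add: mmult_mult[symmetric] mult.commute)

lemma mmult_smul_left: "mmult (smul c p) v = smul c (mmult p v)"
  by (rule mvec_eqI) (simp add: component_mmult component_smul smul_eq_mult mult.assoc)

lemma mmult_smul_right: "mmult p (smul c v) = smul c (mmult p v)"
  by (rule mvec_eqI) (simp add: component_mmult component_smul smul_eq_mult mult.left_commute)

lemma mmult_single_0: "mmult (Poly_Mapping.single 0 c) v = smul c v"
  by (rule mvec_eqI) (simp add: component_mmult component_smul smul_eq_mult)

lemma mmult_sum_left: "mmult (\<Sum>i\<in>I. p i) v = (\<Sum>i\<in>I. mmult (p i) v)"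
  by (induction I rule: infinite_finite_induct) (auto simp: mmult_add_left)

text \<open>\<open>F\<close> is torsion-free over a domain. Hence a cone is a free module over its
  polynomial ring, and its type determines its Hilbert function.\<close>

lemma mmult_eq_0:
  assumes "mmult p v = 0" "v \<noteq> 0"
  shows "p = (0 :: 'k::field poly)"
proof -
  obtain j where "component j v \<noteq> 0" using assms(2) mvec_eqI[of v 0] by auto
  moreover have "p * component j v = 0" using assms(1) component_mmult[of j p v] by simp
  ultimately show ?thesis by simp
qed

lemma linear_mmult_left: "Vector_Spaces.linear smul smul (\<lambda>p. mmult p v)"
  by unfold_locales (simp_all add: mmult_add_left mmult_smul_left)

lemma linear_mmult_right: "Vector_Spaces.linear smul smul (mmult p)"
  by unfold_locales (simp_all add: mmult_add_right mmult_smul_right)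

lemma keys_mmult:
  "t \<in> Poly_Mapping.keys (mmult p v) \<Longrightarrow>
    \<exists>a\<in>Poly_Mapping.keys p. \<exists>s\<in>Poly_Mapping.keys v. t = (a + fst s, snd s)"
proof -
  assume "t \<in> Poly_Mapping.keys (mmult p v)"
  moreover obtain a j where t: "t = (a, j)" by force
  ultimately have "a \<in> Poly_Mapping.keys (p * component j v)"
    by (simp add: component_mmult[symmetric] in_keys_iff)
  then obtain b c where "b \<in> Poly_Mapping.keys p" "c \<in> Poly_Mapping.keys (component j v)" "a = b + c"
    using Poly_Mapping.keys_mult[of p "component j v"] by blast
  then show ?thesis using t by (force simp: in_keys_iff)
qed

lemma lookup_single_mult: "Poly_Mapping.lookup (Poly_Mapping.single b c * q) (b + a) = c * Poly_Mapping.lookup q a"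
  for q :: "'k::field poly"
proof -
  have "Poly_Mapping.single b c * q =
      Poly_Mapping.single b c * (\<Sum>t\<in>Poly_Mapping.keys q. Poly_Mapping.single t (Poly_Mapping.lookup q t))"
    using keys_sum_singles[of "Poly_Mapping.keys q" q] by simp
  also have "\<dots> = (\<Sum>t\<in>Poly_Mapping.keys q. Poly_Mapping.single (b + t) (c * Poly_Mapping.lookup q t))"
    by (simp add: sum_distrib_left mult_single)
  finally show ?thesis
    by (auto simp: lookup_sum lookup_single when_def in_keys_iff)
qed

lemma keys_single_mult:
  assumes "c \<noteq> 0"
  shows "Poly_Mapping.keys (Poly_Mapping.single b c * q) = (+) b ` Poly_Mapping.keys (q :: 'k::field poly)"
proof (intro equalityI subsetI)
  fix a assume "a \<in> Poly_Mapping.keys (Poly_Mapping.single b c * q)"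
  then show "a \<in> (+) b ` Poly_Mapping.keys q"
    using Poly_Mapping.keys_mult[of "Poly_Mapping.single b c" q] by (auto split: if_splits)
next
  fix a assume "a \<in> (+) b ` Poly_Mapping.keys q"
  then show "a \<in> Poly_Mapping.keys (Poly_Mapping.single b c * q)"
    using assms by (auto simp: in_keys_iff lookup_single_mult)
qed

lemma keys_mmult_single:
  assumes "c \<noteq> 0"
  shows "Poly_Mapping.keys (mmult (Poly_Mapping.single b c) v) =
    (\<lambda>s. (b + fst s, snd s)) ` Poly_Mapping.keys (v :: 'k::field mvec)"
proof (intro equalityI subsetI)
  fix t assume "t \<in> Poly_Mapping.keys (mmult (Poly_Mapping.single b c) v)"
  then show "t \<in> (\<lambda>s. (b + fst s, snd s)) ` Poly_Mapping.keys v"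
    using keys_mmult[of t "Poly_Mapping.single b c" v] by (auto split: if_splits)
next
  fix t assume "t \<in> (\<lambda>s. (b + fst s, snd s)) ` Poly_Mapping.keys v"
  then obtain a j where a: "(a, j) \<in> Poly_Mapping.keys v" "t = (b + a, j)" by force
  have "Poly_Mapping.lookup (mmult (Poly_Mapping.single b c) v) t = c * Poly_Mapping.lookup v (a, j)"
    using lookup_single_mult[of b c "component j v" a] a by (simp add: component_mmult[symmetric])
  then show "t \<in> Poly_Mapping.keys (mmult (Poly_Mapping.single b c) v)"
    using a assms by (simp add: in_keys_iff)
qed

lemma hom_of_deg_mmult:
  assumes "hom_of_deg tdeg y p" "hom_of_deg (mtdeg degE) x v"
  shows "hom_of_deg (mtdeg degE) (y + x) (mmult p v)"
  using assms keys_mmult[of _ p v] unfolding hom_of_deg_def mtdeg_def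
  by (fastforce simp: tdeg_add)

lemma hpart_linear:
  assumes \<phi>: "Vector_Spaces.linear smul smul \<phi>"
    and hom: "\<And>y a. hom_of_deg dg' y a \<Longrightarrow> hom_of_deg dg (y + e) (\<phi> a)"
  shows "hpart dg z (\<phi> a) = (if e \<le> z then \<phi> (hpart dg' (z - e) a) else 0)"
proof -
  interpret l: Vector_Spaces.linear smul smul \<phi> by (rule \<phi>)
  let ?Y = "dg' ` Poly_Mapping.keys a"
  have "hpart dg z (\<phi> a) = hpart dg z (\<phi> (\<Sum>y\<in>?Y. hpart dg' y a))"
    using sum_hpart[of a dg'] by simp
  also have "\<dots> = (\<Sum>y\<in>?Y. hpart dg z (\<phi> (hpart dg' y a)))" by (simp add: l.sum hpart_sum)
  also have "\<dots> = (\<Sum>y\<in>?Y. if z = y + e then \<phi> (hpart dg' y a) else 0)"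
    by (intro sum.cong refl hpart_hom_of_deg hom hom_of_deg_hpart)
  also have "\<dots> = (\<Sum>y\<in>?Y. if y = z - e \<and> e \<le> z then \<phi> (hpart dg' y a) else 0)"
    by (intro sum.cong refl) auto
  also have "\<dots> = (if e \<le> z then \<phi> (hpart dg' (z - e) a) else 0)"
  proof (cases "z - e \<in> ?Y")
    case False
    then have "k \<notin> Poly_Mapping.keys a" if "dg' k = z - e" for k using that by (metis imageI)
    then have "hpart dg' (z - e) a = 0"
      by (intro poly_mapping_eqI) (auto simp: lookup_hpart in_keys_iff)
    then show ?thesis using False by (auto simp: l.zero intro!: sum.neutral)
  qed (auto simp: sum.delta')
  finally show ?thesis .
qed

subsection \<open>Submodules\<close>

lemma Sring_eq: "Sring n = supp_in (expos {..<n})"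
  by (auto simp: Sring_def supp_in_def expos_def valid_expo_def)

lemma Fmod_eq: "Fmod n m = supp_in {t. valid_term n m t}"
  by (auto simp: Fmod_def supp_in_def)

lemma single_in_Sring: "valid_expo n a \<Longrightarrow> Poly_Mapping.single a c \<in> Sring n"
  by (simp add: Sring_def)

lemma Sring_add: "p \<in> Sring n \<Longrightarrow> q \<in> Sring n \<Longrightarrow> p + q \<in> Sring n"
  unfolding Sring_eq using subspace_supp_in pm.subspace_add by blast

lemma Sring_zero [simp]: "0 \<in> Sring n" by (simp add: Sring_def)
lemma Sring_one [simp]: "1 \<in> Sring n"
  by (simp add: Sring_def valid_expo_def)

lemma Sring_mult: "p \<in> Sring n \<Longrightarrow> q \<in> Sring n \<Longrightarrow> p * q \<in> Sring n"
  using Poly_Mapping.keys_mult[of p q] by (force simp: Sring_def valid_expo_def keys_add_expo)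

definition smod :: "nat \<Rightarrow> ('k::field) mvec set \<Rightarrow> bool" where
  "smod n V \<longleftrightarrow> 0 \<in> V \<and> (\<forall>a\<in>V. \<forall>b\<in>V. a + b \<in> V) \<and> (\<forall>p\<in>Sring n. \<forall>a\<in>V. mmult p a \<in> V)"

lemma smod_subspace: "smod n V \<Longrightarrow> pm.subspace V"
  unfolding smod_def pm.subspace_def
  by (metis mmult_single_0 single_in_Sring valid_expo_def Poly_Mapping.keys_zero empty_subsetI)

lemma smod_mmult: "smod n V \<Longrightarrow> p \<in> Sring n \<Longrightarrow> a \<in> V \<Longrightarrow> mmult p a \<in> V"
  by (simp add: smod_def)

lemma smod_add: "smod n V \<Longrightarrow> a \<in> V \<Longrightarrow> b \<in> V \<Longrightarrow> a + b \<in> V"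
  by (simp add: smod_def)

lemma smod_sub_gen: "smod n (sub_gen n G)"
  unfolding smod_def by (auto intro: sub_gen.intros)

lemma sub_gen_minimal:
  assumes "smod n V" "G \<subseteq> V" shows "sub_gen n G \<subseteq> V"
proof
  fix v assume "v \<in> sub_gen n G"
  then show "v \<in> V" by induction (use assms in \<open>auto simp: smod_def\<close>)
qed

lemma sub_gen_mono: "G \<subseteq> H \<Longrightarrow> sub_gen n G \<subseteq> sub_gen n H"
  by (rule sub_gen_minimal[OF smod_sub_gen]) (auto intro: sub_gen.intros)

lemma smod_Fmod: "smod n (Fmod n m)"
proof -
  have "mmult p v \<in> Fmod n m" if "p \<in> Sring n" "v \<in> Fmod n m" for p v
    using that keys_mmult[of _ p v]
    by (fastforce simp: Fmod_def Sring_def valid_term_def valid_expo_def keys_add_expo)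
  moreover have "pm.subspace (Fmod n m)" unfolding Fmod_eq by (rule subspace_supp_in)
  ultimately show ?thesis unfolding smod_def pm.subspace_def by blast
qed

lemma smod_sum_image:
  fixes V :: "'k::field mvec set"
  assumes "smod n V" shows "smod n {v + mmult p f | v p. v \<in> V \<and> p \<in> Sring n}"
  unfolding smod_def
proof (intro conjI ballI)
  have "0 = 0 + mmult 0 f" "0 \<in> V" using assms by (simp_all add: smod_def)
  then show "0 \<in> {v + mmult p f | v p. v \<in> V \<and> p \<in> Sring n}" using Sring_zero by blast
next
  fix a b assume "a \<in> {v + mmult p f | v p. v \<in> V \<and> p \<in> Sring n}"
    and "b \<in> {v + mmult p f | v p. v \<in> V \<and> p \<in> Sring n}"
  then obtain v p w q where "a = v + mmult p f" "v \<in> V" "p \<in> Sring n"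
    "b = w + mmult q f" "w \<in> V" "q \<in> Sring n" by blast
  moreover from this have "a + b = (v + w) + mmult (p + q) f" by (simp add: mmult_add_left)
  moreover from calculation have "v + w \<in> V" "p + q \<in> Sring n"
    using assms Sring_add smod_add by blast+
  ultimately show "a + b \<in> {v + mmult p f | v p. v \<in> V \<and> p \<in> Sring n}" by blast
next
  fix q :: "'k poly" and a assume q: "q \<in> Sring n" and "a \<in> {v + mmult p f | v p. v \<in> V \<and> p \<in> Sring n}"
  then obtain v p where vp: "a = v + mmult p f" "v \<in> V" "p \<in> Sring n" by blast
  then have "mmult q a = mmult q v + mmult (q * p) f" by (simp add: mmult_add_right mmult_mult)
  moreover have "mmult q v \<in> V" "q * p \<in> Sring n" using assms q vp smod_mmult Sring_mult by blast+
  ultimately show "mmult q a \<in> {v + mmult p f | v p. v \<in> V \<and> p \<in> Sring n}" by blast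
qed

lemma sub_gen_insert:
  "sub_gen n (insert f G) = {v + mmult p f | v p. v \<in> sub_gen n G \<and> p \<in> Sring n}" (is "_ = ?R")
proof
  have "v = v + mmult 0 f" for v by simp
  then have "sub_gen n G \<subseteq> ?R" using Sring_zero by blast
  then have "G \<subseteq> ?R" by (auto intro: sub_gen.intros)
  moreover have "f \<in> ?R"
  proof -
    have "f = 0 + mmult 1 f" by simp
    then show ?thesis using sub_gen.sg_zero Sring_one by blast
  qed
  ultimately show "sub_gen n (insert f G) \<subseteq> ?R"
    by (intro sub_gen_minimal smod_sum_image smod_sub_gen) auto
next
  show "?R \<subseteq> sub_gen n (insert f G)"
    using sub_gen_mono[of G "insert f G" n] by (auto intro!: sub_gen.sg_add sub_gen.sg_mult intro: sub_gen.sg_gen)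
qed

text \<open>The vectors whose components all lie in the submodule form a submodule containing the
  generators. Closure under \<open>p\<close> is checked one monomial of \<open>p\<close> at a time,
  since a monomial acts on components by a mere shift of degree.\<close>

lemma graded_sub_gen:
  fixes G :: "'k::field mvec set"
  assumes "\<And>f. f \<in> G \<Longrightarrow> \<exists>e. hom_of_deg (mtdeg degE) e f"
  shows "graded (mtdeg degE) (sub_gen n G)"
proof -
  let ?V = "{v. \<forall>z. hpart (mtdeg degE) z v \<in> sub_gen n G}"
  have "smod n ?V"
    unfolding smod_def
  proof (intro conjI ballI)
    fix p :: "'k poly" and a assume p: "p \<in> Sring n" and a: "a \<in> ?V"
    have "hpart (mtdeg degE) z (mmult p a) \<in> sub_gen n G" for z
    proof -
      have "hpart (mtdeg degE) z (mmult (Poly_Mapping.single b c) a) \<in> sub_gen n G"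
        if "b \<in> Poly_Mapping.keys p" for b and c :: 'k
      proof -
        have "hom_of_deg tdeg (tdeg b) (Poly_Mapping.single b c)" by (simp add: hom_of_deg_def)
        then have "hom_of_deg (mtdeg degE) (y + tdeg b) (mmult (Poly_Mapping.single b c) w)"
          if "hom_of_deg (mtdeg degE) y w" for y w
          unfolding add.commute[of y] by (rule hom_of_deg_mmult[OF _ that])
        then have "hpart (mtdeg degE) z (mmult (Poly_Mapping.single b c) a) =
          (if tdeg b \<le> z then mmult (Poly_Mapping.single b c) (hpart (mtdeg degE) (z - tdeg b) a) else 0)"
          by (rule hpart_linear[OF linear_mmult_right])
        then show ?thesis using a p that
          by (auto simp: Sring_def intro!: sub_gen.sg_zero sub_gen.sg_mult single_in_Sring)
      qed
      then have "(\<Sum>b\<in>Poly_Mapping.keys p. hpart (mtdeg degE) z (mmult (Poly_Mapping.single b (Poly_Mapping.lookup p b)) a)) \<in> sub_gen n G"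
        by (intro pm.subspace_sum smod_subspace[OF smod_sub_gen])
      also have "(\<Sum>b\<in>Poly_Mapping.keys p. hpart (mtdeg degE) z (mmult (Poly_Mapping.single b (Poly_Mapping.lookup p b)) a))
          = hpart (mtdeg degE) z (mmult p a)"
        using keys_sum_singles[of "Poly_Mapping.keys p" p]
        by (simp add: hpart_sum[symmetric] mmult_sum_left[symmetric])
      finally show ?thesis .
    qed
    then show "mmult p a \<in> ?V" by simp
  qed (auto simp: hpart_add intro: sub_gen.intros)
  moreover have "G \<subseteq> ?V"
  proof
    fix f assume f: "f \<in> G"
    then obtain e where "hom_of_deg (mtdeg degE) e f" using assms by blast
    then show "f \<in> ?V" using f by (auto simp: hpart_hom_of_deg intro: sub_gen.intros)
  qed
  ultimately have "sub_gen n G \<subseteq> ?V" by (rule sub_gen_minimal)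
  then show ?thesis unfolding graded_def by blast
qed

lemma graded_supp_in: "graded dg (supp_in X)"
  by (auto simp: graded_def supp_in_def keys_hpart)

lemma finite_valid_terms: "finite {t. valid_term n m t \<and> mtdeg degE t = z}"
proof (rule finite_subset)
  show "{t. valid_term n m t \<and> mtdeg degE t = z} \<subseteq> {a \<in> expos {..<n}. tdeg a \<le> z} \<times> {..<m}"
    by (auto simp: valid_term_def valid_expo_def mtdeg_def expos_def)
  show "finite ({a \<in> expos {..<n}. tdeg a \<le> z} \<times> {..<m})"
    by (intro finite_cartesian_product finite_expos_tdeg_le) auto
qed

lemma finite_valid_terms': "finite {t \<in> {t. valid_term n m t}. mtdeg degE t = z}"
  using finite_valid_terms[of n m degE z] by simp

lemma finite_expos_tdeg: "finite {a \<in> expos {..<n}. tdeg a = z}"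
  by (rule finite_subset[OF _ finite_expos_tdeg_le[of "{..<n}" z]]) auto

subsection \<open>Initial submodules\<close>

lemma monomial_order_strict_total:
  assumes "monomial_order n m ord"
  shows "strict_total_on {t. valid_term n m t} ord"
proof -
  have "\<forall>s t u. valid_term n m s \<longrightarrow> valid_term n m t \<longrightarrow> valid_term n m u \<longrightarrow>
      ord s t \<longrightarrow> ord t u \<longrightarrow> ord s u"
    using assms unfolding monomial_order_def by (elim conjE) assumption
  moreover have "\<forall>s t. valid_term n m s \<longrightarrow> valid_term n m t \<longrightarrow> s = t \<or> ord s t \<or> ord t s"
    using assms unfolding monomial_order_def by (elim conjE) assumption
  moreover have "\<forall>s. valid_term n m s \<longrightarrow> \<not> ord s s"
    using assms unfolding monomial_order_def by (elim conjE) assumption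
  ultimately show ?thesis unfolding strict_total_on_def by blast
qed

lemma monomial_order_add:
  assumes "monomial_order n m ord" "valid_term n m (a, j)" "valid_term n m (b, k)" "valid_expo n c"
    and "ord (a, j) (b, k)"
  shows "ord (a + c, j) (b + c, k)"
proof -
  have "\<forall>a j b k c. valid_term n m (a, j) \<longrightarrow> valid_term n m (b, k) \<longrightarrow> valid_expo n c \<longrightarrow>
      ord (a, j) (b, k) \<longrightarrow> ord (a + c, j) (b + c, k)"
    using assms(1) unfolding monomial_order_def by (elim conjE) assumption
  then show ?thesis using assms by blast
qed

lemma leads_valid: "V \<subseteq> Fmod n m \<Longrightarrow> t \<in> leads ord V \<Longrightarrow> valid_term n m t"
  by (auto simp: leads_def Fmod_def)

lemma leads_shift:
  assumes mo: "monomial_order n m ord" and V: "smod n V" "V \<subseteq> Fmod n m"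
    and a: "(a, j) \<in> leads ord V" and b: "valid_expo n b"
  shows "(b + a, j) \<in> leads ord V"
proof -
  obtain v where v: "v \<in> V" "(a, j) \<in> Poly_Mapping.keys v"
    "\<And>s. s \<in> Poly_Mapping.keys v \<Longrightarrow> s \<noteq> (a, j) \<Longrightarrow> ord s (a, j)"
    using a by (auto simp: leads_def)
  let ?w = "mmult (Poly_Mapping.single b 1) v"
  have keys: "Poly_Mapping.keys ?w = (\<lambda>s. (b + fst s, snd s)) ` Poly_Mapping.keys v"
    by (rule keys_mmult_single) simp
  have "?w \<in> V" using V(1) v(1) b by (intro smod_mmult single_in_Sring)
  moreover have "(b + a, j) \<in> Poly_Mapping.keys ?w" using v(2) unfolding keys by force
  moreover have "ord s (b + a, j)" if s: "s \<in> Poly_Mapping.keys ?w" "s \<noteq> (b + a, j)" for s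
  proof -
    obtain c k where ck: "(c, k) \<in> Poly_Mapping.keys v" "s = (b + c, k)"
      using s(1) unfolding keys by force
    have "ord (c, k) (a, j)" using v(3)[OF ck(1)] ck(2) s(2) by auto
    moreover have "valid_term n m (c, k)" "valid_term n m (a, j)"
      using ck(1) v(1,2) V(2) by (auto simp: Fmod_def)
    ultimately have "ord (c + b, k) (a + b, j)"
      using monomial_order_add[OF mo _ _ b] by blast
    then show ?thesis using ck(2) by (simp add: add.commute)
  qed
  ultimately show ?thesis unfolding leads_def by blast
qed

lemma lead_term_greatest:
  assumes mo: "monomial_order n m ord" and v: "v \<in> Fmod n m" "v \<noteq> 0"
  shows "lead_term ord v \<in> Poly_Mapping.keys v"
    and "\<And>s. s \<in> Poly_Mapping.keys v \<Longrightarrow> s \<noteq> lead_term ord v \<Longrightarrow> ord s (lead_term ord v)"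
proof -
  have sub: "Poly_Mapping.keys v \<subseteq> {t. valid_term n m t}" using v(1) by (auto simp: Fmod_def)
  have st: "strict_total_on (Poly_Mapping.keys v) ord"
    by (rule strict_total_on_subset[OF monomial_order_strict_total[OF mo] sub])
  let ?P = "\<lambda>t. t \<in> Poly_Mapping.keys v \<and> (\<forall>s\<in>Poly_Mapping.keys v. s \<noteq> t \<longrightarrow> ord s t)"
  have "Poly_Mapping.keys v \<noteq> {}" using v(2) by simp
  then obtain t where t: "?P t" using strict_total_on_max[OF _ _ st] by auto
  have "s = t" if "?P s" for s
  proof (rule ccontr)
    assume "s \<noteq> t"
    then have "ord s t" "ord t s" using t that by auto
    then show False using st t that unfolding strict_total_on_def by blast
  qed
  with t have "?P (lead_term ord v)" unfolding lead_term_def by (rule theI)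
  then show "lead_term ord v \<in> Poly_Mapping.keys v"
    and "\<And>s. s \<in> Poly_Mapping.keys v \<Longrightarrow> s \<noteq> lead_term ord v \<Longrightarrow> ord s (lead_term ord v)" by auto
qed

lemma leads_eq_lead_term:
  assumes mo: "monomial_order n m ord" and V: "V \<subseteq> Fmod n m"
  shows "leads ord V = {lead_term ord v | v. v \<in> V \<and> v \<noteq> 0}"
proof (intro equalityI subsetI)
  fix t assume "t \<in> leads ord V"
  then obtain v where v: "v \<in> V" "t \<in> Poly_Mapping.keys v"
    "\<And>s. s \<in> Poly_Mapping.keys v \<Longrightarrow> s \<noteq> t \<Longrightarrow> ord s t" by (auto simp: leads_def)
  have v0: "v \<noteq> 0" using v(2) by auto
  have "v \<in> Fmod n m" using v(1) V by blast
  note lt = lead_term_greatest[OF mo this v0]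
  have "t = lead_term ord v"
  proof (rule ccontr)
    assume "t \<noteq> lead_term ord v"
    then have "ord t (lead_term ord v)" "ord (lead_term ord v) t" using lt v by auto
    moreover have "valid_term n m t" "valid_term n m (lead_term ord v)"
      using v V lt(1) by (auto simp: Fmod_def)
    ultimately show False using monomial_order_strict_total[OF mo] unfolding strict_total_on_def by blast
  qed
  then show "t \<in> {lead_term ord v | v. v \<in> V \<and> v \<noteq> 0}" using v(1) v0 by blast
next
  fix t assume "t \<in> {lead_term ord v | v. v \<in> V \<and> v \<noteq> 0}"
  then obtain v where v: "t = lead_term ord v" "v \<in> V" "v \<noteq> 0" by blast
  then show "t \<in> leads ord V"
    using lead_term_greatest[OF mo _ v(3)] V unfolding leads_def by blast
qed

text \<open>The leading terms of a submodule are closed under multiplication by monomials, so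
  generating a submodule from them adds no new monomial.\<close>

lemma single_in_init_sub_iff:
  assumes mo: "monomial_order n m ord" and M: "smod n M" "M \<subseteq> Fmod n m"
  shows "Poly_Mapping.single t 1 \<in> init_sub n ord M \<longleftrightarrow> t \<in> leads ord (M :: 'k::field mvec set)"
proof
  let ?V = "supp_in (leads ord M) :: 'k mvec set"
  have "smod n ?V"
    unfolding smod_def
  proof (intro conjI ballI)
    fix p :: "'k poly" and a assume p: "p \<in> Sring n" and a: "a \<in> ?V"
    have "t \<in> leads ord M" if t: "t \<in> Poly_Mapping.keys (mmult p a)" for t
    proof -
      obtain b s where bs: "b \<in> Poly_Mapping.keys p" "s \<in> Poly_Mapping.keys a" "t = (b + fst s, snd s)"
        using keys_mmult[OF t] by blast
      have "(fst s, snd s) \<in> leads ord M" "valid_expo n b"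
        using bs a p by (auto simp: supp_in_def Sring_def)
      then show ?thesis using leads_shift[OF mo M] bs(3) by blast
    qed
    then show "mmult p a \<in> ?V" by (auto simp: supp_in_def)
  qed (use subspace_supp_in[of "leads ord M"] in \<open>auto simp: pm.subspace_def\<close>)
  then have sub: "init_sub n ord M \<subseteq> ?V"
    unfolding init_sub_def
    by (rule sub_gen_minimal) (auto simp: supp_in_def leads_eq_lead_term[OF mo M(2)])
  show "t \<in> leads ord M" if "Poly_Mapping.single t 1 \<in> init_sub n ord M"
    using that sub by (auto simp: supp_in_def)
  show "Poly_Mapping.single t 1 \<in> init_sub n ord M" if "t \<in> leads ord M"
    using that unfolding init_sub_def leads_eq_lead_term[OF mo M(2)] by (auto intro: sub_gen.sg_gen)
qed

lemma kspan_singles: "kspan ((\<lambda>t. Poly_Mapping.single t (1::'k::field)) ` B) = supp_in B"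
proof (intro equalityI subsetI)
  fix v assume "v \<in> kspan ((\<lambda>t. Poly_Mapping.single t (1::'k)) ` B)"
  then show "v \<in> supp_in B"
  proof induction
    case (ks_smult a c)
    then have "a \<in> supp_in B" by (auto simp: supp_in_def)
    then show ?case by (simp add: mmult_single_0 pm.subspace_scale[OF subspace_supp_in])
  qed (auto simp: pm.subspace_0[OF subspace_supp_in] pm.subspace_add[OF subspace_supp_in])
next
  fix v :: "'k mvec" assume v: "v \<in> supp_in B"
  have "(\<Sum>t\<in>X. Poly_Mapping.single t (Poly_Mapping.lookup v t)) \<in> kspan ((\<lambda>t. Poly_Mapping.single t (1::'k)) ` B)"
    if "finite X" "X \<subseteq> B" for X
    using that
  proof (induction X rule: finite_induct)
    case (insert t X)
    have "Poly_Mapping.single t (Poly_Mapping.lookup v t)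
        = mmult (Poly_Mapping.single 0 (Poly_Mapping.lookup v t)) (Poly_Mapping.single t 1)"
      by (simp add: mmult_single_0)
    also have "\<dots> \<in> kspan ((\<lambda>t. Poly_Mapping.single t (1::'k)) ` B)"
      using insert.prems by (intro kspan.ks_smult) auto
    finally show ?case using insert by (simp add: kspan.ks_add)
  qed (simp add: kspan.ks_zero)
  from this[of "Poly_Mapping.keys v"]
  show "v \<in> kspan ((\<lambda>t. Poly_Mapping.single t (1::'k)) ` B)"
    using v keys_sum_singles[of "Poly_Mapping.keys v" v] by (simp add: supp_in_def)
qed

lemma Nspan_eq:
  "Nspan n m (A :: 'k::field mvec set) = supp_in {t. valid_term n m t \<and> Poly_Mapping.single t (1::'k) \<notin> A}"
  unfolding Nspan_def kspan_singles[symmetric] by (rule arg_cong[of _ _ kspan]) blast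

subsection \<open>Hilbert functions of cone decompositions\<close>

definition cone_types :: "(nat \<Rightarrow> nat) \<Rightarrow> (('k::field) mvec \<times> nat set) set \<Rightarrow> (nat \<times> nat) multiset" where
  "cone_types degE P = image_mset (\<lambda>C. (cdeg degE C, cdim C)) (mset_set P)"

lemma in_cone_types: "finite P \<Longrightarrow> x \<in># cone_types degE P \<longleftrightarrow> (\<exists>C\<in>P. x = (cdeg degE C, cdim C))"
  by (auto simp: cone_types_def)

lemma hf_cone_types: "finite P \<Longrightarrow> hf (cone_types degE P) z = (\<Sum>C\<in>P. cone_hf (cdim C) (z - int (cdeg degE C)))"
  by (simp add: cone_types_def hf_def sum_unfold_sum_mset image_mset.compositionality comp_def)

lemma standard_cone_types: "finite P \<Longrightarrow> q_standard degE q P \<Longrightarrow> standard q (cone_types degE P)"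
  unfolding q_standard_def by (intro standardI) (fastforce simp: in_cone_types)+

lemma exact_cone_types:
  assumes "finite P" "q_exact degE q P" shows "exact q (cone_types degE P)"
  unfolding exact_def
proof (intro conjI allI impI)
  show "standard q (cone_types degE P)" using assms by (simp add: q_exact_def standard_cone_types)
  fix e k e' k'
  assume a: "(e, k) \<in># cone_types degE P" "(e', k') \<in># cone_types degE P - {#(e, k)#}" "0 < k" "0 < k'"
  obtain C where C: "C \<in> P" "(e, k) = (cdeg degE C, cdim C)" using a(1) assms(1) by (auto simp: in_cone_types)
  have "cone_types degE P = add_mset (e, k) (cone_types degE (P - {C}))"
    using C assms(1) by (simp add: cone_types_def mset_set.remove)
  then have "(e', k') \<in># cone_types degE (P - {C})" using a(2) by simp
  then obtain C' where "C' \<in> P" "C' \<noteq> C" "(e', k') = (cdeg degE C', cdim C')"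
    using assms(1) by (auto simp: in_cone_types)
  then show "e \<noteq> e'" using assms(2) C a unfolding q_exact_def by (metis Pair_inject)
qed

lemma dim_image_inj:
  fixes \<phi> :: "('a \<Rightarrow>\<^sub>0 'k::field) \<Rightarrow> ('b \<Rightarrow>\<^sub>0 'k)"
  assumes "pm.subspace A" "A \<subseteq> supp_in X" "finite X"
    and \<phi>: "Vector_Spaces.linear smul smul \<phi>"
    and "\<And>a. a \<in> A \<Longrightarrow> \<phi> a = 0 \<Longrightarrow> a = 0"
  shows "pm.dim (\<phi> ` A) = pm.dim A"
proof -
  interpret l: Vector_Spaces.linear smul smul \<phi> by (rule \<phi>)
  have "{v + \<phi> a | v a. v \<in> {0} \<and> a \<in> A} = \<phi> ` A" by auto
  moreover have "{a \<in> A. \<phi> a \<in> {0}} = {0}" using assms(5) pm.subspace_0[OF assms(1)] l.zero by auto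
  moreover have "pm.dim {v + \<phi> a | v a. v \<in> {0} \<and> a \<in> A} + pm.dim {a \<in> A. \<phi> a \<in> {0}}
      = pm.dim {0 :: 'b \<Rightarrow>\<^sub>0 'k} + pm.dim A"
    by (rule dim_sum_image[OF assms(1-3) pm.subspace_single_0 _ finite.emptyI \<phi>]) (simp add: supp_in_def)
  moreover have "pm.dim {0 :: 'a \<Rightarrow>\<^sub>0 'k} = 0" "pm.dim {0 :: 'b \<Rightarrow>\<^sub>0 'k} = 0"
    using pm.basis_card_eq_dim[of "{}" "{0 :: 'a \<Rightarrow>\<^sub>0 'k}"] pm.basis_card_eq_dim[of "{}" "{0 :: 'b \<Rightarrow>\<^sub>0 'k}"]
    by (simp_all add: pm.independent_empty)
  ultimately show ?thesis by simp
qed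

text \<open>The unique-representation clause makes the linear map sending the basis vector \<open>(C, a)\<close> to
  \<open>x\<^sup>a h\<^sub>C\<close> an isomorphism onto the degree \<open>z\<close> part of the decomposed space.\<close>

lemma card_eq_hf_cone_types:
  fixes P :: "('k::field mvec \<times> nat set) set"
  assumes dec: "cone_decomp n m degE (supp_in B) P" and B: "\<And>t. t \<in> B \<Longrightarrow> valid_term n m t"
  shows "int (card {t \<in> B. mtdeg degE t = z}) = hf (cone_types degE P) (int z)"
proof -
  have finP: "finite P" using dec by (simp add: cone_decomp_def)
  have C: "fst C \<noteq> 0" "hom_of_deg (mtdeg degE) (cdeg degE C) (fst C)" "snd C \<subseteq> {..<n}" "cone C \<subseteq> supp_in B"
    if "C \<in> P" for C
    using dec that by (auto simp: cone_decomp_def hom_vec_def hom_of_deg_def cdeg_def)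
  have ex: "\<exists>!c. (\<forall>C\<in>P. c C \<in> cone C) \<and> (\<forall>C. C \<notin> P \<longrightarrow> c C = 0) \<and> v = (\<Sum>C\<in>P. c C)"
    if "v \<in> supp_in B" for v
    using dec that by (simp add: cone_decomp_def)
  define E where "E C = {a \<in> expos (snd C). tdeg a + cdeg degE C = z}" for C :: "'k mvec \<times> nat set"
  have finE: "finite (E C)" if "C \<in> P" for C
    by (rule finite_subset[OF _ finite_expos_tdeg_le[of "{..<n}" z]]) (use C(3)[OF that] in \<open>auto simp: E_def expos_def\<close>)
  define X where "X = Sigma P E"
  have finX: "finite X" using finP finE by (simp add: X_def)
  define pol where "pol w C = (\<Sum>a\<in>E C. Poly_Mapping.single a (Poly_Mapping.lookup w (C, a)))"
    for w :: "(('k mvec \<times> nat set) \<times> expo) \<Rightarrow>\<^sub>0 'k" and C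
  define \<phi> where "\<phi> w = (\<Sum>C\<in>P. mmult (pol w C) (fst C))" for w
  have pol_add: "pol (v + w) C = pol v C + pol w C" for v w C
    by (simp add: pol_def lookup_add single_add sum.distrib)
  have pol_smul: "pol (smul c w) C = smul c (pol w C)" for c w C
    by (simp add: pol_def pm.scale_sum_right)
  have lin: "Vector_Spaces.linear smul smul \<phi>"
    by unfold_locales (simp_all add: \<phi>_def pol_add pol_smul mmult_add_left mmult_smul_left sum.distrib pm.scale_sum_right)
  have lookup_pol: "Poly_Mapping.lookup (pol w C) a = (if a \<in> E C then Poly_Mapping.lookup w (C, a) else 0)"
    if "C \<in> P" for w C a
    using finE[OF that] by (auto simp: pol_def lookup_sum lookup_single when_def)
  have pol_Ksub: "pol w C \<in> Ksub (snd C)" if "C \<in> P" for w C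
  proof -
    have "a \<in> E C" if "a \<in> Poly_Mapping.keys (pol w C)" for a
      using that lookup_pol[OF \<open>C \<in> P\<close>, of w a] by (auto simp: in_keys_iff split: if_splits)
    then show ?thesis by (auto simp: Ksub_def E_def expos_def)
  qed
  have pol_hom: "hom_of_deg (mtdeg degE) z (mmult (pol w C) (fst C))" if "C \<in> P" for w C
  proof (cases "cdeg degE C \<le> z")
    case True
    have "hom_of_deg tdeg (z - cdeg degE C) (pol w C)"
      using lookup_pol[OF that, of w] by (auto simp: hom_of_deg_def in_keys_iff E_def split: if_splits)
    from hom_of_deg_mmult[OF this C(2)[OF that]] show ?thesis using True by simp
  next
    case False
    then have "E C = {}" by (auto simp: E_def)
    then show ?thesis by (simp add: pol_def hom_of_deg_def)
  qed
  have inj: "w = 0" if w: "w \<in> supp_in X" "\<phi> w = 0" for w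
  proof -
    \<comment> \<open>Uniqueness is applied to the vector 0, which has this representation and the
      zero one; the value 0 off \<open>P\<close> is what \<open>cone_decomp\<close> demands.
      Torsion-freeness then kills the coefficients.\<close>
    let ?c = "\<lambda>C. if C \<in> P then mmult (pol w C) (fst C) else 0"
    have c0: "0 \<in> cone C" for C :: "'k mvec \<times> nat set"
      unfolding cone_def by (auto intro!: exI[of _ 0] simp: Ksub_def)
    have "?c C \<in> cone C" if "C \<in> P" for C using pol_Ksub[OF that, of w] that by (auto simp: cone_def)
    moreover have "0 = (\<Sum>C\<in>P. ?c C)" using w(2) by (simp add: \<phi>_def)
    ultimately have P1: "(\<forall>C\<in>P. ?c C \<in> cone C) \<and> (\<forall>C. C \<notin> P \<longrightarrow> ?c C = 0) \<and> 0 = (\<Sum>C\<in>P. ?c C)"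
      by simp
    have P2: "(\<forall>C\<in>P. (0 :: 'k mvec) \<in> cone C) \<and> (\<forall>C. C \<notin> P \<longrightarrow> (0 :: 'k mvec) = 0) \<and> 0 = (\<Sum>C\<in>P. 0 :: 'k mvec)"
      using c0 by simp
    have "?c = (\<lambda>C. 0)"
      by (rule Uniq_D[OF ex[OF pm.subspace_0[OF subspace_supp_in], unfolded ex1_iff_ex_Uniq, THEN conjunct2], OF P1 P2])
    then have "mmult (pol w C) (fst C) = 0" if "C \<in> P" for C using that by (auto dest: fun_cong[of _ _ C])
    then have pol0: "pol w C = 0" if "C \<in> P" for C using mmult_eq_0 C(1) that by blast
    show "w = 0"
    proof (rule poly_mapping_eqI)
      fix x
      show "Poly_Mapping.lookup w x = Poly_Mapping.lookup 0 x"
      proof (cases "x \<in> X")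
        case True
        then obtain C a where x: "x = (C, a)" "C \<in> P" "a \<in> E C" by (auto simp: X_def)
        then show ?thesis using lookup_pol[of C w a] pol0 by simp
      next
        case False
        then show ?thesis using supp_inD[OF w(1)] by simp
      qed
    qed
  qed
  have img: "\<phi> ` supp_in X = gr (mtdeg degE) z (supp_in B)"
  proof (intro equalityI subsetI)
    fix v :: "'k mvec" assume "v \<in> \<phi> ` supp_in X"
    then obtain w where v: "v = \<phi> w" by blast
    have "mmult (pol w C) (fst C) \<in> gr (mtdeg degE) z (supp_in B)" if "C \<in> P" for C
      using C(4)[OF that] pol_Ksub[OF that, of w] pol_hom[OF that, of w] by (auto simp: gr_def cone_def)
    then show "v \<in> gr (mtdeg degE) z (supp_in B)"
      unfolding v \<phi>_def by (intro pm.subspace_sum subspace_gr subspace_supp_in)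
  next
    fix v :: "'k mvec" assume v: "v \<in> gr (mtdeg degE) z (supp_in B)"
    then obtain c where c: "\<And>C. C \<in> P \<Longrightarrow> c C \<in> cone C" "v = (\<Sum>C\<in>P. c C)"
      using ex[of v] by (auto simp: gr_def)
    have "\<forall>C\<in>P. \<exists>p. p \<in> Ksub (snd C) \<and> c C = mmult p (fst C)" using c(1) unfolding cone_def by blast
    then obtain p where p: "\<And>C. C \<in> P \<Longrightarrow> p C \<in> Ksub (snd C)" "\<And>C. C \<in> P \<Longrightarrow> c C = mmult (p C) (fst C)"
      by metis
    \<comment> \<open>\<open>w\<close> keeps only those coefficients of the \<open>p C\<close> that
      land in degree \<open>z\<close>. The sum is still \<open>v\<close>, because \<open>v\<close>
      is homogeneous of that degree.\<close>
    define w where "w = (\<Sum>(C, a)\<in>X. Poly_Mapping.single (C, a) (Poly_Mapping.lookup (p C) a))"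
    have lw: "Poly_Mapping.lookup w x = (if x \<in> X then Poly_Mapping.lookup (p (fst x)) (snd x) else 0)" for x
      using finX by (auto simp: w_def lookup_sum case_prod_unfold lookup_single when_def)
    have "w \<in> supp_in X" by (rule supp_inI) (auto simp: lw split: if_splits)
    moreover have "\<phi> w = v"
    proof -
      have "mmult (pol w C) (fst C) = hpart (mtdeg degE) z (c C)" if CP: "C \<in> P" for C
      proof -
        have "hpart (mtdeg degE) z (mmult (p C) (fst C))
          = (if cdeg degE C \<le> z then mmult (hpart tdeg (z - cdeg degE C) (p C)) (fst C) else 0)"
          by (rule hpart_linear[OF linear_mmult_left]) (rule hom_of_deg_mmult[OF _ C(2)[OF CP]])
        moreover have "pol w C = hpart tdeg (z - cdeg degE C) (p C)" if "cdeg degE C \<le> z"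
        proof (rule poly_mapping_eqI)
          fix a
          have "a \<in> expos (snd C)" if "Poly_Mapping.lookup (p C) a \<noteq> 0"
            using p(1)[OF CP] that by (auto simp: Ksub_def expos_def in_keys_iff)
          then show "Poly_Mapping.lookup (pol w C) a = Poly_Mapping.lookup (hpart tdeg (z - cdeg degE C) (p C)) a"
            using that CP by (auto simp: lookup_pol lw lookup_hpart X_def E_def)
        qed
        moreover have "pol w C = 0" if "\<not> cdeg degE C \<le> z"
        proof -
          have "E C = {}" using that by (auto simp: E_def)
          then show ?thesis by (simp add: pol_def)
        qed
        ultimately show ?thesis using p(2)[OF CP] by auto
      qed
      then have "\<phi> w = hpart (mtdeg degE) z v" by (simp add: \<phi>_def c(2) hpart_sum)
      also have "\<dots> = v" using v by (simp add: gr_def hom_of_deg_iff_hpart)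
      finally show ?thesis .
    qed
    ultimately show "v \<in> \<phi> ` supp_in X" by blast
  qed
  have finB: "finite {t \<in> B. mtdeg degE t = z}"
    by (rule finite_subset[OF _ finite_valid_terms[of n m degE z]]) (use B in auto)
  have "card {t \<in> B. mtdeg degE t = z} = pm.dim (\<phi> ` supp_in X)"
    using hilb_supp_in[OF finB, where 'b = 'k] by (simp add: hilb_def img)
  also have "\<dots> = pm.dim (supp_in X :: (('k mvec \<times> nat set) \<times> expo \<Rightarrow>\<^sub>0 'k) set)"
    by (rule dim_image_inj[OF subspace_supp_in order_refl finX lin inj])
  also have "\<dots> = card X" by (rule dim_supp_in[OF finX])
  finally have "int (card {t \<in> B. mtdeg degE t = z}) = (\<Sum>C\<in>P. int (card (E C)))"
    using finP finE by (simp add: X_def card_SigmaI)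
  also have "\<dots> = (\<Sum>C\<in>P. cone_hf (cdim C) (int z - int (cdeg degE C)))"
  proof (rule sum.cong[OF refl])
    fix C assume CP: "C \<in> P"
    have "E C = {a \<in> expos (snd C). int (tdeg a) = int z - int (cdeg degE C)}" by (auto simp: E_def)
    then have "int (card (E C)) = mon_hf (expos (snd C)) (int z - int (cdeg degE C))" by (simp add: mon_hf_def)
    then show "int (card (E C)) = cone_hf (cdim C) (int z - int (cdeg degE C))"
      using mon_hf_expos[OF finite_subset[OF C(3)[OF CP]]] by (simp add: cdim_def)
  qed
  finally show ?thesis by (simp add: hf_cone_types[OF finP])
qed

subsection \<open>Regular sequences\<close>

lemma ideal_gen_subset_Sring:
  assumes "G \<subseteq> Sring n" shows "ideal_gen n G \<subseteq> Sring n"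
proof
  fix p assume "p \<in> ideal_gen n G"
  then show "p \<in> Sring n" by induction (use assms in \<open>auto intro: Sring_add Sring_mult\<close>)
qed

lemma Fmod_component:
  "v \<in> Fmod n m \<longleftrightarrow> (\<forall>j. component j v \<in> Sring n) \<and> (\<forall>j\<ge>m. component j v = 0)"
proof
  assume v: "v \<in> Fmod n m"
  then have *: "valid_term n m t" if "Poly_Mapping.lookup v t \<noteq> 0" for t
    using that by (auto simp: Fmod_def in_keys_iff)
  have "component j v \<in> Sring n" for j
    using * by (auto simp: Sring_def in_keys_iff valid_term_def)
  moreover have "component j v = 0" if "m \<le> j" for j
  proof (rule poly_mapping_eqI)
    fix a
    show "Poly_Mapping.lookup (component j v) a = Poly_Mapping.lookup 0 a"
      using *[of "(a, j)"] that by (auto simp: valid_term_def)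
  qed
  ultimately show "(\<forall>j. component j v \<in> Sring n) \<and> (\<forall>j\<ge>m. component j v = 0)" by blast
next
  assume a: "(\<forall>j. component j v \<in> Sring n) \<and> (\<forall>j\<ge>m. component j v = 0)"
  have "valid_term n m (b, j)" if "(b, j) \<in> Poly_Mapping.keys v" for b j
  proof -
    have nz: "Poly_Mapping.lookup (component j v) b \<noteq> 0" using that by (simp add: in_keys_iff)
    then have "j < m" using a by (metis not_le lookup_zero)
    moreover have "valid_expo n b" using a nz by (auto simp: Sring_def in_keys_iff simp del: lookup_component)
    ultimately show ?thesis by (simp add: valid_term_def)
  qed
  then show "v \<in> Fmod n m" by (auto simp: Fmod_def)
qed

lemma component_basis_mmult:
  "component i (mmult p (Poly_Mapping.single (0, j) 1)) = (if j = i then p else 0)"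
  by (simp add: component_mmult component_single)

lemma Fmod_basis_sum:
  assumes "v \<in> Fmod n m"
  shows "v = (\<Sum>j<m. mmult (component j v) (Poly_Mapping.single (0, j) 1))"
proof (rule mvec_eqI)
  fix i
  show "component i v = component i (\<Sum>j<m. mmult (component j v) (Poly_Mapping.single (0, j) 1))"
    using assms Fmod_component[of v n m] by (cases "i < m") (simp_all add: component_sum component_basis_mmult)
qed

definition ext_gens :: "nat \<Rightarrow> (nat \<Rightarrow> ('k::field) poly) \<Rightarrow> nat \<Rightarrow> 'k mvec set" where
  "ext_gens m g i = {mmult (g k) (Poly_Mapping.single (0, j) 1) | k j. k < i \<and> j < m}"

text \<open>For an ideal \<open>I\<close>, the submodule \<open>IF\<close> is the direct sum of
  copies of \<open>I\<close>. This carries regularity, a statement about \<open>S\<close>, over to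
  \<open>F\<close>.\<close>

lemma ideal_ext_iff:
  assumes g: "\<And>k. k < i \<Longrightarrow> g k \<in> Sring n"
  shows "v \<in> sub_gen n (ext_gens m g i) \<longleftrightarrow>
    v \<in> Fmod n m \<and> (\<forall>j. component j v \<in> ideal_gen n (g ` {..<i}))"
proof
  have sub: "ideal_gen n (g ` {..<i}) \<subseteq> Sring n" by (rule ideal_gen_subset_Sring) (use g in auto)
  let ?V = "{v \<in> Fmod n m. \<forall>j. component j v \<in> ideal_gen n (g ` {..<i})}"
  have "smod n ?V"
    using smod_Fmod[of n m] unfolding smod_def
    by (auto simp: component_add component_mmult intro: ideal_gen.intros)
  moreover have "ext_gens m g i \<subseteq> ?V"
  proof
    fix v assume "v \<in> ext_gens m g i"
    then obtain k j where kj: "v = mmult (g k) (Poly_Mapping.single (0, j) 1)" "k < i" "j < m"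
      by (auto simp: ext_gens_def)
    then have "component i' v = (if j = i' then g k else 0)" for i' by (simp add: component_basis_mmult)
    then show "v \<in> ?V" using kj g[of k] by (auto simp: Fmod_component intro: ideal_gen.intros)
  qed
  ultimately have "sub_gen n (ext_gens m g i) \<subseteq> ?V" by (rule sub_gen_minimal)
  then show "v \<in> Fmod n m \<and> (\<forall>j. component j v \<in> ideal_gen n (g ` {..<i}))"
    if "v \<in> sub_gen n (ext_gens m g i)" using that by blast
next
  assume v: "v \<in> Fmod n m \<and> (\<forall>j. component j v \<in> ideal_gen n (g ` {..<i}))"
  have "mmult p (Poly_Mapping.single (0, j) 1) \<in> sub_gen n (ext_gens m g i)"
    if "p \<in> ideal_gen n (g ` {..<i})" "j < m" for p j
    using that
  proof induction
    case (ig_gen q)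
    then show ?case by (intro sub_gen.sg_gen) (auto simp: ext_gens_def)
  qed (auto simp: mmult_add_left mmult_mult intro: sub_gen.intros)
  then have "(\<Sum>j<m. mmult (component j v) (Poly_Mapping.single (0, j) 1)) \<in> sub_gen n (ext_gens m g i)"
    using v by (intro pm.subspace_sum smod_subspace[OF smod_sub_gen]) auto
  then show "v \<in> sub_gen n (ext_gens m g i)" using Fmod_basis_sum[of v n m] v by simp
qed

text \<open>The shape \<open>V + \<phi>(A)\<close> required by \<open>hilb_sum_image\<close>, with
  \<open>A = F\<close> and multiplication by \<open>g i\<close>.\<close>

lemma ideal_ext_Suc:
  fixes g :: "nat \<Rightarrow> 'k::field poly"
  assumes g: "\<And>k. k < Suc i \<Longrightarrow> g k \<in> Sring n"
  shows "sub_gen n (ext_gens m g (Suc i)) =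
    {v + mmult (g i) w | v w. v \<in> sub_gen n (ext_gens m g i) \<and> w \<in> Fmod n m}" (is "_ = ?R")
proof
  have g': "\<And>k. k < i \<Longrightarrow> g k \<in> Sring n" using g by simp
  have "smod n ?R"
    unfolding smod_def
  proof (intro conjI ballI)
    have "0 = 0 + mmult (g i) 0" by simp
    moreover have "(0 :: 'k mvec) \<in> Fmod n m" by (simp add: Fmod_def)
    ultimately show "0 \<in> ?R" using sub_gen.sg_zero by blast
  next
    fix a b assume "a \<in> ?R" "b \<in> ?R"
    then obtain v w v' w' where "a = v + mmult (g i) w" "v \<in> sub_gen n (ext_gens m g i)" "w \<in> Fmod n m"
      "b = v' + mmult (g i) w'" "v' \<in> sub_gen n (ext_gens m g i)" "w' \<in> Fmod n m" by blast
    moreover from this have "a + b = (v + v') + mmult (g i) (w + w')" by (simp add: mmult_add_right)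
    moreover have "v + v' \<in> sub_gen n (ext_gens m g i)" "w + w' \<in> Fmod n m"
      using calculation smod_add[OF smod_Fmod] smod_add[OF smod_sub_gen] by auto
    ultimately show "a + b \<in> ?R" by blast
  next
    fix p :: "'k poly" and a assume p: "p \<in> Sring n" and "a \<in> ?R"
    then obtain v w where vw: "a = v + mmult (g i) w" "v \<in> sub_gen n (ext_gens m g i)" "w \<in> Fmod n m"
      by blast
    then have "mmult p a = mmult p v + mmult (g i) (mmult p w)"
      by (simp add: mmult_add_right mmult_commute)
    moreover have "mmult p v \<in> sub_gen n (ext_gens m g i)" "mmult p w \<in> Fmod n m"
      using p vw smod_mmult[OF smod_Fmod] smod_mmult[OF smod_sub_gen] by auto
    ultimately show "mmult p a \<in> ?R" by blast
  qed
  moreover have "ext_gens m g (Suc i) \<subseteq> ?R"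
  proof
    fix v assume "v \<in> ext_gens m g (Suc i)"
    then obtain k j where kj: "v = mmult (g k) (Poly_Mapping.single (0, j) 1)" "k < Suc i" "j < m"
      by (auto simp: ext_gens_def)
    have e: "Poly_Mapping.single (0, j) 1 \<in> Fmod n m" "0 \<in> Fmod n m"
      using kj by (auto simp: Fmod_def valid_term_def valid_expo_def)
    consider "k < i" | "k = i" using kj by linarith
    then show "v \<in> ?R"
    proof cases
      case 1
      then have "v \<in> sub_gen n (ext_gens m g i)" using kj by (intro sub_gen.sg_gen) (auto simp: ext_gens_def)
      moreover have "v = v + mmult (g i) 0" by simp
      ultimately show ?thesis using e by blast
    next
      case 2
      then have "v = 0 + mmult (g i) (Poly_Mapping.single (0, j) 1)" using kj by simp
      then show ?thesis using e sub_gen.sg_zero by blast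
    qed
  qed
  ultimately show "sub_gen n (ext_gens m g (Suc i)) \<subseteq> ?R" by (rule sub_gen_minimal)
next
  show "?R \<subseteq> sub_gen n (ext_gens m g (Suc i))"
  proof
    fix x assume "x \<in> ?R"
    then obtain v w where vw: "x = v + mmult (g i) w" "v \<in> sub_gen n (ext_gens m g i)" "w \<in> Fmod n m"
      by blast
    have "ext_gens m g i \<subseteq> ext_gens m g (Suc i)" unfolding ext_gens_def by force
    then have "v \<in> sub_gen n (ext_gens m g (Suc i))" using sub_gen_mono vw(2) by blast
    moreover have "mmult (g i) w \<in> sub_gen n (ext_gens m g (Suc i))"
    proof (rule ideal_ext_iff[THEN iffD2], rule g, assumption, intro conjI allI)
      show "mmult (g i) w \<in> Fmod n m" using g vw(3) by (intro smod_mmult[OF smod_Fmod]) auto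
      fix j
      have "component j w \<in> Sring n" using vw(3) by (simp add: Fmod_component)
      then have "component j w * g i \<in> ideal_gen n (g ` {..<Suc i})"
        by (intro ideal_gen.ig_mult ideal_gen.ig_gen) auto
      then show "component j (mmult (g i) w) \<in> ideal_gen n (g ` {..<Suc i})"
        by (simp add: component_mmult mult.commute)
    qed
    ultimately show "x \<in> sub_gen n (ext_gens m g (Suc i))" using vw(1) sub_gen.sg_add by blast
  qed
qed

text \<open>Regularity enters here: the kernel of multiplication by \<open>g i\<close> from
  \<open>F\<close> into the quotient is the previous submodule itself.\<close>

lemma ideal_ext_colon:
  assumes reg: "regular_seq n c g" and i: "i < c"
  shows "{w \<in> Fmod n m. mmult (g i) w \<in> sub_gen n (ext_gens m g i)} = sub_gen n (ext_gens m g i)"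
proof -
  have g: "\<And>k. k < i \<Longrightarrow> g k \<in> Sring n" and gi: "g i \<in> Sring n"
    using reg i by (auto simp: regular_seq_def)
  have nzd: "f \<in> ideal_gen n (g ` {..<i})" if "f \<in> Sring n" "g i * f \<in> ideal_gen n (g ` {..<i})" for f
    using reg i that by (auto simp: regular_seq_def)
  note iff = ideal_ext_iff[of i g n _ m, OF g]
  show ?thesis
  proof (intro equalityI subsetI)
    fix w assume w: "w \<in> {w \<in> Fmod n m. mmult (g i) w \<in> sub_gen n (ext_gens m g i)}"
    then have "g i * component j w \<in> ideal_gen n (g ` {..<i})" "component j w \<in> Sring n" for j
      by (auto simp: iff component_mmult Fmod_component)
    then have "component j w \<in> ideal_gen n (g ` {..<i})" for j using nzd by blast
    then show "w \<in> sub_gen n (ext_gens m g i)" using w by (auto simp: iff)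
  next
    fix w assume w: "w \<in> sub_gen n (ext_gens m g i)"
    then have "w \<in> Fmod n m" by (simp add: iff)
    then show "w \<in> {w \<in> Fmod n m. mmult (g i) w \<in> sub_gen n (ext_gens m g i)}"
      using w gi by (simp add: smod_mmult[OF smod_sub_gen])
  qed
qed

section \<open>Hilbert function of a complete intersection\<close>

definition box_hf :: "nat \<Rightarrow> (nat \<Rightarrow> nat) \<Rightarrow> nat \<Rightarrow> int \<Rightarrow> int" where
  "box_hf n d i z = mon_hf {a \<in> expos {..<n}. \<forall>k<i. Poly_Mapping.lookup a k < d k} z"

lemma box_hf_neg: "z < 0 \<Longrightarrow> box_hf n d i z = 0"
proof -
  assume "z < 0"
  then have "{a \<in> N. int (tdeg a) = z} = {}" for N by auto
  then show ?thesis unfolding box_hf_def mon_hf_def by (simp only: card.empty)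
qed

lemma box_hf_0: "box_hf n d 0 z = cone_hf n z"
  using mon_hf_expos[of "{..<n}" z] by (simp add: box_hf_def)

text \<open>The factor \<open>1 - t^{d_i}\<close> of the Hilbert series, written as a
  recursion.\<close>

lemma box_hf_Suc:
  assumes "i < n"
  shows "box_hf n d (Suc i) z = box_hf n d i z - box_hf n d i (z - int (d i))"
proof -
  let ?N = "{a \<in> expos {..<n}. \<forall>k<i. Poly_Mapping.lookup a k < d k}"
  have "{a \<in> ?N. Poly_Mapping.lookup a i < d i} = {a \<in> expos {..<n}. \<forall>k<Suc i. Poly_Mapping.lookup a k < d k}"
    by (auto simp: less_Suc_eq)
  moreover have "{a. a + Poly_Mapping.single i (d i) \<in> ?N} = ?N"
  proof -
    have "a + Poly_Mapping.single i (d i) \<in> expos {..<n} \<longleftrightarrow> a \<in> expos {..<n}" for a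
      using expos_shift[of i "{..<n}" "d i"] assms by blast
    then show ?thesis by (auto simp: lookup_add lookup_single)
  qed
  ultimately show ?thesis
    using mon_hf_split[of "{..<n}" ?N z i "d i"] by (simp add: box_hf_def)
qed

text \<open>\<open>S\<close> itself is polynomial from \<open>1 - n\<close> on, and each subtraction
  of a copy shifted by \<open>d k\<close> delays this by \<open>d k\<close>.\<close>

lemma fdiff_pow_box_hf:
  assumes "i \<le> n" "(\<Sum>k<i. int (d k)) + 1 - int n \<le> z"
  shows "(fdiff ^^ n) (box_hf n d i) z = 0"
  using assms
proof (induction i arbitrary: z)
  case 0
  then show ?case using fdiff_pow_cone_hf_zero[of n n z] by (simp add: box_hf_0[abs_def])
next
  case (Suc i)
  have "(fdiff ^^ n) (box_hf n d (Suc i)) z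
      = (fdiff ^^ n) (\<lambda>z. box_hf n d i z - box_hf n d i (z - int (d i))) z"
  proof -
    have "box_hf n d (Suc i) = (\<lambda>z. box_hf n d i z - box_hf n d i (z - int (d i)))"
      using box_hf_Suc[of i n d] Suc.prems by (intro ext) simp
    then show ?thesis by (rule arg_cong)
  qed
  also have "\<dots> = (fdiff ^^ n) (box_hf n d i) z - (fdiff ^^ n) (box_hf n d i) (z - int (d i))"
    by (simp add: fdiff_pow_diff fdiff_pow_shift)
  also have "\<dots> = 0" using Suc.IH[of z] Suc.IH[of "z - int (d i)"] Suc.prems by simp
  finally show ?case .
qed

lemma card_terms_eq_sum_mon_hf:
  assumes "N \<subseteq> expos {..<n}"
  shows "int (card {t. fst t \<in> N \<and> snd t < m \<and> mtdeg degE t = z})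
    = (\<Sum>j<m. mon_hf N (int z - int (degE j)))"
proof -
  let ?A = "\<lambda>j. {a \<in> N. int (tdeg a) = int z - int (degE j)}"
  have "bij_betw (\<lambda>(j, a). (a, j)) (Sigma {..<m} ?A) {t. fst t \<in> N \<and> snd t < m \<and> mtdeg degE t = z}"
    by (rule bij_betw_byWitness[where f' = "\<lambda>(a, j). (j, a)"]) (auto simp: mtdeg_def)
  then have "card {t. fst t \<in> N \<and> snd t < m \<and> mtdeg degE t = z} = card (Sigma {..<m} ?A)"
    by (simp add: bij_betw_same_card)
  also have "\<dots> = (\<Sum>j<m. card (?A j))"
    by (rule card_SigmaI) (auto intro: finite_mon_hf[OF _ assms])
  finally show ?thesis by (simp add: mon_hf_def)
qed

lemma hilb_Fmod: "int (hilb (mtdeg degE) (Fmod n m :: 'k::field mvec set) z) = (\<Sum>j<m. cone_hf n (int z - int (degE j)))"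
proof -
  have "{t \<in> {t. valid_term n m t}. mtdeg degE t = z} = {t. fst t \<in> expos {..<n} \<and> snd t < m \<and> mtdeg degE t = z}"
    by (auto simp: valid_term_def valid_expo_def expos_def)
  then show ?thesis
    using hilb_supp_in[OF finite_valid_terms'[of n m degE z], where 'b = 'k]
      card_terms_eq_sum_mon_hf[of "expos {..<n}" n m degE z]
    unfolding Fmod_eq by (simp add: mon_hf_expos)
qed

lemma hom_ext_gens:
  assumes "\<And>k. k < i \<Longrightarrow> hom_poly (g k) (d k)" and v: "v \<in> ext_gens m g i"
  shows "\<exists>e. hom_of_deg (mtdeg degE) e v"
proof -
  obtain k j where kj: "v = mmult (g k) (Poly_Mapping.single (0, j) 1)" "k < i"
    using v by (auto simp: ext_gens_def)
  have "hom_of_deg tdeg (d k) (g k)" using assms(1)[OF kj(2)] by (simp add: hom_of_deg_def hom_poly_def)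
  moreover have "hom_of_deg (mtdeg degE) (degE j) (Poly_Mapping.single (0, j) 1)"
    by (simp add: hom_of_deg_def mtdeg_def)
  ultimately show ?thesis unfolding kj(1) using hom_of_deg_mmult by blast
qed

text \<open>Each regular element acts on the Hilbert function of the quotient by the recursion of
  \<open>box_hf_Suc\<close>. The quotient appears as a difference of two dimensions.\<close>

lemma hilb_ideal_ext:
  fixes g :: "nat \<Rightarrow> 'k::field poly"
  assumes reg: "regular_seq n c g" and hom: "\<And>k. k < c \<Longrightarrow> hom_poly (g k) (d k)"
    and "i \<le> c" "c \<le> n"
  shows "int (hilb (mtdeg degE) (sub_gen n (ext_gens m g i)) z)
    = int (hilb (mtdeg degE) (Fmod n m :: 'k mvec set) z) - (\<Sum>j<m. box_hf n d i (int z - int (degE j)))"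
  using \<open>i \<le> c\<close>
proof (induction i arbitrary: z)
  case 0
  have "sub_gen n (ext_gens m g 0) \<subseteq> {0}"
    by (rule sub_gen_minimal) (auto simp: smod_def ext_gens_def)
  then have eq: "sub_gen n (ext_gens m g 0) = {0}" using sub_gen.sg_zero by blast
  have "hilb (mtdeg degE) {0 :: 'k mvec} z = card ({} :: 'k mvec set)"
    unfolding hilb_def
    by (intro pm.basis_card_eq_dim[symmetric]) (auto simp: pm.independent_empty gr_def)
  then show ?case by (simp add: eq hilb_Fmod box_hf_0)
next
  case (Suc i)
  have i: "i < c" "i < n" using Suc.prems \<open>c \<le> n\<close> by auto
  have g: "\<And>k. k < Suc i \<Longrightarrow> g k \<in> Sring n" using reg Suc.prems by (auto simp: regular_seq_def)
  let ?V = "sub_gen n (ext_gens m g i)"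
  have hom_gi: "hom_of_deg tdeg (d i) (g i)" using hom[OF i(1)] by (simp add: hom_of_deg_def hom_poly_def)
  have homs: "hom_of_deg (mtdeg degE) (y + d i) (mmult (g i) a)" if "hom_of_deg (mtdeg degE) y a" for y a
    unfolding add.commute[of y] by (rule hom_of_deg_mmult[OF hom_gi that])
  have Vsub: "?V \<subseteq> supp_in {t. valid_term n m t}"
    using ideal_ext_iff[of i g n _ m] g unfolding Fmod_eq by auto
  have sum: "int (hilb (mtdeg degE) {v + mmult (g i) a | v a. v \<in> ?V \<and> a \<in> Fmod n m} z)
    = int (hilb (mtdeg degE) ?V z) + (if d i \<le> z then int (hilb (mtdeg degE) (Fmod n m :: 'k mvec set) (z - d i))
      - int (hilb (mtdeg degE) {a \<in> Fmod n m. mmult (g i) a \<in> ?V} (z - d i)) else 0)"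
  proof (rule hilb_sum_image[OF smod_subspace[OF smod_Fmod] _ _ finite_valid_terms'
        smod_subspace[OF smod_sub_gen] _ Vsub finite_valid_terms' linear_mmult_right])
    show "graded (mtdeg degE) (Fmod n m)" unfolding Fmod_eq by (rule graded_supp_in)
    show "Fmod n m \<subseteq> supp_in {t. valid_term n m t}" by (simp add: Fmod_eq)
    show "graded (mtdeg degE) ?V" by (rule graded_sub_gen, rule hom_ext_gens[of i g d]) (use hom i in auto)
    show "hpart (mtdeg degE) z (mmult (g i) a) = (if d i \<le> z then mmult (g i) (hpart (mtdeg degE) (z - d i) a) else 0)" for a z
      by (rule hpart_linear[OF linear_mmult_right homs])
  qed
  have step: "int (hilb (mtdeg degE) (sub_gen n (ext_gens m g (Suc i))) z)
    = int (hilb (mtdeg degE) ?V z) + (if d i \<le> z then int (hilb (mtdeg degE) (Fmod n m :: 'k mvec set) (z - d i))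
      - int (hilb (mtdeg degE) ?V (z - d i)) else 0)"
  proof -
    have "sub_gen n (ext_gens m g (Suc i)) = {v + mmult (g i) w | v w. v \<in> ?V \<and> w \<in> Fmod n m}"
      by (rule ideal_ext_Suc) (rule g)
    with sum show ?thesis unfolding ideal_ext_colon[OF reg i(1)] by (simp only:)
  qed
  have "(\<Sum>j<m. box_hf n d (Suc i) (int z - int (degE j)))
      = (\<Sum>j<m. box_hf n d i (int z - int (degE j))) - (\<Sum>j<m. box_hf n d i (int z - int (d i) - int (degE j)))"
    by (simp add: box_hf_Suc[OF i(2)] sum_subtractf algebra_simps)
  \<comment> \<open>In degrees below \<open>d i\<close> multiplication by \<open>g i\<close>
    contributes nothing; the box side agrees, being 0 at negative arguments.\<close>
  moreover have "(\<Sum>j<m. box_hf n d i (int z - int (d i) - int (degE j))) = 0" if "\<not> d i \<le> z"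
    by (rule sum.neutral) (use that in \<open>auto simp: box_hf_neg\<close>)
  ultimately show ?case using step Suc.IH[of z] Suc.IH[of "z - d i"] Suc.prems
    by (auto simp: of_nat_diff)
qed

subsection \<open>Adding a generator\<close>

text \<open>\<open>p \<mapsto> p f\<close> identifies \<open>(N + Sf)/N\<close> with
  \<open>S/I\<close> shifted by \<open>e\<close>, where \<open>I = N : f\<close>. By Macaulay,
  \<open>S/I\<close> has the Hilbert function of the exponents that do not lead in \<open>I\<close>,
  a down-closed set to which Dube's splitting applies.\<close>

lemma standard_quotient:
  fixes f :: "'k::field mvec"
  assumes mo: "monomial_order n m ord" and N: "smod n N" "N \<subseteq> Fmod n m" "graded (mtdeg degE) N"
    and f: "f \<in> Fmod n m" "hom_of_deg (mtdeg degE) e f" and m: "0 < m"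
  shows "\<exists>R. standard e R \<and> (\<forall>z. int (hilb (mtdeg degE) {v + mmult p f | v p. v \<in> N \<and> p \<in> Sring n} z)
    = int (hilb (mtdeg degE) N z) + hf R (int z))"
proof -
  define I where "I = {p \<in> Sring n. mmult p f \<in> N}"
  \<comment> \<open>A monomial order on \<open>S\<close>, borrowed from the multiples of
    \<open>e_1\<close> in \<open>F\<close>; this is what \<open>0 < m\<close> is for.\<close>
  define ord0 where "ord0 a b = ord (a, 0) (b, 0)" for a b
  have hp: "hpart (mtdeg degE) z (mmult p f) = (if e \<le> z then mmult (hpart tdeg (z - e) p) f else 0)" for p z
    by (rule hpart_linear[OF linear_mmult_left]) (rule hom_of_deg_mmult[OF _ f(2)])
  have val: "valid_term n m (a, 0)" if "a \<in> expos {..<n}" for a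
    using that m by (simp add: valid_term_def valid_expo_def expos_def)
  have st: "strict_total_on {t. valid_term n m t} ord" by (rule monomial_order_strict_total[OF mo])
  have st0: "strict_total_on (expos {..<n}) ord0"
    unfolding strict_total_on_def
  proof (intro conjI ballI impI)
    fix a b c assume abc: "a \<in> expos {..<n}" "b \<in> expos {..<n}" "c \<in> expos {..<n}" "ord0 a b" "ord0 b c"
    then show "ord0 a c"
      using st val[OF abc(1)] val[OF abc(2)] val[OF abc(3)]
      unfolding strict_total_on_def ord0_def mem_Collect_eq Ball_def by (elim conjE) blast
  next
    fix a b assume ab: "a \<in> expos {..<n}" "b \<in> expos {..<n}"
    have "(a, 0) = (b, 0::nat) \<or> ord (a, 0) (b, 0) \<or> ord (b, 0) (a, 0)"
      using st val[OF ab(1)] val[OF ab(2)] unfolding strict_total_on_def by blast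
    then show "a = b \<or> ord0 a b \<or> ord0 b a" by (simp add: ord0_def)
  next
    fix a assume "a \<in> expos {..<n}"
    then show "\<not> ord0 a a" using st val unfolding strict_total_on_def ord0_def by simp
  qed
  have Ssub: "pm.subspace (Sring n :: 'k poly set)" unfolding Sring_eq by (rule subspace_supp_in)
  have Sgr: "graded tdeg (Sring n :: 'k poly set)" unfolding Sring_eq by (rule graded_supp_in)
  have Isub: "pm.subspace I"
    using Ssub smod_subspace[OF N(1)] unfolding I_def pm.subspace_def
    by (auto simp: mmult_add_left mmult_smul_left)
  have Igr: "graded tdeg I"
    unfolding graded_def
  proof (intro ballI allI)
    fix p y assume p: "p \<in> I"
    have "hpart (mtdeg degE) (y + e) (mmult p f) \<in> N" using p N(3) by (simp add: I_def graded_def)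
    then show "hpart tdeg y p \<in> I" using p Sgr hp[of "y + e" p] by (simp add: I_def graded_def)
  qed
  have Isupp: "I \<subseteq> supp_in (expos {..<n})" by (auto simp: I_def Sring_eq)
  let ?N = "expos {..<n} - leads ord0 I"
  have leadsI: "leads ord0 I \<subseteq> expos {..<n}" using Isupp unfolding leads_def supp_in_def by blast
  have "down_closed ?N"
    unfolding down_closed_def
  proof (intro allI impI)
    fix a b assume ab: "a + b \<in> ?N"
    then have v: "a \<in> expos {..<n}" "b \<in> expos {..<n}" by (auto simp: expos_def keys_add_expo)
    have "a + b \<in> leads ord0 I" if a: "a \<in> leads ord0 I"
    proof -
      obtain p where p: "p \<in> I" "a \<in> Poly_Mapping.keys p"
        "\<And>s. s \<in> Poly_Mapping.keys p \<Longrightarrow> s \<noteq> a \<Longrightarrow> ord0 s a" using a by (auto simp: leads_def)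
      let ?q = "Poly_Mapping.single b (1::'k) * p"
      have b: "valid_expo n b" using v(2) by (simp add: expos_def valid_expo_def)
      have keys: "Poly_Mapping.keys ?q = (+) b ` Poly_Mapping.keys p" by (rule keys_single_mult) simp
      have "?q \<in> I" using p(1) b smod_mmult[OF N(1)] single_in_Sring[OF b]
        by (auto simp: I_def mmult_mult intro: Sring_mult)
      moreover have "a + b \<in> Poly_Mapping.keys ?q" using p(2) unfolding keys by (auto simp: add.commute)
      moreover have "ord0 s (a + b)" if s: "s \<in> Poly_Mapping.keys ?q" "s \<noteq> a + b" for s
      proof -
        obtain c where c: "c \<in> Poly_Mapping.keys p" "s = c + b" using s(1) unfolding keys by (auto simp: add.commute)
        then have "ord0 c a" using p(3) s(2) by auto
        moreover have "c \<in> expos {..<n}" using c p(1) Isupp by (auto simp: supp_in_def)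
        ultimately show ?thesis
          unfolding c(2) ord0_def using monomial_order_add[OF mo val val b, of c a] v(1) by simp
      qed
      ultimately show ?thesis unfolding leads_def by blast
    qed
    then show "a \<in> ?N" using ab v by blast
  qed
  then obtain R where R: "standard 0 R" "\<And>z. mon_hf ?N z = hf R z"
    using standard_decomposition_exists[of "{..<n}" ?N] by auto
  have quot: "int (hilb tdeg (Sring n :: 'k poly set) y) - int (hilb tdeg I y) = mon_hf ?N (int y)" for y
  proof -
    have fin: "finite {a \<in> expos {..<n}. tdeg a = y}" by (rule finite_expos_tdeg)
    have S: "hilb tdeg (Sring n :: 'k poly set) y = card {a \<in> expos {..<n}. tdeg a = y}"
      unfolding Sring_eq by (rule hilb_supp_in[OF fin])
    have I: "hilb tdeg I y = card {a \<in> leads ord0 I. tdeg a = y}"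
      by (rule hilb_eq_card_leads[OF Isub Igr Isupp fin st0])
    have un: "{a \<in> expos {..<n}. tdeg a = y} = {a \<in> leads ord0 I. tdeg a = y} \<union> {a \<in> ?N. tdeg a = y}"
      using leadsI by blast
    have "card {a \<in> expos {..<n}. tdeg a = y} = card {a \<in> leads ord0 I. tdeg a = y} + card {a \<in> ?N. tdeg a = y}"
    proof -
      have "{a \<in> leads ord0 I. tdeg a = y} \<inter> {a \<in> ?N. tdeg a = y} = {}" by blast
      moreover have "finite {a \<in> leads ord0 I. tdeg a = y}" "finite {a \<in> ?N. tdeg a = y}"
        by (rule finite_subset[OF _ fin], use leadsI in blast)+
      ultimately show ?thesis unfolding un by (intro card_Un_disjoint)
    qed
    then show ?thesis using S I by (simp add: mon_hf_def)
  qed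
  show ?thesis
  proof (intro exI[of _ "shift_cones e R"] conjI allI)
    show "standard e (shift_cones e R)" using standard_shift_cones[OF R(1), of e] by simp
    fix z
    have "int (hilb (mtdeg degE) {v + mmult p f | v p. v \<in> N \<and> p \<in> Sring n} z)
      = int (hilb (mtdeg degE) N z) + (if e \<le> z then int (hilb tdeg (Sring n :: 'k poly set) (z - e))
        - int (hilb tdeg {p \<in> Sring n. mmult p f \<in> N} (z - e)) else 0)"
      by (rule hilb_sum_image[OF Ssub Sgr eq_refl[OF Sring_eq] finite_expos_tdeg smod_subspace[OF N(1)] N(3) _ finite_valid_terms'
            linear_mmult_left hp]) (use N(2) in \<open>simp_all add: Fmod_eq\<close>)
    also have "(if e \<le> z then int (hilb tdeg (Sring n :: 'k poly set) (z - e))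
        - int (hilb tdeg {p \<in> Sring n. mmult p f \<in> N} (z - e)) else 0) = mon_hf ?N (int z - int e)"
    proof (cases "e \<le> z")
      case True
      then show ?thesis using quot[of "z - e"] by (simp add: I_def of_nat_diff)
    next
      case False
      then have "{a \<in> ?N. int (tdeg a) = int z - int e} = {}" by auto
      then show ?thesis using False unfolding mon_hf_def by (simp only: card.empty) simp
    qed
    finally show "int (hilb (mtdeg degE) {v + mmult p f | v p. v \<in> N \<and> p \<in> Sring n} z)
      = int (hilb (mtdeg degE) N z) + hf (shift_cones e R) (int z)"
      by (simp add: R(2) hf_shift_cones)
  qed
qed

lemma single_in_sub_gen_var_pow_iff:
  assumes t: "valid_term n m t" and c: "c \<le> n"
  shows "Poly_Mapping.single t (1::'k::field) \<in> sub_gen n {Poly_Mapping.single (var_pow i (d i), j) 1 | i j. i < c \<and> j < m}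
    \<longleftrightarrow> (\<exists>i<c. d i \<le> Poly_Mapping.lookup (fst t) i)" (is "_ \<in> sub_gen n ?G \<longleftrightarrow> _")
proof
  let ?U = "{s :: mterm. \<exists>i<c. d i \<le> Poly_Mapping.lookup (fst s) i}"
  have "smod n (supp_in ?U :: 'k mvec set)"
    unfolding smod_def
  proof (intro conjI ballI)
    fix p :: "'k poly" and a :: "'k mvec" assume a: "a \<in> supp_in ?U"
    have "s \<in> ?U" if s: "s \<in> Poly_Mapping.keys (mmult p a)" for s
    proof -
      obtain b s' where bs: "s' \<in> Poly_Mapping.keys a" "s = (b + fst s', snd s')"
        using keys_mmult[OF s] by blast
      then have "s' \<in> ?U" using a by (auto simp: supp_in_def)
      then show ?thesis using bs(2) by (auto simp: lookup_add intro: trans_le_add2)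
    qed
    then show "mmult p a \<in> supp_in ?U" by (auto simp: supp_in_def)
  qed (auto intro: pm.subspace_0[OF subspace_supp_in] pm.subspace_add[OF subspace_supp_in])
  then have "sub_gen n ?G \<subseteq> supp_in ?U"
    by (rule sub_gen_minimal) (auto simp: supp_in_def var_pow_def)
  then show "\<exists>i<c. d i \<le> Poly_Mapping.lookup (fst t) i" if "Poly_Mapping.single t (1::'k) \<in> sub_gen n ?G"
    using that by (auto simp: supp_in_def)
next
  assume "\<exists>i<c. d i \<le> Poly_Mapping.lookup (fst t) i"
  then obtain i where i: "i < c" "d i \<le> Poly_Mapping.lookup (fst t) i" by blast
  let ?b = "fst t - Poly_Mapping.single i (d i)"
  have eq: "?b + var_pow i (d i) = fst t" unfolding var_pow_def by (rule add_single_minus[OF i(2)])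
  have "Poly_Mapping.keys ?b \<subseteq> Poly_Mapping.keys (fst t)"
    using keys_add_expo[of ?b "var_pow i (d i)"] eq by auto
  then have b: "valid_expo n ?b" using t by (auto simp: valid_term_def valid_expo_def)
  have "mmult (Poly_Mapping.single ?b 1) (Poly_Mapping.single (var_pow i (d i), snd t) (1::'k)) \<in> sub_gen n ?G"
    using i t b by (intro sub_gen.sg_mult sub_gen.sg_gen single_in_Sring) (auto simp: valid_term_def)
  also have "mmult (Poly_Mapping.single ?b 1) (Poly_Mapping.single (var_pow i (d i), snd t) (1::'k)) = Poly_Mapping.single t 1"
    using eq by (intro mvec_eqI) (simp add: component_mmult component_single mult_single)
  finally show "Poly_Mapping.single t (1::'k) \<in> sub_gen n ?G" .
qed

text \<open>Equal finite dimensions force equality in each degree. This excludes an empty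
  \<open>Q\<close>, whose degree would be the maximum of the empty set.\<close>

lemma graded_eq_if_hilb_eq:
  fixes V W :: "('a \<Rightarrow>\<^sub>0 'k::field) set"
  assumes V: "pm.subspace V" and W: "pm.subspace W" "V \<subseteq> W" and eq: "\<And>z. hilb dg V z = hilb dg W z"
    and "graded dg W" "W \<subseteq> supp_in X" "\<And>z. finite {t \<in> X. dg t = z}"
  shows "V = W"
proof (intro equalityI W(2) subsetI)
  fix v assume v: "v \<in> W"
  have "hpart dg z v \<in> V" for z
  proof (rule ccontr)
    assume nin: "hpart dg z v \<notin> V"
    have gr: "hpart dg z v \<in> gr dg z W"
      using v assms(5) by (simp add: gr_def graded_def hom_of_deg_hpart)
    have "V \<subseteq> supp_in X" using W(2) assms(6) by blast
    then obtain A where A: "finite A" "A \<subseteq> gr dg z V" "pm.independent A" "pm.span A = gr dg z V"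
      "card A = pm.dim (gr dg z V)"
      by (rule finite_basis_exists[OF subspace_gr[OF V] gr_supp_in assms(7)])
    obtain B where B: "finite B" "B \<subseteq> gr dg z W" "pm.independent B" "pm.span B = gr dg z W"
      "card B = pm.dim (gr dg z W)"
      by (rule finite_basis_exists[OF subspace_gr[OF W(1)] gr_supp_in[OF assms(6)] assms(7)])
    let ?x = "hpart dg z v"
    have x: "?x \<notin> pm.span A" using A(4) nin by (simp add: gr_def)
    have "?x \<notin> A" using A(2) nin by (auto simp: gr_def)
    have "insert ?x A \<subseteq> gr dg z W" using gr A(2) W(2) by (auto simp: gr_def)
    then have "card (insert ?x A) \<le> card B"
      using pm.independent_span_bound[OF B(1) pm.independent_insertI[OF x A(3)]] B(4) by simp
    then show False using eq[of z] A(1,5) B(5) \<open>?x \<notin> A\<close> by (simp add: hilb_def)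
  qed
  then have "(\<Sum>z\<in>dg ` Poly_Mapping.keys v. hpart dg z v) \<in> V"
    by (intro pm.subspace_sum V)
  then show "v \<in> V" using sum_hpart[of v dg] by simp
qed

text \<open>One generator at a time, each contributing a family that is standard from its own degree
  \<open>e i\<close>. Raising them all to the common threshold \<open>D\<close> needs
  \<open>e i \<le> D\<close> and limits the equality to degrees from \<open>D\<close> on.\<close>

lemma hilb_submodule_generated:
  fixes f :: "nat \<Rightarrow> 'k::field mvec"
  assumes mo: "monomial_order n m ord" and m: "0 < m"
    and G: "G \<subseteq> Fmod n m" "\<And>v. v \<in> G \<Longrightarrow> \<exists>e. hom_of_deg (mtdeg degE) e v"
    and f: "\<And>i. i < s \<Longrightarrow> f i \<in> Fmod n m" "\<And>i. i < s \<Longrightarrow> hom_of_deg (mtdeg degE) (e i) (f i)"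
    and D: "\<And>i. i < s \<Longrightarrow> e i \<le> D"
  shows "\<exists>R. standard D R \<and> (\<forall>z\<ge>D. int (hilb (mtdeg degE) (sub_gen n (G \<union> f ` {..<s})) z)
    = int (hilb (mtdeg degE) (sub_gen n G) z) + hf R (int z))"
  using f D
proof (induction s)
  case 0
  show ?case by (rule exI[of _ "{#}"]) (simp add: standard_empty)
next
  case (Suc s)
  have "\<exists>R. standard D R \<and> (\<forall>z\<ge>D. int (hilb (mtdeg degE) (sub_gen n (G \<union> f ` {..<s})) z)
    = int (hilb (mtdeg degE) (sub_gen n G) z) + hf R (int z))"
    by (rule Suc.IH) (use Suc.prems in auto)
  then obtain R where R: "standard D R" "\<And>z. z \<ge> D \<Longrightarrow> int (hilb (mtdeg degE) (sub_gen n (G \<union> f ` {..<s})) z)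
    = int (hilb (mtdeg degE) (sub_gen n G) z) + hf R (int z)" by blast
  let ?N = "sub_gen n (G \<union> f ` {..<s})"
  have ins: "sub_gen n (G \<union> f ` {..<Suc s}) = {v + mmult p (f s) | v p. v \<in> ?N \<and> p \<in> Sring n}"
    unfolding sub_gen_insert[symmetric] by (simp add: lessThan_Suc)
  have "?N \<subseteq> Fmod n m" by (rule sub_gen_minimal[OF smod_Fmod]) (use G Suc.prems in auto)
  moreover have "graded (mtdeg degE) ?N"
    by (rule graded_sub_gen) (use G Suc.prems(2) less_SucI in blast)
  ultimately obtain W where W: "standard (e s) W"
    "\<And>z. int (hilb (mtdeg degE) (sub_gen n (G \<union> f ` {..<Suc s})) z) = int (hilb (mtdeg degE) ?N z) + hf W (int z)"
    using standard_quotient[OF mo smod_sub_gen _ _ Suc.prems(1)[of s] Suc.prems(2)[of s] m, of "G \<union> f ` {..<s}"]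
    unfolding ins by auto
  obtain W' where W': "standard D W'" "\<And>z. z \<ge> int D \<Longrightarrow> hf W' z = hf W z"
    using standard_raise_to[OF W(1), of D] Suc.prems(3)[of s] by auto
  show ?case
    by (rule exI[of _ "R + W'"]) (use R W W' in \<open>auto intro: standard_union\<close>)
qed

text \<open>Above degree \<open>b\<close> only point cones remain in \<open>P\<close>. If the Hilbert function is a polynomial from
  degree \<open>a\<close> on, so is the number of point cones, which is eventually zero.\<close>

lemma no_point_cones:
  assumes pos: "\<And>e k. (e, k) \<in># P \<Longrightarrow> 0 < k \<Longrightarrow> e < b \<and> k \<le> n"
    and hf: "\<And>z. a \<le> z \<Longrightarrow> hf P z = h z" and poly: "\<And>z. a \<le> z \<Longrightarrow> (fdiff ^^ n) h z = 0"
    and e: "int b \<le> int e" "a \<le> int e"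
  shows "(e, 0) \<notin># P"
proof
  assume in_P: "(e, 0) \<in># P"
  let ?Pos = "filter_mset (\<lambda>x. 0 < snd x) P"
  let ?Pt = "filter_mset (\<lambda>x. \<not> 0 < snd x) P"
  have split: "hf P z = hf ?Pos z + hf ?Pt z" for z
    using multiset_partition[of P "\<lambda>x. 0 < snd x"] hf_union by metis
  have pt: "k = 0" if "(i, k) \<in># ?Pt" for i k using that by simp
  define c where "c = max a (int b)"
  have "(fdiff ^^ n) (hf ?Pt) z = 0" if z: "c \<le> z" for z
  proof -
    have "(fdiff ^^ n) (hf ?Pt) z = (fdiff ^^ n) (\<lambda>y. h y - hf ?Pos y) z"
    proof (rule fdiff_pow_cong[of a])
      show "hf ?Pt y = h y - hf ?Pos y" if "a \<le> y" for y using hf[OF that] split[of y] by linarith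
      show "a \<le> z" using z by (simp add: c_def)
    qed
    also have "\<dots> = (fdiff ^^ n) h z - (fdiff ^^ n) (hf ?Pos) z" by (rule fdiff_pow_diff)
    also have "\<dots> = 0"
      using poly[of z] fdiff_pow_hf[of ?Pos b n z] pos z by (auto simp: c_def)
    finally show ?thesis .
  qed
  moreover obtain u where u: "\<And>i k. (i, k) \<in># P \<Longrightarrow> i \<le> u"
    using finite_nat_set_iff_bounded_le[of "fst ` set_mset P"] by force
  have "hf ?Pt z = 0" if z: "int (Suc u) \<le> z" for z
  proof -
    have "(nat z, 0) \<notin># ?Pt" using u[of "nat z" 0] z by auto
    then show ?thesis using hf_zero_dim[of ?Pt "nat z", OF pt] z by (simp add: not_in_iff)
  qed
  ultimately have "hf ?Pt (int e) = 0"
    using eventually_zero_fdiff[of c n "hf ?Pt" "int (Suc u)" "int e"] e by (auto simp: c_def)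
  moreover have "hf ?Pt (int e) = int (count ?Pt (e, 0))" by (rule hf_zero_dim[OF pt])
  moreover have "0 < count ?Pt (e, 0)" using in_P by simp
  ultimately show False by linarith
qed

theorem theorem6p4:
  fixes n m r s :: nat
    and degE :: "nat \<Rightarrow> nat"
    and ord :: "mterm \<Rightarrow> mterm \<Rightarrow> bool"
    and g :: "nat \<Rightarrow> ('k::field) poly"
    and d :: "nat \<Rightarrow> nat"
    and f :: "nat \<Rightarrow> 'k mvec"
    and Q P :: "('k mvec \<times> nat set) set"
  defines "l \<equiv> Max (degE ` {..<m})"
    and "D \<equiv> Max ((\<lambda>i. vdeg degE (f i)) ` {..<s})"
    and "M \<equiv> sub_gen n ({mmult (g i) (Poly_Mapping.single (0, j) 1) | i j. i < n - r \<and> j < m}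
                        \<union> f ` {..<s})"
    and "JF \<equiv> sub_gen n {Poly_Mapping.single (var_pow i (d i), j) (1::'k) | i j. i < n - r \<and> j < m}"
  assumes "r \<le> n"
    and "monomial_order n m ord"
    and "regular_seq n (n - r) g"
    and "\<forall>i < n - r. hom_poly (g i) (d i)"
    and "s \<ge> 1"
    and "\<forall>i < s. f i \<in> Fmod n m \<and> f i \<noteq> 0 \<and> hom_vec degE (f i) (vdeg degE (f i))"
    and "D \<ge> l"
    and "M \<noteq> Fmod n m"
    and "cone_decomp n m degE (Nspan n m (init_sub n ord M)) Q"
    and "q_standard degE l Q"
    and "cone_decomp n m degE (Nspan n m JF) P"
    and "q_exact degE D P"
  shows "int (1 + decomp_deg degE Q)
           \<le> max (int (macaulay_const degE D P 1)) (int (\<Sum>i<n - r. d i) + int l - int n + 1)"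
proof -
  note mo = assms(6) and reg = assms(7)
  define c where "c = n - r"
  have cn: "c \<le> n" by (simp add: c_def)
  let ?dg = "mtdeg degE"
  let ?G = "ext_gens m g c"
  have M_eq: "M = sub_gen n (?G \<union> f ` {..<s})" unfolding M_def ext_gens_def c_def ..
  have f: "f i \<in> Fmod n m" "hom_of_deg ?dg (vdeg degE (f i)) (f i)" if "i < s" for i
    using assms(10) that by (auto simp: hom_vec_def hom_of_deg_def)
  \<comment> \<open>\<open>s \<ge> 1\<close> provides a nonzero element of \<open>F\<close>, so
    \<open>F\<close> has a generator.\<close>
  have m: "0 < m"
  proof -
    have "f 0 \<in> Fmod n m" "f 0 \<noteq> 0" using assms(9,10) by auto
    moreover from this obtain t where "t \<in> Poly_Mapping.keys (f 0)" by (metis all_not_in_conv keys_eq_empty)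
    ultimately have "valid_term n m t" by (simp add: Fmod_def)
    then show ?thesis by (simp add: valid_term_def)
  qed
  have finQ: "finite Q" and finP: "finite P" using assms(13,15) by (auto simp: cone_decomp_def)
  have g: "g k \<in> Sring n" "hom_poly (g k) (d k)" if "k < c" for k
    using reg assms(8) that by (auto simp: regular_seq_def c_def)
  have Gsub: "?G \<subseteq> Fmod n m"
    using ideal_ext_iff[of c g n _ m] g(1) by (auto intro: sub_gen.sg_gen)
  have Ghom: "\<exists>e. hom_of_deg ?dg e v" if "v \<in> ?G" for v
    using hom_ext_gens[OF g(2) that] .
  have M: "smod n M" "M \<subseteq> Fmod n m" "graded ?dg M"
  proof -
    show "smod n M" unfolding M_eq by (rule smod_sub_gen)
    show "M \<subseteq> Fmod n m" unfolding M_eq by (rule sub_gen_minimal[OF smod_Fmod]) (use Gsub f(1) in auto)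
    show "graded ?dg M" unfolding M_eq by (rule graded_sub_gen) (use Ghom f(2) in blast)
  qed
  \<comment> \<open>The common Hilbert function of \<open>F/(g)F\<close> and \<open>F/JF\<close>, as
    a function on all integers so that differences can be taken.\<close>
  let ?h = "\<lambda>z. \<Sum>j<m. box_hf n d c (z - int (degE j))"
  obtain R where R: "standard D R" "\<And>z. z \<ge> D \<Longrightarrow>
      int (hilb ?dg M z) = int (hilb ?dg (sub_gen n ?G) z) + hf R (int z)"
  proof -
    have "vdeg degE (f i) \<le> D" if "i < s" for i unfolding D_def by (rule Max_ge) (use that in auto)
    then have "\<exists>R. standard D R \<and> (\<forall>z\<ge>D. int (hilb ?dg (sub_gen n (?G \<union> f ` {..<s})) z)
        = int (hilb ?dg (sub_gen n ?G) z) + hf R (int z))"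
      by (intro hilb_submodule_generated[OF mo m Gsub Ghom f])
    then show ?thesis using that unfolding M_eq by (elim exE conjE) simp
  qed
  have hilbG: "int (hilb ?dg (sub_gen n ?G) z) = int (hilb ?dg (Fmod n m :: 'k mvec set) z) - ?h (int z)" for z
    by (rule hilb_ideal_ext[OF reg _ _ cn[unfolded c_def]]) (use assms(8) in \<open>auto simp: c_def\<close>)
  have hfP: "hf (cone_types degE P) (int z) = ?h (int z)" for z
  proof -
    let ?N = "{a \<in> expos {..<n}. \<forall>k<c. Poly_Mapping.lookup a k < d k}"
    let ?B = "{t. valid_term n m t \<and> Poly_Mapping.single t (1::'k) \<notin> JF}"
    have "hf (cone_types degE P) (int z) = int (card {t \<in> ?B. ?dg t = z})"
      by (rule card_eq_hf_cone_types[symmetric, OF assms(15)[unfolded Nspan_eq]]) simp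
    also have "{t \<in> ?B. ?dg t = z} = {t. fst t \<in> ?N \<and> snd t < m \<and> ?dg t = z}"
    proof -
      have "Poly_Mapping.single t (1::'k) \<notin> JF \<longleftrightarrow> (\<forall>k<c. Poly_Mapping.lookup (fst t) k < d k)"
        if "valid_term n m t" for t
        unfolding JF_def c_def[symmetric] single_in_sub_gen_var_pow_iff[OF that cn] by (simp add: not_le)
      moreover have "valid_term n m t \<longleftrightarrow> fst t \<in> expos {..<n} \<and> snd t < m" for t
        by (simp add: valid_term_def valid_expo_def expos_def)
      ultimately show ?thesis by blast
    qed
    also have "int (card \<dots>) = ?h (int z)"
      unfolding box_hf_def by (rule card_terms_eq_sum_mon_hf) blast
    finally show ?thesis .
  qed
  have hfQ: "hf (cone_types degE Q) (int z) = int (hilb ?dg (Fmod n m :: 'k mvec set) z) - int (hilb ?dg M z)" for z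
  proof -
    let ?T = "{t \<in> {t. valid_term n m t}. ?dg t = z}"
    let ?L = "{t \<in> leads ord M. ?dg t = z}"
    let ?B = "{t. valid_term n m t \<and> Poly_Mapping.single t (1::'k) \<notin> init_sub n ord M}"
    have "hf (cone_types degE Q) (int z) = int (card {t \<in> ?B. ?dg t = z})"
      by (rule card_eq_hf_cone_types[symmetric, OF assms(13)[unfolded Nspan_eq]]) simp
    also have "{t \<in> ?B. ?dg t = z} = ?T - ?L"
      using single_in_init_sub_iff[OF mo M(1,2)] by auto
    also have "int (card (?T - ?L)) = int (card ?T) - int (card ?L)"
    proof -
      have sub: "?L \<subseteq> ?T" using leads_valid[OF M(2)] by blast
      then have "finite ?L" using finite_valid_terms' finite_subset by blast
      then show ?thesis using card_Diff_subset[OF _ sub] card_mono[OF finite_valid_terms' sub] by simp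
    qed
    also have "card ?L = hilb ?dg M z"
      by (rule hilb_eq_card_leads[symmetric, OF smod_subspace[OF M(1)] M(3) M(2)[unfolded Fmod_eq]
            finite_valid_terms' monomial_order_strict_total[OF mo]])
    also have "card ?T = hilb ?dg (Fmod n m :: 'k mvec set) z"
      unfolding Fmod_eq by (rule hilb_supp_in[symmetric, OF finite_valid_terms'])
    finally show ?thesis .
  qed
  have Qne: "Q \<noteq> {}"
  proof
    assume "Q = {}"
    have dims: "hilb ?dg M z = hilb ?dg (Fmod n m :: 'k mvec set) z" for z
      using hfQ[of z] \<open>Q = {}\<close> by (simp add: cone_types_def)
    have "M = Fmod n m"
      unfolding Fmod_eq
      by (rule graded_eq_if_hilb_eq[where dg = ?dg, OF smod_subspace[OF M(1)] subspace_supp_in M(2)[unfolded Fmod_eq] _ graded_supp_in order_refl finite_valid_terms'])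
        (simp add: dims Fmod_eq[symmetric])
    then show False using assms(12) by contradiction
  qed
  define e where "e = decomp_deg degE Q"
  have "e \<in> cdeg degE ` Q" unfolding e_def decomp_deg_def using finQ Qne by (intro Max_in) auto
  then obtain k where ek: "(e, k) \<in># cone_types degE Q" by (auto simp: in_cone_types[OF finQ])
  define b where "b = macaulay_const degE D P 1"
  have finMac: "finite (insert D {1 + cdeg degE C | C. C \<in> P \<and> cdim C \<ge> 1})"
    using finite_subset[OF _ finite_imageI[OF finP, of "\<lambda>C. 1 + cdeg degE C"],
        of "{1 + cdeg degE C | C. C \<in> P \<and> cdim C \<ge> 1}"] by blast
  \<comment> \<open>Since the Macaulay constants are at least \<open>D\<close>, a cone of
    \<open>Q\<close> in degree \<open>b\<close> or above survives the raising to
    \<open>D\<close>.\<close>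
  have Db: "D \<le> b" unfolding b_def macaulay_const_def by (rule Max_ge[OF finMac]) simp
  have posP: "i < b \<and> k \<le> n" if ik: "(i, k) \<in># cone_types degE P" "0 < k" for i k
  proof -
    obtain C where C: "C \<in> P" "i = cdeg degE C" "k = cdim C" using ik(1) by (auto simp: in_cone_types[OF finP])
    have "1 \<le> cdim C" using C(3) ik(2) by simp
    then have "1 + i \<in> insert D {1 + cdeg degE C | C. C \<in> P \<and> cdim C \<ge> 1}" using C(1,2) by blast
    then have "1 + i \<le> b" unfolding b_def macaulay_const_def by (rule Max_ge[OF finMac])
    moreover have "snd C \<subseteq> {..<n}" using assms(15) C(1) by (auto simp: cone_decomp_def)
    then have "k \<le> n" using C(3) card_mono[of "{..<n}" "snd C"] by (simp add: cdim_def)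
    ultimately show ?thesis by simp
  qed
  show ?thesis
  proof (rule ccontr)
    assume "\<not> ?thesis"
    \<comment> \<open>The bound concerns \<open>1 + e\<close>, so its failure puts \<open>e\<close>
      at or above both quantities, which is where point cones of \<open>P\<close> are
      excluded.\<close>
    then have eb: "b \<le> e" and ea: "int (\<Sum>i<c. d i) + int l - int n + 1 \<le> int e"
      unfolding b_def[symmetric] e_def[symmetric] c_def[symmetric] by auto
    obtain Q' where Q': "standard D Q'" "\<And>z. z \<ge> int D \<Longrightarrow> hf Q' z = hf (cone_types degE Q) z"
      "\<And>i j. (i, j) \<in># cone_types degE Q \<Longrightarrow> D \<le> i \<Longrightarrow> (i, j) \<in># Q'"
      using standard_raise_to[OF standard_cone_types[OF finQ assms(14)] assms(11)] by blast
    have "(e, 0) \<in># cone_types degE P"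
    proof (rule standard_bounded_by_exact[of D "Q' + R"])
      show "standard D (Q' + R)" using Q'(1) R(1) by (rule standard_union)
      show "exact D (cone_types degE P)" by (rule exact_cone_types[OF finP assms(16)])
      \<comment> \<open>\<open>Q'\<close> accounts for \<open>F/M\<close> and \<open>R\<close> for
        \<open>M/(g)F\<close>; the contribution of \<open>M\<close> cancels.\<close>
      show "hf (Q' + R) z = hf (cone_types degE P) z" if z: "int D \<le> z" for z
        using Q'(2)[OF z] R(2)[of "nat z"] hfQ[of "nat z"] hfP[of "nat z"] hilbG[of "nat z"] z by simp
      show "(e, k) \<in># Q' + R" using Q'(3)[OF ek] Db eb by simp
    qed (use posP Db eb in auto)
    moreover have "(e, 0) \<notin># cone_types degE P"
    \<comment> \<open>The constant may be negative whereas \<open>hfP\<close> speaks of natural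
      degrees, hence the truncation by \<open>nat\<close>.\<close>
    proof (rule no_point_cones[where b = b and n = n and h = ?h and a = "int (max b (nat (int (\<Sum>i<c. d i) + int l - int n + 1)))"])
      show "hf (cone_types degE P) z = ?h z" if "int (max b (nat (int (\<Sum>i<c. d i) + int l - int n + 1))) \<le> z" for z
        using hfP[of "nat z"] that by simp
      show "(fdiff ^^ n) ?h z = 0" if z: "int (max b (nat (int (\<Sum>i<c. d i) + int l - int n + 1))) \<le> z" for z
      proof -
        have "(fdiff ^^ n) (\<lambda>z. box_hf n d c (z - int (degE j))) z = 0" if "j < m" for j
        proof -
          \<comment> \<open>The summand of \<open>e_j\<close> is the box function delayed by its
            degree; the worst delay is the \<open>l\<close> in the bound.\<close>
          have "degE j \<le> l" unfolding l_def by (rule Max_ge) (use that in auto)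
          then show ?thesis unfolding fdiff_pow_shift
            using z by (intro fdiff_pow_box_hf[OF cn]) auto
        qed
        then show ?thesis by (simp add: fdiff_pow_sum)
      qed
    qed (use posP eb ea in auto)
    ultimately show False by simp
  qed
qed

end
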